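(* Let $p>5$ be prime and let $\mathcal M$ be an $n$-valent type II regular balanced Cayley map on $\mathrm{PSL}(2,p)$. Then $n\mid p(p^2-1)$. Moreover: (i) If $n=p$, then $\mathcal M\cong\mathcal{CM}^{\beta}_{\varpi(z)}$ for a unique $z\in\mathbb F_p$, $z\neq0$. (ii) If $n\mid p-1$, then $\mathcal M\cong\mathcal{CM}_{\omega(\mathrm{ii},a)}^{\alpha^{(p-1)u/n}}$ for a unique pair $(a,u)$ with $a\in\mathbb F_p$ such that: $a\neq 0$ and $a^2\neq -1$; $\gcd(u,n)=1$ and $1\le u<n/2$; if $n=3$ then $3a^2\neq-1$, $3a^2\neq -2$ and $9a^4+9a^2+1\neq 0$; if $n=5$ then $5a^4+5a^2+1\neq 0$. (iii) If $n\mid p+1$, then $\mathcal M\cong\mathcal{CM}_{\tilde\omega(\mathrm{ii},\check a)}^{\gamma^{(p+1)v/n}}$ for a unique pair $(\check a,v)$ with $\check a\in\mathbb F_p$ such that: $\check a\neq 0$ and $\check a^2\neq -e$; $\gcd(v,n)=1$ and $1\le v<n/2$; if $n=3$ then $3\check a^2\neq -e$, $3\check a^2\neq -2e$ and $9\check a^4+9\check a^2e+e^2\neq 0$; if $n=5$ then $5\check a^4+5\check a^2e+e^2\neq 0$.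
   Context: Cayley maps: for a finite group $\Gamma$ and a generating set $\Omega$ with $1\notin\Omega=\Omega^{-1}$, and a cyclic permutation $\rho$ of $\Omega$, $\mathcal{CM}(\Gamma,\Omega,\rho)$ is the cellular embedding of the Cayley graph $\mathrm{Cay}(\Gamma,\Omega)$ (vertices $\Gamma$, arcs $(\eta,\omega)$ from $\eta$ to $\eta\omega$) into a closed oriented surface determined by the cyclic order $(\eta,\omega)\mapsto(\eta,\rho(\omega))$ on arcs at each vertex. Isomorphisms are graph isomorphisms compatible with cyclic orders. Regular: automorphism group arc-transitive; balanced: $\rho(\omega^{-1})=\rho(\omega)^{-1}$ for all $\omega\in\Omega$; valency $=\#\Omega$. In a regular balanced Cayley map all elements of $\Omega$ have the same order; type II means they are all involutions (type I: they are not). Notation: for $\sigma\in\mathrm{PGL}(2,p)$, $\omega\in\mathrm{PSL}(2,p)$ ($\mathrm{PGL}(2,p)$ acting on $\mathrm{PSL}(2,p)$ by conjugation), $\mathcal{CM}_\omega^\sigma$ is $\mathcal{CM}(\mathrm{PSL}(2,p),\Omega,\rho)$ with $\Omega=\{\sigma^i\omega\sigma^{-i}\}_{i\ge1}$ and $\rho(\sigma^i\omega\sigma^{-i})=\sigma^{i+1}\omega\sigma^{-(i+1)}$. Fixed data: $e$ a generator of $\mathbb F_p^\times$; $w_1+w_2\sqrt e$ a generator of $\mathbb F_{p^2}^\times$ (with $\sqrt e$ a fixed square root of $e$ in $\mathbb F_{p^2}$) and $w=w_1/w_2\in\mathbb F_p$. Matrices: $\alpha=\begin{pmatrix} e&0\\0&1\end{pmatrix}$,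 $\beta=\begin{pmatrix}1&1\\0&1\end{pmatrix}$, $\gamma=\begin{pmatrix} w&e\\1&w\end{pmatrix}$, $\varpi(z)=\begin{pmatrix}0&-1/z\\ z&0\end{pmatrix}$, $\omega(\mathrm{ii},a)=\begin{pmatrix} a&1\\ -a^2-1&-a\end{pmatrix}$. For each $\check a\in\mathbb F_p$ choose and fix a solution $(x_{\mathrm{ii},\check a},y_{\mathrm{ii},\check a})\in\mathbb F_p^2$ of $(y+\check a)^2-ex^2=\check a^2+e$, and set $\tilde\omega(\mathrm{ii},\check a)=\begin{pmatrix} x_{\mathrm{ii},\check a} & y_{\mathrm{ii},\check a}\\ -(2\check a+y_{\mathrm{ii},\check a})/e & -x_{\mathrm{ii},\check a}\end{pmatrix}$.
   Formalization: Uniqueness of z, a and ǎ is stated up to sign (exactly z and −z, (a,u) and (−a,u), (ǎ,v) and (−ǎ,v) work), since ϖ(−z)=−ϖ(z) is the same element of PSL(2,p) and a, −a (ǎ, −ǎ) give isomorphic maps; u and v remain unique. *)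

theory Defs
  imports
    "HOL-Analysis.Determinants"
    "HOL-Algebra.Coset"
    "HOL-Algebra.Generated_Groups"
    "HOL-Computational_Algebra.Primes"
    "HOL-Combinatorics.Orbits"
    "Graph_Theory.Digraph"
begin

section \<open>Cayley maps\<close>

text \<open>
  A cellular embedding of a graph into a closed oriented surface is encoded by its rotation
  system: the digraph of arcs, together with the permutation \<open>rot\<close> sending each arc to the next
  one around its initial vertex.
\<close>

record ('v, 'd) oriented_map = "('v, 'd) pre_digraph" +
  rot :: "'d \<Rightarrow> 'd"

text \<open>
  Arc reversal is not recorded: the underlying graphs below are simple, so the reverse of an arc is
  determined by its end points and is preserved by every digraph isomorphism.
\<close>

definition oriented_map_iso ::
  "('v, 'd) oriented_map \<Rightarrow> ('w, 'c) oriented_map \<Rightarrow> ('v \<Rightarrow> 'w) \<Rightarrow> ('d \<Rightarrow> 'c) \<Rightarrow> bool" where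
  "oriented_map_iso M N f g \<longleftrightarrow>
     bij_betw f (verts M) (verts N) \<and> bij_betw g (arcs M) (arcs N) \<and>
     (\<forall>d \<in> arcs M. tail N (g d) = f (tail M d) \<and> head N (g d) = f (head M d) \<and>
                   rot N (g d) = g (rot M d))"

definition oriented_maps_isomorphic ::
  "('v, 'd) oriented_map \<Rightarrow> ('w, 'c) oriented_map \<Rightarrow> bool"  (infix \<open>\<cong>\<^sub>M\<close> 50) where
  "M \<cong>\<^sub>M N \<longleftrightarrow> (\<exists>f g. oriented_map_iso M N f g)"

definition regular_map :: "('v, 'd) oriented_map \<Rightarrow> bool" where
  "regular_map M \<longleftrightarrow>
     (\<forall>c \<in> arcs M. \<forall>d \<in> arcs M. \<exists>f g. oriented_map_iso M M f g \<and> g c = d)"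

definition cayley_map ::
  "('a, 'm) monoid_scheme \<Rightarrow> 'a set \<Rightarrow> ('a \<Rightarrow> 'a) \<Rightarrow> ('a, 'a \<times> 'a) oriented_map" where
  "cayley_map G \<Omega> \<rho> =
     \<lparr> verts = carrier G,
       arcs = carrier G \<times> \<Omega>,
       tail = (\<lambda>(\<eta>, \<omega>). \<eta>),
       head = (\<lambda>(\<eta>, \<omega>). \<eta> \<otimes>\<^bsub>G\<^esub> \<omega>),
       rot = (\<lambda>(\<eta>, \<omega>). (\<eta>, \<rho> \<omega>)) \<rparr>"

text \<open>
  The hypotheses under which \<^term>\<open>cayley_map G \<Omega> \<rho>\<close> is a Cayley map.  As \<open>\<Omega>\<close> is finite,
  \<^term>\<open>cyclic_on \<rho> \<Omega>\<close> says that \<open>\<rho>\<close> restricts to a permutation of \<open>\<Omega>\<close> with a single cycle;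
  the values of \<open>\<rho>\<close> outside \<open>\<Omega>\<close> play no role.
\<close>

definition cayley_map_data :: "('a, 'm) monoid_scheme \<Rightarrow> 'a set \<Rightarrow> ('a \<Rightarrow> 'a) \<Rightarrow> bool" where
  "cayley_map_data G \<Omega> \<rho> \<longleftrightarrow>
     group G \<and> finite (carrier G) \<and> \<Omega> \<subseteq> carrier G \<and> generate G \<Omega> = carrier G \<and>
     \<one>\<^bsub>G\<^esub> \<notin> \<Omega> \<and> m_inv G ` \<Omega> = \<Omega> \<and> cyclic_on \<rho> \<Omega>"

definition balanced :: "('a, 'm) monoid_scheme \<Rightarrow> 'a set \<Rightarrow> ('a \<Rightarrow> 'a) \<Rightarrow> bool" where
  "balanced G \<Omega> \<rho> \<longleftrightarrow> (\<forall>\<omega> \<in> \<Omega>. \<rho> (inv\<^bsub>G\<^esub> \<omega>) = inv\<^bsub>G\<^esub> (\<rho> \<omega>))"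

definition type_II :: "('a, 'm) monoid_scheme \<Rightarrow> 'a set \<Rightarrow> bool" where
  "type_II G \<Omega> \<longleftrightarrow> (\<forall>\<omega> \<in> \<Omega>. \<omega> \<noteq> \<one>\<^bsub>G\<^esub> \<and> \<omega> \<otimes>\<^bsub>G\<^esub> \<omega> = \<one>\<^bsub>G\<^esub>)"


section \<open>The groups PGL(2) and PSL(2)\<close>

definition GL2 :: "('a::field^2^2) monoid" where
  "GL2 = \<lparr>carrier = {A. invertible A}, mult = (**), one = mat 1\<rparr>"

definition SL2 :: "('a::field^2^2) monoid" where
  "SL2 = \<lparr>carrier = {A. det A = 1}, mult = (**), one = mat 1\<rparr>"

definition GL2_scalars :: "('a::field^2^2) set" where
  "GL2_scalars = {mat c | c. c \<noteq> 0}"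

definition SL2_scalars :: "('a::field^2^2) set" where
  "SL2_scalars = {mat 1, mat (- 1)}"

definition PGL2 :: "('a::field^2^2) set monoid" where
  "PGL2 = GL2 Mod GL2_scalars"

definition PSL2 :: "('a::field^2^2) set monoid" where
  "PSL2 = SL2 Mod SL2_scalars"

definition pgl :: "'a::field^2^2 \<Rightarrow> ('a^2^2) set" where
  "pgl A = GL2_scalars #>\<^bsub>GL2\<^esub> A"

definition psl :: "'a::field^2^2 \<Rightarrow> ('a^2^2) set" where
  "psl A = SL2_scalars #>\<^bsub>SL2\<^esub> A"

text \<open>
  The action of PGL(2) on PSL(2) by conjugation.  If \<open>\<sigma>\<close> is the class of \<open>S\<close> modulo scalars and \<open>\<omega>\<close>
  the class of \<open>A\<close> modulo \<open>\<plusminus>1\<close>, the set below is the class of \<open>S A S\<inverse>\<close> modulo \<open>\<plusminus>1\<close>.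
\<close>

definition conj_act :: "('a::field^2^2) set \<Rightarrow> ('a^2^2) set \<Rightarrow> ('a^2^2) set" where
  "conj_act \<sigma> \<omega> = {S \<otimes>\<^bsub>GL2\<^esub> A \<otimes>\<^bsub>GL2\<^esub> inv\<^bsub>GL2\<^esub> S | S A. S \<in> \<sigma> \<and> A \<in> \<omega>}"

text \<open>The connection set \<open>{\<sigma>\<^sup>i \<omega> \<sigma>\<^sup>-\<^sup>i}\<close> of \<open>CM\<^sup>\<sigma>\<^sub>\<omega>\<close>; its rotation is conjugation by \<open>\<sigma>\<close>.\<close>

definition conj_orbit :: "('a::field^2^2) set \<Rightarrow> ('a^2^2) set \<Rightarrow> ('a^2^2) set set" where
  "conj_orbit \<sigma> \<omega> = {conj_act (\<sigma> [^]\<^bsub>PGL2\<^esub> i) \<omega> | i::nat. i \<ge> 1}"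

definition CM :: "('a::field^2^2) set \<Rightarrow> ('a^2^2) set \<Rightarrow>
    (('a^2^2) set, ('a^2^2) set \<times> ('a^2^2) set) oriented_map" where
  "CM \<sigma> \<omega> = cayley_map PSL2 (conj_orbit \<sigma> \<omega>) (conj_act \<sigma>)"

definition CM_valid :: "('a::field^2^2) set \<Rightarrow> ('a^2^2) set \<Rightarrow> bool" where
  "CM_valid \<sigma> \<omega> \<longleftrightarrow> cayley_map_data PSL2 (conj_orbit \<sigma> \<omega>) (conj_act \<sigma>)"


section \<open>Matrices\<close>

definition mat2 :: "'a::zero \<Rightarrow> 'a \<Rightarrow> 'a \<Rightarrow> 'a \<Rightarrow> 'a^2^2" where
  "mat2 a b c d = vector [vector [a, b], vector [c, d]]"

definition mat_\<alpha> :: "'a::field \<Rightarrow> 'a^2^2" where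
  "mat_\<alpha> e = mat2 e 0 0 1"

definition mat_\<beta> :: "'a::field^2^2" where
  "mat_\<beta> = mat2 1 1 0 1"

definition mat_\<gamma> :: "'a::field \<Rightarrow> 'a \<Rightarrow> 'a^2^2" where
  "mat_\<gamma> e w = mat2 w e 1 w"

definition mat_varpi :: "'a::field \<Rightarrow> 'a^2^2" where
  "mat_varpi z = mat2 0 (- 1 / z) z 0"

definition mat_\<omega>_ii :: "'a::field \<Rightarrow> 'a^2^2" where
  "mat_\<omega>_ii a = mat2 a 1 (- a\<^sup>2 - 1) (- a)"

definition mat_\<omega>t_ii :: "'a::field \<Rightarrow> 'a \<Rightarrow> 'a \<Rightarrow> 'a \<Rightarrow> 'a^2^2" where
  "mat_\<omega>t_ii e x y a = mat2 x y (- (2 * a + y) / e) (- x)"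

definition generates_units :: "'a::field \<Rightarrow> bool" where
  "generates_units g \<longleftrightarrow> g \<noteq> 0 \<and> (\<forall>x. x \<noteq> 0 \<longrightarrow> (\<exists>k::nat. x = g ^ k))"

definition field_embedding :: "('a::field \<Rightarrow> 'b::field) \<Rightarrow> bool" where
  "field_embedding \<iota> \<longleftrightarrow>
     \<iota> 1 = 1 \<and> (\<forall>x y. \<iota> (x + y) = \<iota> x + \<iota> y) \<and> (\<forall>x y. \<iota> (x * y) = \<iota> x * \<iota> y)"


section \<open>The sign ambiguity of the parameters\<close>

text \<open>
  Elements of PSL(2) are matrices up to sign, so the parameters of the normal forms are only
  meaningful up to sign: \<open>\<varpi>(z)\<close> and \<open>\<varpi>(-z)\<close> are the same element of PSL(2), and \<open>\<omega>(ii,a)\<close> and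
  \<open>\<omega>(ii,-a)\<close> are conjugate, in PSL(2), by the diagonal matrix \<open>diag(-1,1)\<close>, which commutes with
  the powers of \<open>\<alpha>\<close>, so that they give isomorphic maps.  In the nonsplit case the same happens for
  \<open>a\<close> and \<open>-a\<close>.  Uniqueness of a parameter of this kind therefore means uniqueness up to sign.
\<close>

lemma psl_varpi_minus: "psl (mat_varpi (- z)) = psl (mat_varpi z)" for z :: "'a::field"
proof -
  have eq: "mat (- 1) ** mat_varpi (- z) = mat_varpi z" "mat (- 1) ** mat_varpi z = mat_varpi (- z)"
    by (simp_all add: vec_eq_iff forall_2 matrix_matrix_mult_def sum_2 mat_def mat_varpi_def mat2_def)
  show ?thesis
    by (auto simp: psl_def r_coset_def SL2_def SL2_scalars_def eq)
qed

lemma omega_ii_minus: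
  fixes a :: "'a::field"
  shows "mat2 (- 1) 0 0 1 ** mat_\<omega>_ii a = mat (- 1) ** mat_\<omega>_ii (- a) ** mat2 (- 1) 0 0 1"
    and "mat2 (- 1) 0 0 1 ** mat_\<alpha> e = mat_\<alpha> e ** mat2 (- 1) 0 0 1"
  by (simp_all add: vec_eq_iff forall_2 matrix_matrix_mult_def sum_2 mat_def mat_\<omega>_ii_def
      mat_\<alpha>_def mat2_def)

end

theory Submission
  imports
    Defs
    "HOL-Computational_Algebra.Polynomial"
    "HOL-Number_Theory.Residues"
begin

text \<open>
  An isomorphism between two Cayley maps whose generators are involutions is, up to a left translation,
  a group automorphism intertwining the rotations, because arc reversal forces it to act in the same way
  on the arcs at all vertices.  As every automorphism of PSL(2,p) is conjugation by a matrix, a regular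
  map of type II is a pair of a matrix \<open>S\<close> (the rotation) and a traceless matrix \<open>A\<close> of
  determinant 1, isomorphism is simultaneous conjugacy of such pairs up to scalars, and the valency is
  the order of \<open>S\<close> in PGL(2,p).  A nonscalar \<open>S\<close> is conjugate up to scalars to \<open>\<beta>\<close>, to a power
  of \<open>\<alpha>\<close> or to a power of \<open>\<gamma>\<close>; the last two cases are treated together as a torus of matrices
  \<open>x + yJ\<close> with \<open>J\<^sup>2 = \<delta>\<close>, where \<open>\<delta> = 1\<close> or \<open>\<delta> = e\<close> and \<open>a\<close> is read off from the trace of \<open>JA\<close>.

  The excluded parameters are those for which \<open>S\<close> and \<open>A\<close> permute a nonempty set of fewer than \<open>p\<close>
  lines of traceless matrices.  If the connection set generated PSL(2,p), the unipotent elements, of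
  order \<open>p\<close>, would fix every such line, which is impossible.
\<close>

section \<open>Two by two matrices\<close>

text \<open>Generation is part of the hypothesis on the given map. Hence an excluded parameter is
  refuted by a configuration of lines that contradicts generation, and a normal form is valid
  because generation is transported to it along the isomorphism.

  The polynomials arise as follows. In valency 3 let t be the trace of the product of two
  consecutive generators; it is an affine function of a^2, and the values t = 0, t = -1 and t^2 + t
  = 1 give the three conditions. In valency 5 the condition says that the axis \<open>J\<close> and
  its images under the half-turns of the five generators are not the six fivefold axes of an
  icosahedral group.

  The ambiguity of the parameters has two sources. \<open>A\<close> is known up to sign, so the
  trace of \<open>JA\<close>, and with it a, is known up to sign. A torus element is conjugate to
  its inverse, so the exponent is known up to u and n - u, and 2u < n selects one of them. Once the
  exponents agree, the conjugating matrix commutes with \<open>J\<close>, which makes the trace of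
  \<open>JA\<close> an invariant up to sign.\<close>

lemma mat2_nth [simp]:
  "mat2 a b c d $ 1 $ 1 = a" "mat2 a b c d $ 1 $ 2 = b"
  "mat2 a b c d $ 2 $ 1 = c" "mat2 a b c d $ 2 $ 2 = d"
  by (simp_all add: mat2_def)

lemma mat2_eq_iff [simp]:
  "mat2 a b c d = mat2 a' b' c' d' \<longleftrightarrow> a = a' \<and> b = b' \<and> c = c' \<and> d = d'"
  by (auto simp: vec_eq_iff forall_2)

lemma mat2_cases: obtains a b c d where "A = mat2 a b c d"
proof -
  have "A = mat2 (A$1$1) (A$1$2) (A$2$1) (A$2$2)" by (simp add: vec_eq_iff forall_2)
  then show ?thesis by (rule that)
qed

lemma mat2_mult:
  fixes a :: "'a::comm_ring_1"
  shows "mat2 a b c d ** mat2 a' b' c' d' =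
    mat2 (a * a' + b * c') (a * b' + b * d') (c * a' + d * c') (c * b' + d * d')"
  by (simp add: vec_eq_iff forall_2 matrix_matrix_mult_def sum_2)

lemma mat_mat2: "mat c = mat2 c 0 0 c"
  by (simp add: vec_eq_iff forall_2 mat_def)

lemma det_mat2: "det (mat2 a b c d) = a * d - b * (c::'a::comm_ring_1)"
  by (simp add: det_2)

lemma mat2_arith:
  "mat2 a b c d + mat2 a' b' c' d' = mat2 (a + a') (b + b') (c + c') (d + d')"
  "mat2 a b c d - mat2 a' b' c' d' = mat2 (a - a') (b - b') (c - c') (d - (d'::'a::ab_group_add))"
  "- mat2 a b c d = mat2 (- a) (- b) (- c) (- d)"
  "0 = mat2 0 0 0 (0::'a)"
  by (simp_all add: vec_eq_iff forall_2)

definition tr :: "'a::comm_ring_1^2^2 \<Rightarrow> 'a" where "tr A = A $ 1 $ 1 + A $ 2 $ 2"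

lemma tr_mat2: "tr (mat2 a b c d) = a + d"
  by (simp add: tr_def)

text \<open>The adjugate over the determinant, so that \<open>mat2\<close> arithmetic evaluates it
  entrywise.\<close>

definition minv :: "'a::field^2^2 \<Rightarrow> 'a^2^2" where
  "minv A = mat2 (A$2$2 / det A) (- A$1$2 / det A) (- A$2$1 / det A) (A$1$1 / det A)"

lemmas mat2_simps = mat2_mult mat_mat2 det_mat2 mat2_arith tr_mat2

lemma minv_right [simp]: "det A \<noteq> 0 \<Longrightarrow> A ** minv A = mat 1"
  by (cases A rule: mat2_cases)
    (simp add: minv_def mat2_simps add_divide_distrib[symmetric] diff_divide_distrib[symmetric] algebra_simps)

lemma minv_left [simp]: "det A \<noteq> 0 \<Longrightarrow> minv A ** A = mat 1"
  by (cases A rule: mat2_cases)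
    (simp add: minv_def mat2_simps add_divide_distrib[symmetric] diff_divide_distrib[symmetric] algebra_simps)

lemma det_times [simp]: "det (A ** B) = det A * det (B::'a::field^2^2)"
  by (rule det_mul)

lemma det_scal [simp]: "det (mat c :: 'a::field^2^2) = c\<^sup>2"
  by (simp add: mat2_simps power2_eq_square)

lemma det_minv: "det A \<noteq> 0 \<Longrightarrow> det (minv A) = 1 / det A"
proof -
  assume "det A \<noteq> 0"
  then have "det A * det (minv A) = 1" by (metis det_times minv_right det_scal one_power2)
  with \<open>det A \<noteq> 0\<close> show ?thesis by (simp add: field_simps)
qed

lemma det_minv_nz [simp]: "det A \<noteq> 0 \<Longrightarrow> det (minv A) \<noteq> 0"
  by (simp add: det_minv)

lemma mat_times_comm: "A ** mat c = mat c ** (A::'a::field^2^2)"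
  by (cases A rule: mat2_cases) (simp add: mat2_simps mult.commute)

lemma mat_mat_times [simp]: "mat c ** mat d = (mat (c * d) :: 'a::field^2^2)"
  by (simp add: mat2_simps)

lemma mat_mat_times' [simp]: "mat c ** (mat d ** A) = mat (c * d) ** (A::'a::field^2^2)"
  by (simp add: matrix_mul_assoc)

lemma mat_uminus: "mat (- 1) ** A = - (A::'a::field^2^2)"
  by (cases A rule: mat2_cases) (simp add: mat2_simps)

lemma mul_uminus [simp]:
  fixes A B :: "'a::field^2^2"
  shows "(- A) ** B = - (A ** B)" "A ** (- B) = - (A ** B)"
  by (cases A rule: mat2_cases, cases B rule: mat2_cases, simp add: mat2_simps)+

lemma det_uminus2 [simp]: "det (- A) = det (A::'a::field^2^2)"
  by (cases A rule: mat2_cases, simp add: mat2_simps)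

lemma mat_left_move: "A ** (mat c ** B) = mat c ** ((A::'a::field^2^2) ** (B::'a^2^2))"
  by (simp add: matrix_mul_assoc mat_times_comm[of A])

lemma minv_cancel [simp]:
  "det A \<noteq> 0 \<Longrightarrow> minv A ** (A ** B) = (B::'a::field^2^2)"
  "det A \<noteq> 0 \<Longrightarrow> A ** (minv A ** B) = (B::'a::field^2^2)"
  "det A \<noteq> 0 \<Longrightarrow> B ** A ** minv A = (B::'a::field^2^2)"
  "det A \<noteq> 0 \<Longrightarrow> B ** minv A ** A = (B::'a::field^2^2)"
  by (simp_all add: matrix_mul_assoc) (simp_all add: matrix_mul_assoc[symmetric])

lemma cancel_left: "det A \<noteq> 0 \<Longrightarrow> A ** B = A ** C \<longleftrightarrow> B = (C::'a::field^2^2)"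
  by (metis minv_cancel(1))

lemma cancel_right: "det A \<noteq> 0 \<Longrightarrow> B ** A = C ** A \<longleftrightarrow> B = (C::'a::field^2^2)"
  by (metis minv_cancel(3))

lemma minv_unique: "A ** B = mat 1 \<Longrightarrow> minv A = (B::'a::field^2^2)"
proof -
  assume *: "A ** B = mat 1"
  then have "det A * det B = 1" by (metis det_times det_scal one_power2)
  then have "det A \<noteq> 0" by auto
  then show ?thesis by (metis * cancel_left minv_right)
qed

lemma minv_mult: "det A \<noteq> 0 \<Longrightarrow> det B \<noteq> 0 \<Longrightarrow> minv (A ** B) = minv B ** minv (A::'a::field^2^2)"
  by (rule minv_unique) (simp add: matrix_mul_assoc)

lemma minv_minv [simp]: "det A \<noteq> 0 \<Longrightarrow> minv (minv A) = (A::'a::field^2^2)"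
  by (rule minv_unique) simp

lemma scal_cancel: "c \<noteq> 0 \<Longrightarrow> mat c ** A = mat c ** B \<longleftrightarrow> A = (B::'a::field^2^2)"
  by (rule cancel_left) simp

section \<open>Matrix powers, scalar matrices and conjugacy\<close>

primrec mpow :: "'a::field^2^2 \<Rightarrow> nat \<Rightarrow> 'a^2^2" where
  "mpow A 0 = mat 1"
| "mpow A (Suc k) = A ** mpow A k"

lemma mpow_add: "mpow A (j + k) = mpow A j ** mpow A k"
  by (induction j) (auto simp: matrix_mul_assoc)

lemma mpow_comm: "mpow A j ** mpow A k = mpow A k ** mpow A j"
  by (metis add.commute mpow_add)

lemma mpow_1 [simp]: "mpow A 1 = A" "mpow A (Suc 0) = A"
  by simp_all

lemma mpow_Suc2: "mpow A (Suc k) = mpow A k ** A"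
  using mpow_comm[of A 1 k] by simp

lemma mpow_mult: "mpow A (j * k) = mpow (mpow A j) k"
  by (induction k) (auto simp: mpow_add)

lemma det_mpow [simp]: "det (mpow A k) = det A ^ k"
  by (induction k) auto

lemma mpow_scal: "mpow (mat c ** A) k = mat (c ^ k) ** mpow A k"
  proof (induction k)
  case (Suc k)
  have "mpow (mat c ** A) (Suc k) = mat c ** (A ** (mat (c ^ k) ** mpow A k))"
    by (simp add: Suc matrix_mul_assoc)
  then show ?case by (simp add: mat_left_move[of A])
qed simp

lemma mpow_intertwine: "P ** A = B ** P \<Longrightarrow> P ** mpow A k = mpow B k ** P"
  by (induction k) (auto, metis matrix_mul_assoc)

text \<open>Zero is included. For an invertible matrix this says that its class in PGL(2) is
  trivial, so \<open>scalar (mpow S k)\<close> expresses that k is a multiple of the order of that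
  class.\<close>

definition scalar :: "'a::field^2^2 \<Rightarrow> bool" where "scalar A \<longleftrightarrow> (\<exists>c. A = mat c)"

lemma scalar_mat [simp]: "scalar (mat c)"
  by (auto simp: scalar_def)

lemma scalar_mat2: "scalar (mat2 a b c d) \<longleftrightarrow> b = 0 \<and> c = 0 \<and> a = d"
  by (auto simp: scalar_def mat2_simps)

lemma scalar_scal: "c \<noteq> 0 \<Longrightarrow> scalar (mat c ** A) \<longleftrightarrow> scalar A"
  by (cases A rule: mat2_cases) (auto simp: mat2_simps scalar_mat2)

lemma scalar_conj:
  assumes "P ** A = mat c ** B ** P" "det P \<noteq> 0" "c \<noteq> 0" shows "scalar A \<longleftrightarrow> scalar B"
proof
  assume "scalar A"
  then obtain d where "A = mat d" by (auto simp: scalar_def)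
  then have "mat c ** B ** P = mat d ** P" using assms by (simp add: mat_times_comm[of P])
  then have "mat c ** B = mat d" using assms cancel_right by blast
  then have "scalar (mat c ** B)" by simp
  then show "scalar B" using assms scalar_scal by blast
next
  assume "scalar B"
  then obtain d where "B = mat d" by (auto simp: scalar_def)
  then have "P ** A = P ** mat (c * d)" using assms by (simp add: mat_times_comm[of P])
  then show "scalar A" using assms cancel_left by (metis scalar_mat)
qed

lemma mpow_conj_scal:
  assumes "P ** A = mat c ** B ** P" shows "P ** mpow A k = mat (c ^ k) ** mpow B k ** P"
  using mpow_intertwine[OF assms, of k] by (simp add: mpow_scal)

lemma tr_conj: "P ** A = B ** P \<Longrightarrow> det P \<noteq> 0 \<Longrightarrow> tr A = tr (B::'a::field^2^2)"
proof -
  assume *: "P ** A = B ** P" "det P \<noteq> 0"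
  have comm: "tr (X ** Y) = tr (Y ** X)" for X Y :: "'a^2^2"
    by (cases X rule: mat2_cases, cases Y rule: mat2_cases) (simp add: mat2_simps algebra_simps)
  have "A = minv P ** (B ** P)" using * by (metis matrix_mul_assoc matrix_mul_lid minv_left)
  then have "tr A = tr (B ** P ** minv P)" by (metis comm)
  then show ?thesis using * by (metis matrix_mul_assoc matrix_mul_rid minv_right)
qed

lemma tr_commute: "tr (X ** Y) = tr (Y ** (X::'a::field^2^2))"
  by (cases X rule: mat2_cases, cases Y rule: mat2_cases) (simp add: mat2_simps algebra_simps)

text \<open>A nonscalar matrix has a cyclic vector v, and in the basis v, Sv it becomes the
  companion matrix of its characteristic polynomial. The columns of the inverse of each
  \<open>P\<close> below form such a basis, with v proportional to the first unit vector, to the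
  second one, or to their difference.\<close>

lemma conj_similar_companion:
  fixes S :: "'a::field^2^2"
  assumes "\<not> scalar S"
  obtains P where "det P \<noteq> 0" "P ** S = mat2 0 (- det S) 1 (tr S) ** P"
proof -
  obtain a b c d where S: "S = mat2 a b c d" by (rule mat2_cases)
  consider "c \<noteq> 0" | "c = 0" "b \<noteq> 0" | "c = 0" "b = 0" "a \<noteq> d"
    using assms by (auto simp: S scalar_mat2)
  then show thesis
  proof cases
    case 1
    then show ?thesis by (intro that[of "mat2 c (- a) 0 1"]) (auto simp: S mat2_simps algebra_simps)
  next
    case 2
    then show ?thesis by (intro that[of "mat2 (- d) b 1 0"]) (auto simp: S mat2_simps algebra_simps)
  next
    case 3
    then show ?thesis by (intro that[of "mat2 (- d) (- a) 1 1"]) (auto simp: S mat2_simps algebra_simps)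
  qed
qed

lemma conj_similar:
  fixes S T :: "'a::field^2^2"
  assumes "\<not> scalar S" "\<not> scalar T" "det S = det T" "tr S = tr T"
  obtains P where "det P \<noteq> 0" "P ** S = T ** P"
proof -
  obtain P where P: "det P \<noteq> 0" "P ** S = mat2 0 (- det S) 1 (tr S) ** P"
    using conj_similar_companion[OF assms(1)] by blast
  obtain Q where Q: "det Q \<noteq> 0" "Q ** T = mat2 0 (- det T) 1 (tr T) ** Q"
    using conj_similar_companion[OF assms(2)] by blast
  have "minv Q ** P ** S = minv Q ** (mat2 0 (- det S) 1 (tr S) ** P)"
    using P by (simp add: matrix_mul_assoc[symmetric])
  also have "\<dots> = minv Q ** (Q ** T ** minv Q) ** P"
    using Q by (simp add: assms) (metis matrix_mul_assoc matrix_mul_rid minv_right)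
  also have "\<dots> = T ** (minv Q ** P)"
    using Q by (metis matrix_mul_assoc matrix_mul_lid minv_left)
  finally show thesis using that[of "minv Q ** P"] P Q by simp
qed

section \<open>Finite prime fields and conjugacy classes of matrices\<close>

text \<open>The least positive exponent \<open>m\<close> with g^m = 1 counts the units: the powers
  below \<open>m\<close> are distinct, and by periodicity they exhaust the nonzero elements.\<close>

lemma generator_power_eq_1_iff:
  fixes g :: "'a::{field,finite}"
  assumes "generates_units g"
  shows "g ^ k = 1 \<longleftrightarrow> (CARD('a) - 1) dvd k"
proof -
  have g0: "g \<noteq> 0" and gen: "\<And>x. x \<noteq> 0 \<Longrightarrow> \<exists>k::nat. x = g ^ k"
    using assms by (auto simp: generates_units_def)
  \<comment> \<open>\<open>generates_units\<close> speaks of natural exponents, so the inverse of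
    \<open>g\<close> is itself a power; this provides a positive exponent for
    \<open>LEAST\<close>.\<close>
  obtain j where j: "inverse g = g ^ j" using gen[of "inverse g"] g0 by auto
  then have ex: "g ^ Suc j = 1" using g0 by (metis power_Suc right_inverse)
  define m where "m = (LEAST m. 0 < m \<and> g ^ m = 1)"
  have m: "0 < m" "g ^ m = 1"
    using LeastI[of "\<lambda>m. 0 < m \<and> g ^ m = 1" "Suc j"] ex unfolding m_def by auto
  have least: "m \<le> i" if "0 < i" "g ^ i = 1" for i
    using that unfolding m_def by (auto intro: Least_le)
  have md: "g ^ i = g ^ (i mod m)" for i
  proof -
    have "g ^ i = g ^ (m * (i div m) + i mod m)" by simp
    also have "\<dots> = (g ^ m) ^ (i div m) * g ^ (i mod m)" by (simp only: power_add power_mult)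
    finally show ?thesis by (simp add: m)
  qed
  have "{x::'a. x \<noteq> 0} = (\<lambda>i. g ^ i) ` {..<m}"
  proof (intro subset_antisym subsetI)
    fix x :: 'a assume "x \<in> {x. x \<noteq> 0}"
    then obtain i where "x = g ^ i" using gen by auto
    then have "x = g ^ (i mod m)" using md by simp
    then show "x \<in> (\<lambda>i. g ^ i) ` {..<m}" using m by auto
  qed (use g0 in auto)
  moreover have "inj_on (\<lambda>i. g ^ i) {..<m}"
  proof (rule linorder_inj_onI')
    fix a b assume ab: "a \<in> {..<m}" "b \<in> {..<m}" "a < b"
    show "g ^ a \<noteq> g ^ b"
    proof
      assume "g ^ a = g ^ b"
      moreover have "g ^ b = g ^ a * g ^ (b - a)" using ab by (simp flip: power_add)
      ultimately have "g ^ (b - a) = 1" using g0 by simp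
      then show False using least[of "b - a"] ab by auto
    qed
  qed
  ultimately have "card {x::'a. x \<noteq> 0} = m" by (simp add: card_image)
  moreover have "card {x::'a. x \<noteq> 0} = CARD('a) - 1"
    using card_Diff_singleton[of "0::'a" UNIV] by (simp add: set_diff_eq)
  ultimately have mm: "m = CARD('a) - 1" by simp
  show ?thesis
  proof
    assume "g ^ k = 1"
    then have "g ^ (k mod m) = 1" using md by simp
    then have "\<not> 0 < k mod m" using least[of "k mod m"] m by (metis mod_less_divisor not_le)
    then show "CARD('a) - 1 dvd k" using mm by auto
  next
    assume "CARD('a) - 1 dvd k"
    then show "g ^ k = 1" using m mm by (auto simp: power_mult)
  qed
qed

lemma unit_power_card:
  fixes g x :: "'a::{field,finite}"
  assumes "generates_units g" "x \<noteq> 0" shows "x ^ (CARD('a) - 1) = 1"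
proof -
  obtain k where "x = g ^ k" using assms by (auto simp: generates_units_def)
  then show ?thesis using assms by (simp add: generator_power_eq_1_iff flip: power_mult)
qed

lemma CHAR_prime_card:
  assumes "prime CARD('a::{field,finite})" shows "CHAR('a) = CARD('a)"
proof -
  have "CHAR('a) dvd CARD('a)" by (rule CHAR_dvd_CARD)
  moreover have "CHAR('a) \<noteq> 1" using of_nat_CHAR[where 'a = 'a] by (metis of_nat_1 zero_neq_one)
  ultimately show ?thesis using assms prime_nat_iff by auto
qed

lemma prime_field_of_nat:
  fixes x :: "'a::{field,finite}"
  assumes "prime CARD('a)"
  obtains m where "m < CARD('a)" "x = of_nat m"
proof -
  have "inj_on (of_nat :: nat \<Rightarrow> 'a) {..<CARD('a)}"
    by (auto intro!: inj_onI simp: of_nat_eq_iff_cong_CHAR CHAR_prime_card[OF assms] cong_def)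
  then have "card ((of_nat :: nat \<Rightarrow> 'a) ` {..<CARD('a)}) = CARD('a)" by (simp add: card_image)
  then have "(of_nat :: nat \<Rightarrow> 'a) ` {..<CARD('a)} = UNIV"
    by (metis card_subset_eq finite subset_UNIV)
  then have "x \<in> of_nat ` {..<CARD('a)}" by simp
  then show ?thesis using that by auto
qed

lemma of_nat_nonzero:
  assumes "prime CARD('a::{field,finite})" "0 < m" "m < CARD('a)"
  shows "of_nat m \<noteq> (0::'a)"
  using assms by (auto simp: of_nat_eq_0_iff_char_dvd CHAR_prime_card dest: dvd_imp_le)

lemma small_numerals_nonzero:
  assumes "prime CARD('a::{field,finite})" "CARD('a) > 5"
  shows "(2::'a) \<noteq> 0" "(3::'a) \<noteq> 0" "(4::'a) \<noteq> 0" "(5::'a) \<noteq> 0"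
  using of_nat_nonzero[OF assms(1), of 2] of_nat_nonzero[OF assms(1), of 3]
    of_nat_nonzero[OF assms(1), of 4] of_nat_nonzero[OF assms(1), of 5] assms by auto

lemma prime_card_even:
  assumes "prime CARD('a::finite)" "CARD('a) > 5" shows "even (CARD('a) - 1)"
  using assms prime_odd_nat[of "CARD('a)"] by auto

text \<open>If e = f^2 with f = e^k, then e = e^(2k), and the even order p - 1 would divide the odd
  number 2k - 1.\<close>

lemma generator_nonsquare:
  fixes e f :: "'a::{field,finite}"
  assumes "prime CARD('a)" "CARD('a) > 5" "generates_units e"
  shows "e \<noteq> f\<^sup>2"
proof
  assume ef: "e = f\<^sup>2"
  then have "f \<noteq> 0" using assms by (auto simp: generates_units_def)
  then obtain k where "f = e ^ k" using assms by (auto simp: generates_units_def)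
  then have *: "e = e ^ (2 * k)" using ef by (simp add: power_mult mult.commute[of 2])
  have "e \<noteq> 0" using assms by (auto simp: generates_units_def)
  have "k \<noteq> 0"
  proof
    assume "k = 0"
    then have "e ^ 1 = 1" using * by simp
    then have "(CARD('a) - 1) dvd 1" using generator_power_eq_1_iff[OF assms(3)] by blast
    then show False using assms by auto
  qed
  then have "e ^ (2 * k) = e * e ^ (2 * k - 1)" by (cases k) auto
  then have "e ^ (2 * k - 1) = 1" using * \<open>e \<noteq> 0\<close> by simp
  then have "(CARD('a) - 1) dvd (2 * k - 1)" using generator_power_eq_1_iff[OF assms(3)] by blast
  then have "even (2 * k - 1)" using prime_card_even[OF assms(1,2)] dvd_trans by blast
  then show False using \<open>k \<noteq> 0\<close> by auto
qed

text \<open>Decided by the parity of the exponent of \<open>d\<close> as a power of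
  \<open>e\<close>; it sorts the discriminants in \<open>trichotomy\<close>.\<close>

lemma square_or_nonsquare:
  fixes e d :: "'a::{field,finite}"
  assumes "generates_units e"
  obtains f where "d = f\<^sup>2" | f where "d = e * f\<^sup>2"
proof (cases "d = 0")
  case True
  then show ?thesis using that(1)[of 0] by simp
next
  case False
  then obtain k where k: "d = e ^ k" using assms by (auto simp: generates_units_def)
  show ?thesis
  proof (cases "even k")
    case True
    then have "d = (e ^ (k div 2))\<^sup>2" using k by (simp flip: power_mult)
    then show ?thesis by (rule that(1))
  next
    case False
    then have "d = e * (e ^ (k div 2))\<^sup>2" using k by (metis power_Suc power_mult odd_two_times_div_two_succ mult.commute Suc_eq_plus1)
    then show ?thesis by (rule that(2))
  qed
qed

lemma mpow_alpha: "mpow (mat_\<alpha> e) k = mat2 (e ^ k) 0 0 1"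
  by (induction k) (auto simp: mat_\<alpha>_def mat2_simps)

lemma mpow_beta: "mpow mat_\<beta> k = mat2 1 (of_nat k) 0 1"
  by (induction k) (auto simp: mat_\<beta>_def mat2_simps)

lemma scalar_mpow_alpha:
  fixes e :: "'a::{field,finite}"
  assumes "generates_units e"
  shows "scalar (mpow (mat_\<alpha> e) k) \<longleftrightarrow> (CARD('a) - 1) dvd k"
  using generator_power_eq_1_iff[OF assms] by (simp add: mpow_alpha scalar_mat2)

lemma scalar_mpow_beta:
  assumes "prime CARD('a::{field,finite})"
  shows "scalar (mpow (mat_\<beta> :: 'a^2^2) k) \<longleftrightarrow> CARD('a) dvd k"
  using CHAR_prime_card[OF assms] by (simp add: mpow_beta scalar_mat2 of_nat_eq_0_iff_char_dvd)

lemma card_roots_of_unity: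
  fixes k :: nat assumes "k > 0"
  shows "card {x::'a::{field,finite}. x ^ k = 1} \<le> k"
proof -
  define q :: "'a poly" where "q = Polynomial.monom 1 k - 1"
  have "Polynomial.coeff q k = 1" using assms by (simp add: q_def)
  then have "q \<noteq> 0" by auto
  moreover have "Polynomial.degree q \<le> k"
    unfolding q_def by (intro Polynomial.degree_diff_le) (auto simp: degree_monom_le)
  moreover have "{x::'a. x ^ k = 1} = {x. poly q x = 0}"
    by (auto simp: q_def poly_monom)
  ultimately show ?thesis using card_poly_roots_bound[of q] by simp
qed

locale quadratic_extension =
  fixes e w1 w2 :: "'a::{field,finite}" and \<iota> :: "'a \<Rightarrow> 'b::{field,finite}" and s :: 'b
  assumes prime: "prime CARD('a)" and gt5: "CARD('a) > 5"
    and gen_e: "generates_units e"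
    and card_b: "CARD('b) = CARD('a)\<^sup>2"
    and emb: "field_embedding \<iota>" and s: "s\<^sup>2 = \<iota> e"
    and gen_b: "generates_units (\<iota> w1 + \<iota> w2 * s)"
begin

lemma emb_simps: "\<iota> 1 = 1" "\<iota> (a + b) = \<iota> a + \<iota> b" "\<iota> (a * b) = \<iota> a * \<iota> b"
  using emb by (auto simp: field_embedding_def)

lemma emb_0: "\<iota> 0 = 0"
  using emb_simps(2)[of 0 0] by (metis add_cancel_right_right add_0_left)

lemma emb_power: "\<iota> (a ^ k) = \<iota> a ^ k"
  by (induction k) (auto simp: emb_simps)

lemma emb_eq_0: "\<iota> a = 0 \<longleftrightarrow> a = 0"
proof
  assume "\<iota> a = 0"
  then show "a = 0" using emb_simps(1) emb_simps(3)[of a "inverse a"] by (cases "a = 0") auto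
qed (simp add: emb_0)

lemma emb_diff: "\<iota> (a - b) = \<iota> a - \<iota> b"
  using emb_simps(2)[of "a - b" b] by (simp add: algebra_simps)

lemma emb_inj: "\<iota> a = \<iota> b \<longleftrightarrow> a = b"
  using emb_eq_0[of "a - b"] by (simp add: emb_diff)

section \<open>The field with p^2 elements and the nonsplit torus\<close>

definition ext :: "'a \<Rightarrow> 'a \<Rightarrow> 'b" where "ext a b = \<iota> a + \<iota> b * s"

text \<open>1 and \<open>s\<close> are independent over the prime field: a second representation
  would exhibit \<open>e\<close> as the square of (a' - a) / (b - b').\<close>

lemma ext_inj: "ext a b = ext a' b' \<longleftrightarrow> a = a' \<and> b = b'"
proof
  assume *: "ext a b = ext a' b'"
  have "b = b'"
  proof (rule ccontr)
    assume "b \<noteq> b'"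
    then have nz: "\<iota> (b - b') \<noteq> 0" by (simp add: emb_eq_0)
    have "\<iota> (b - b') * s = \<iota> (a' - a)" using * by (simp add: ext_def emb_diff algebra_simps)
    then have "\<iota> (b - b') ^ 2 * \<iota> e = \<iota> (a' - a) ^ 2" by (metis s power_mult_distrib)
    then have "\<iota> ((b - b')\<^sup>2 * e) = \<iota> ((a' - a)\<^sup>2)" by (simp add: emb_simps emb_power)
    then have "(b - b')\<^sup>2 * e = (a' - a)\<^sup>2" by (simp add: emb_inj)
    then have "e = ((a' - a) / (b - b'))\<^sup>2" using \<open>b \<noteq> b'\<close> by (simp add: field_simps power_divide)
    then show False using generator_nonsquare[OF prime gt5 gen_e] by blast
  qed
  then show "a = a' \<and> b = b'" using * by (simp add: ext_def emb_inj)
qed simp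

lemma ext_mult: "ext a b * ext c d = ext (a * c + e * b * d) (a * d + b * c)"
proof -
  have "ext a b * ext c d = \<iota> a * \<iota> c + \<iota> b * \<iota> d * s\<^sup>2 + (\<iota> a * \<iota> d + \<iota> b * \<iota> c) * s"
    by (simp add: ext_def algebra_simps power2_eq_square)
  then show ?thesis by (simp add: ext_def emb_simps s algebra_simps)
qed

text \<open>\<open>mat2 a (e * b) b a\<close> is multiplication by a + b sqrt(e) in the basis 1,
  sqrt(e), so the rule mirrors \<open>ext_mult\<close>.\<close>

lemma torus_mult:
  "mat2 a (e * b) b a ** mat2 c (e * d) d c =
    mat2 (a * c + e * b * d) (e * (a * d + b * c)) (a * d + b * c) (a * c + e * b * d)"
  by (simp add: mat2_simps algebra_simps)

lemma power_gen:
  "\<exists>a b. mpow (mat2 w1 (e * w2) w2 w1) k = mat2 a (e * b) b a \<and> (\<iota> w1 + \<iota> w2 * s) ^ k = ext a b"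
proof (induction k)
  case 0
  show ?case by (rule exI[of _ 1], rule exI[of _ 0]) (simp add: mat2_simps ext_def emb_simps emb_0)
next
  case (Suc k)
  then obtain a b where ab: "mpow (mat2 w1 (e * w2) w2 w1) k = mat2 a (e * b) b a"
    "(\<iota> w1 + \<iota> w2 * s) ^ k = ext a b" by blast
  have "(\<iota> w1 + \<iota> w2 * s) ^ Suc k = ext w1 w2 * ext a b" by (simp only: power_Suc ab ext_def[of w1 w2])
  then show ?case unfolding ext_mult mpow.simps ab torus_mult by blast
qed

lemma card_sq: "CARD('b) - 1 = (CARD('a) + 1) * (CARD('a) - 1)"
  using gt5 by (simp add: card_b power2_eq_square algebra_simps)

text \<open>Otherwise the generator would lie in the embedded prime field, where orders divide p -
  1, which is less than p^2 - 1.\<close>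

lemma w2_nonzero: "w2 \<noteq> 0"
proof
  assume "w2 = 0"
  then have g: "generates_units (\<iota> w1)" using gen_b by (simp add: emb_0)
  then have "w1 \<noteq> 0" by (auto simp: generates_units_def emb_0)
  then have "\<iota> w1 ^ (CARD('a) - 1) = 1" using unit_power_card[OF gen_e, of w1] by (simp add: emb_simps flip: emb_power)
  then have "(CARD('b) - 1) dvd (CARD('a) - 1)" using generator_power_eq_1_iff[OF g] by blast
  then have "CARD('b) - 1 \<le> CARD('a) - 1" using gt5 by (auto dest: dvd_imp_le)
  moreover have "CARD('a) + 1 \<le> (CARD('a) + 1) * (CARD('a) - 1)"
    using gt5 mult_le_mono2[of 1 "CARD('a) - 1" "CARD('a) + 1"] by simp
  ultimately show False unfolding card_sq by linarith
qed

abbreviation "g0 \<equiv> mat_\<gamma> e (w1 / w2)"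

lemma gen_mat: "mat2 w1 (e * w2) w2 w1 = mat w2 ** g0"
  using w2_nonzero by (simp add: mat_\<gamma>_def mat2_simps)

text \<open>The norm form is anisotropic because \<open>e\<close> is not a square.\<close>

lemma torus_det_nonzero: "a \<noteq> 0 \<or> b \<noteq> 0 \<Longrightarrow> a\<^sup>2 - e * b\<^sup>2 \<noteq> 0"
proof
  assume ab: "a \<noteq> 0 \<or> b \<noteq> 0" "a\<^sup>2 - e * b\<^sup>2 = 0"
  then have "b \<noteq> 0" by auto
  then have "e = (a / b)\<^sup>2" using ab by (simp add: power_divide field_simps)
  then show False using generator_nonsquare[OF prime gt5 gen_e] by blast
qed

lemma det_gamma: "det g0 \<noteq> 0"
  using torus_det_nonzero[of "w1 / w2" 1] by (simp add: mat_\<gamma>_def mat2_simps power2_eq_square)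

text \<open>The units of the embedded prime field are p - 1 roots of x^(p-1) = 1, and by
  \<open>card_roots_of_unity\<close> there are no others.\<close>

lemma in_base_iff: "x \<noteq> 0 \<Longrightarrow> x ^ (CARD('a) - 1) = 1 \<longleftrightarrow> x \<in> range \<iota>"
proof -
  assume "x \<noteq> 0"
  have sub: "\<iota> ` (UNIV - {0}) \<subseteq> {x. x ^ (CARD('a) - 1) = 1}"
    using unit_power_card[OF gen_e] by (auto simp: emb_simps simp flip: emb_power)
  have "card (\<iota> ` (UNIV - {0})) = CARD('a) - 1"
    by (subst card_image) (auto simp: inj_on_def emb_inj)
  then have "\<iota> ` (UNIV - {0}) = {x. x ^ (CARD('a) - 1) = 1}"
    using sub card_roots_of_unity[of "CARD('a) - 1", where 'a = 'b] gt5
    by (intro card_seteq) auto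
  then show ?thesis using \<open>x \<noteq> 0\<close> emb_0 by (auto simp: set_eq_iff)
qed

text \<open>Up to the scalar \<open>w2\<close>, \<open>g0\<close> is multiplication by the chosen
  generator, and scalar matrices correspond to the embedded prime field, cut out by x^(p-1) = 1. The
  condition (p+1)(p-1) dvd k(p-1) then loses its factor p - 1.\<close>

lemma scalar_mpow_gamma: "scalar (mpow g0 k) \<longleftrightarrow> (CARD('a) + 1) dvd k"
proof -
  obtain a b where ab: "mpow (mat2 w1 (e * w2) w2 w1) k = mat2 a (e * b) b a"
    "(\<iota> w1 + \<iota> w2 * s) ^ k = ext a b" using power_gen by blast
  have nz: "ext a b \<noteq> 0" unfolding ab(2)[symmetric] using gen_b by (simp add: generates_units_def)
  have "scalar (mpow g0 k) \<longleftrightarrow> scalar (mpow (mat2 w1 (e * w2) w2 w1) k)"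
    unfolding gen_mat using w2_nonzero by (simp add: mpow_scal scalar_scal)
  also have "\<dots> \<longleftrightarrow> b = 0" using gen_e by (auto simp: ab scalar_mat2 generates_units_def)
  also have "\<dots> \<longleftrightarrow> ext a b \<in> range \<iota>"
  proof
    assume "ext a b \<in> range \<iota>"
    then obtain c where "ext a b = \<iota> c" by blast
    then have "ext a b = ext c 0" by (simp add: ext_def emb_0)
    then show "b = 0" by (simp add: ext_inj)
  qed (simp add: ext_def emb_0)
  also have "\<dots> \<longleftrightarrow> (\<iota> w1 + \<iota> w2 * s) ^ (k * (CARD('a) - 1)) = 1"
    using in_base_iff[OF nz] ab(2) by (simp add: power_mult)
  also have "\<dots> \<longleftrightarrow> (CARD('a) + 1) * (CARD('a) - 1) dvd k * (CARD('a) - 1)"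
    unfolding generator_power_eq_1_iff[OF gen_b] card_sq ..
  also have "\<dots> \<longleftrightarrow> (CARD('a) + 1) dvd k" unfolding mult.commute[of _ "CARD('a) - 1"] nat_mult_dvd_cancel_disj using gt5 by auto
  finally show ?thesis .
qed

lemma torus_power:
  assumes "a \<noteq> 0 \<or> b \<noteq> 0"
  obtains c k where "c \<noteq> 0" "mat2 a (e * b) b a = mat c ** mpow g0 k"
proof -
  have "ext a b \<noteq> 0" using ext_inj[of a b 0 0] assms by (auto simp: ext_def emb_0)
  then obtain k where k: "ext a b = (\<iota> w1 + \<iota> w2 * s) ^ k" using gen_b by (auto simp: generates_units_def)
  then have "mpow (mat2 w1 (e * w2) w2 w1) k = mat2 a (e * b) b a"
    using power_gen[of k] by (auto simp: ext_inj)
  then show ?thesis using that[of "w2 ^ k" k] w2_nonzero unfolding gen_mat mpow_scal by simp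
qed

text \<open>By \<open>conj_similar\<close> only trace and determinant matter. The discriminant t^2 -
  4d is zero, a nonzero square, or \<open>e\<close> times a nonzero square, and each case has a
  model matrix with the same trace and determinant.\<close>

lemma trichotomy:
  assumes "det S \<noteq> 0" "\<not> scalar S"
  obtains (unipotent) P c where "det P \<noteq> 0" "c \<noteq> 0" "P ** S = mat c ** mat_\<beta> ** P"
  | (split) P c k where "det P \<noteq> 0" "c \<noteq> 0" "P ** S = mat c ** mpow (mat_\<alpha> e) k ** P"
  | (nonsplit) P c k where "det P \<noteq> 0" "c \<noteq> 0" "P ** S = mat c ** mpow g0 k ** P"
proof -
  note nums = small_numerals_nonzero[OF prime gt5]
  define t d where "t = tr S" and "d = det S"
  have sim: "\<exists>P. det P \<noteq> 0 \<and> P ** S = T ** P" if "\<not> scalar T" "det T = d" "tr T = t" for T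
    using conj_similar[OF assms(2) that(1)] that unfolding t_def d_def by metis
  show ?thesis
  proof (cases "t\<^sup>2 - 4 * d = 0")
    case True
    have td: "t * t = 4 * d" using True by (simp add: power2_eq_square)
    then have "t / 2 \<noteq> 0" using assms nums by (auto simp: d_def)
    have dd: "d = t * t / 4" using td nums by simp
    have "mat (t / 2) ** mat_\<beta> = mat2 (t / 2) (t / 2) 0 (t / 2)" by (simp add: mat_\<beta>_def mat2_simps)
    moreover have "\<not> scalar \<dots>" using \<open>t / 2 \<noteq> 0\<close> by (simp add: scalar_mat2)
    moreover have "t / 2 + t / 2 = t" using nums by (simp add: field_simps)
    ultimately obtain P where "det P \<noteq> 0" "P ** S = mat (t / 2) ** mat_\<beta> ** P"
      using sim[of "mat (t / 2) ** mat_\<beta>"] dd by (auto simp: mat2_simps)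
    then show ?thesis using unipotent \<open>t / 2 \<noteq> 0\<close> by blast
  next
    case False
    consider f where "t\<^sup>2 - 4 * d = f\<^sup>2" | f where "t\<^sup>2 - 4 * d = e * f\<^sup>2"
      by (rule square_or_nonsquare[OF gen_e])
    then show ?thesis
    proof cases
      case (1 f)
      then have f: "f \<noteq> 0" using False by auto
      define x y where "x = (t + f) / 2" and "y = (t - f) / 2"
      have "x * y = ((t + f) * (t - f)) / 4" by (simp add: x_def y_def)
      also have "(t + f) * (t - f) = t\<^sup>2 - f\<^sup>2" by (simp add: algebra_simps power2_eq_square)
      also have "t\<^sup>2 - f\<^sup>2 = 4 * d" unfolding 1[symmetric] by simp
      finally have xy: "x * y = d" using nums by simp
      have xy2: "x + y = t" using nums by (simp add: x_def y_def field_simps)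
      have "x - y = f" using nums by (simp add: x_def y_def diff_divide_distrib[symmetric])
      then have ne: "x \<noteq> y" using f by auto
      have nz: "x \<noteq> 0" "y \<noteq> 0" using xy assms by (auto simp: d_def)
      \<comment> \<open>PGL(2) sees only the ratio of the eigenvalues, which is a power of
        \<open>e\<close>.\<close>
      then obtain k where k: "x / y = e ^ k" using gen_e unfolding generates_units_def by (metis divide_eq_0_iff)
      have "mat y ** mpow (mat_\<alpha> e) k = mat2 x 0 0 y" using nz by (simp add: mpow_alpha mat2_simps flip: k)
      then obtain P where "det P \<noteq> 0" "P ** S = mat y ** mpow (mat_\<alpha> e) k ** P"
        using sim[of "mat2 x 0 0 y"] ne xy xy2 by (auto simp: mat2_simps scalar_mat2)
      then show ?thesis using split nz by blast
    next
      case (2 f)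
      then have f: "f \<noteq> 0" using False by auto
      have "4 * d = t\<^sup>2 - e * f\<^sup>2" unfolding 2[symmetric] by simp
      then have dd: "d = (t\<^sup>2 - e * f\<^sup>2) / 4" using nums by (simp add: field_simps)
      have t2: "t / 2 + t / 2 = t" using nums by (simp add: field_simps)
      obtain P where P: "det P \<noteq> 0" "P ** S = mat2 (t / 2) (e * (f / 2)) (f / 2) (t / 2) ** P"
        using sim[of "mat2 (t / 2) (e * (f / 2)) (f / 2) (t / 2)"] dd t2 f nums
        by (auto simp: mat2_simps scalar_mat2 power2_eq_square diff_divide_distrib)
      obtain c k where "c \<noteq> 0" "mat2 (t / 2) (e * (f / 2)) (f / 2) (t / 2) = mat c ** mpow g0 k"
        using torus_power[of "t / 2" "f / 2"] f nums by auto
      then show ?thesis using nonsplit P by metis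
    qed
  qed
qed

end

section \<open>Cayley maps with involutory generators\<close>

lemma cyclic_on_power:
  assumes "cyclic_on \<rho> \<Omega>" "x \<in> \<Omega>" "y \<in> \<Omega>"
  obtains k where "y = (\<rho> ^^ k) x"
proof -
  have "\<Omega> = orbit \<rho> x" using assms cyclic_on_alldef by metis
  then show ?thesis using assms that by (auto simp: orbit_altdef)
qed

text \<open>On a single cycle the least period \<open>n\<close> of a point equals the number of
  points.\<close>

lemma cyclic_on_fixpoint_iff:
  assumes "cyclic_on \<rho> \<Omega>" "x \<in> \<Omega>"
  shows "(\<rho> ^^ k) x = x \<longleftrightarrow> card \<Omega> dvd k"
proof -
  have orb: "\<Omega> = orbit \<rho> x" using assms cyclic_on_alldef by metis
  then have "x \<in> orbit \<rho> x" using assms by simp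
  then obtain m where m0: "0 < m" "(\<rho> ^^ m) x = x" by (auto simp: orbit_altdef)
  define n where "n = (LEAST m. 0 < m \<and> (\<rho> ^^ m) x = x)"
  have n: "0 < n" "(\<rho> ^^ n) x = x"
    using LeastI[of "\<lambda>m. 0 < m \<and> (\<rho> ^^ m) x = x" m] m0 unfolding n_def by auto
  have least: "n \<le> i" if "0 < i" "(\<rho> ^^ i) x = x" for i
    using that unfolding n_def by (auto intro: Least_le)
  have "\<Omega> = (\<lambda>i. (\<rho> ^^ i) x) ` {..<n}"
    unfolding orb using orbit_altdef_bounded[OF n(2,1)] by auto
  moreover have "inj_on (\<lambda>i. (\<rho> ^^ i) x) {..<n}"
  proof (rule linorder_inj_onI')
    fix a b assume ab: "a \<in> {..<n}" "b \<in> {..<n}" "a < b"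
    show "(\<rho> ^^ a) x \<noteq> (\<rho> ^^ b) x"
    proof
      assume eq: "(\<rho> ^^ a) x = (\<rho> ^^ b) x"
      \<comment> \<open>Advancing both sides by n - b turns the coincidence into the period n - b +
        a, shorter than \<open>n\<close>.\<close>
      have "(\<rho> ^^ ((n - b) + a)) x = (\<rho> ^^ ((n - b) + b)) x"
        unfolding funpow_add by (simp add: eq)
      then have "(\<rho> ^^ ((n - b) + a)) x = x" using ab n by simp
      then show False using least[of "(n - b) + a"] ab by auto
    qed
  qed
  ultimately have c: "card \<Omega> = n" by (simp add: card_image)
  show ?thesis
  proof
    assume "(\<rho> ^^ k) x = x"
    then have "(\<rho> ^^ (k mod n)) x = x" using funpow_mod_eq[OF n(2)] by simp
    then have "\<not> 0 < k mod n" using least[of "k mod n"] n by (metis mod_less_divisor not_le)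
    then show "card \<Omega> dvd k" using c by auto
  next
    assume "card \<Omega> dvd k"
    then have "k mod n = 0" using c by simp
    then show "(\<rho> ^^ k) x = x" using funpow_mod_eq[OF n(2), of k] by simp
  qed
qed

lemma intertwine_funpow:
  assumes "cyclic_on \<rho> \<Omega>" "x \<in> \<Omega>" "\<And>z. z \<in> \<Omega> \<Longrightarrow> h (\<rho> z) = \<rho>' (h z)"
  shows "h ((\<rho> ^^ k) x) = (\<rho>' ^^ k) (h x)"
  using assms by (induction k) (auto simp: cyclic_on_funpow_in)

locale involutory_cayley_map = group G for G (structure) +
  fixes \<Omega> \<rho>
  assumes data: "cayley_map_data G \<Omega> \<rho>" and invol: "type_II G \<Omega>"
begin

lemma gens: "\<Omega> \<subseteq> carrier G" and generates: "generate G \<Omega> = carrier G" and cyc: "cyclic_on \<rho> \<Omega>"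
  and finite_G: "finite (carrier G)"
  using data by (auto simp: cayley_map_data_def)

lemma involD: "\<omega> \<in> \<Omega> \<Longrightarrow> \<omega> \<otimes> \<omega> = \<one>"
  using invol by (auto simp: type_II_def)

lemma rho_in: "\<omega> \<in> \<Omega> \<Longrightarrow> \<rho> \<omega> \<in> \<Omega>"
  using cyc cyclic_on_inI by metis

lemma inv_gen: "\<omega> \<in> \<Omega> \<Longrightarrow> inv \<omega> = \<omega>"
  using involD gens by (intro inv_equality) auto

text \<open>Every generator is its own inverse, so right multiplication by generators already
  reaches every element and the induction has no case for inverses.\<close>

lemma generator_induct [consumes 1, case_names one step]:
  assumes "h \<in> carrier G" "P \<one>"
    and step: "\<And>h \<omega>. h \<in> carrier G \<Longrightarrow> \<omega> \<in> \<Omega> \<Longrightarrow> P h \<Longrightarrow> P (h \<otimes> \<omega>)"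
  shows "P h"
proof -
  have "h \<in> generate G \<Omega>" using assms generates by simp
  \<comment> \<open>Quantifying over a left factor \<open>g\<close> lets the product case of
    \<open>generate\<close> chain its two hypotheses.\<close>
  then have "\<forall>g \<in> carrier G. P g \<longrightarrow> P (g \<otimes> h)"
  proof (induction rule: generate.induct)
    case (eng h1 h2)
    have c: "h1 \<in> carrier G" "h2 \<in> carrier G" using eng generates by auto
    show ?case
    proof (intro ballI impI)
      fix g assume g: "g \<in> carrier G" "P g"
      then have "P (g \<otimes> h1 \<otimes> h2)" using eng c by auto
      then show "P (g \<otimes> (h1 \<otimes> h2))" using g c by (simp add: m_assoc)
    qed
  qed (auto simp: step inv_gen)
  then have "P (\<one> \<otimes> h)" using assms by blast
  then show ?thesis using assms by simp
qed

text \<open>An isomorphism acts on the arcs at \<open>\<eta>\<close> by a bijection \<open>\<theta> \<eta>\<close> of generators.  Since arc reversal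
  relates the arcs at \<open>\<eta>\<close> and at \<open>\<eta>\<omega>\<close>, and both \<open>\<theta> \<eta>\<close> and \<open>\<theta> (\<eta>\<omega>)\<close> intertwine the rotations,
  \<open>\<theta> \<eta>\<close> does not depend on \<open>\<eta>\<close>.\<close>

lemma map_iso_hom:
  assumes N: "involutory_cayley_map G \<Omega>' \<rho>'"
    and iso: "oriented_map_iso (cayley_map G \<Omega> \<rho>) (cayley_map G \<Omega>' \<rho>') f g"
    and f1: "f \<one> = \<one>"
  shows "f \<in> iso G G" "f ` \<Omega> = \<Omega>'" "\<And>\<omega>. \<omega> \<in> \<Omega> \<Longrightarrow> f (\<rho> \<omega>) = \<rho>' (f \<omega>)"
    and "\<And>\<omega>. \<omega> \<in> \<Omega> \<Longrightarrow> g (\<one>, \<omega>) = (\<one>, f \<omega>)"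
proof -
  interpret N: involutory_cayley_map G \<Omega>' \<rho>' by fact
  have bf: "bij_betw f (carrier G) (carrier G)" and bg: "bij_betw g (carrier G \<times> \<Omega>) (carrier G \<times> \<Omega>')"
    using iso by (auto simp: oriented_map_iso_def cayley_map_def)
  have fc: "f \<eta> \<in> carrier G" if "\<eta> \<in> carrier G" for \<eta>
    using bf that by (auto simp: bij_betw_def)
  define \<theta> where "\<theta> = (\<lambda>\<eta> \<omega>. snd (g (\<eta>, \<omega>)))"
  have g_eq: "g (\<eta>, \<omega>) = (f \<eta>, \<theta> \<eta> \<omega>)" and \<theta>_in: "\<theta> \<eta> \<omega> \<in> \<Omega>'"
    and f_eq: "f (\<eta> \<otimes> \<omega>) = f \<eta> \<otimes> \<theta> \<eta> \<omega>" and \<theta>_rho: "\<theta> \<eta> (\<rho> \<omega>) = \<rho>' (\<theta> \<eta> \<omega>)"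
    if h: "\<eta> \<in> carrier G" "\<omega> \<in> \<Omega>" for \<eta> \<omega>
  proof -
    obtain a b where ab: "g (\<eta>, \<omega>) = (a, b)" by (cases "g (\<eta>, \<omega>)")
    have "(\<eta>, \<omega>) \<in> arcs (cayley_map G \<Omega> \<rho>)" using h by (simp add: cayley_map_def)
    then have *: "tail (cayley_map G \<Omega>' \<rho>') (a, b) = f \<eta>" "head (cayley_map G \<Omega>' \<rho>') (a, b) = f (\<eta> \<otimes> \<omega>)"
      "rot (cayley_map G \<Omega>' \<rho>') (a, b) = g (\<eta>, \<rho> \<omega>)"
      using iso unfolding oriented_map_iso_def ab[symmetric] by (auto simp: cayley_map_def)
    have "g (\<eta>, \<omega>) \<in> carrier G \<times> \<Omega>'" using bg h by (auto simp: bij_betw_def)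
    moreover have "a = f \<eta>" "a \<otimes> b = f (\<eta> \<otimes> \<omega>)" "g (\<eta>, \<rho> \<omega>) = (a, \<rho>' b)"
      using * by (auto simp: cayley_map_def)
    ultimately show "g (\<eta>, \<omega>) = (f \<eta>, \<theta> \<eta> \<omega>)" "\<theta> \<eta> \<omega> \<in> \<Omega>'" "f (\<eta> \<otimes> \<omega>) = f \<eta> \<otimes> \<theta> \<eta> \<omega>"
      "\<theta> \<eta> (\<rho> \<omega>) = \<rho>' (\<theta> \<eta> \<omega>)"
      using ab by (auto simp: \<theta>_def)
  qed
  have step: "\<theta> (\<eta> \<otimes> \<omega>) \<omega>' = \<theta> \<eta> \<omega>'" if h: "\<eta> \<in> carrier G" "\<omega> \<in> \<Omega>" "\<omega>' \<in> \<Omega>" for \<eta> \<omega> \<omega>'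
  proof -
    have c: "\<omega> \<in> carrier G" "\<eta> \<otimes> \<omega> \<in> carrier G" using h gens by auto
    \<comment> \<open>Walking along \<omega> and back returns to \<eta> because \<omega> is an
      involution. The two image generators are therefore mutually inverse, and they are equal
      because generators of the target are involutions too.\<close>
    have "f (\<eta> \<otimes> \<omega> \<otimes> \<omega>) = f \<eta> \<otimes> \<theta> \<eta> \<omega> \<otimes> \<theta> (\<eta> \<otimes> \<omega>) \<omega>" using f_eq h c by simp
    moreover have "\<eta> \<otimes> \<omega> \<otimes> \<omega> = \<eta>" using h c involD by (simp add: m_assoc)
    moreover have in': "\<theta> \<eta> \<omega> \<in> carrier G" "\<theta> (\<eta> \<otimes> \<omega>) \<omega> \<in> carrier G"
      using \<theta>_in h c N.gens by auto
    ultimately have "f \<eta> = f \<eta> \<otimes> (\<theta> \<eta> \<omega> \<otimes> \<theta> (\<eta> \<otimes> \<omega>) \<omega>)"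
      using m_assoc[OF fc[OF h(1)] in'] by argo
    then have "\<theta> \<eta> \<omega> \<otimes> \<theta> (\<eta> \<otimes> \<omega>) \<omega> = \<one>"
      by (subst (asm) l_cancel_one') (use fc[OF h(1)] in' in auto)
    moreover have "\<theta> \<eta> \<omega> \<otimes> \<theta> \<eta> \<omega> = \<one>" using N.involD[OF \<theta>_in[OF h(1,2)]] .
    ultimately have "\<theta> \<eta> \<omega> \<otimes> \<theta> (\<eta> \<otimes> \<omega>) \<omega> = \<theta> \<eta> \<omega> \<otimes> \<theta> \<eta> \<omega>" by simp
    then have eq: "\<theta> (\<eta> \<otimes> \<omega>) \<omega> = \<theta> \<eta> \<omega>"
      using Units_l_cancel[of "\<theta> \<eta> \<omega>" "\<theta> (\<eta> \<otimes> \<omega>) \<omega>" "\<theta> \<eta> \<omega>"] in' by simp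
    obtain k where k: "\<omega>' = (\<rho> ^^ k) \<omega>" using cyclic_on_power[OF cyc h(2,3)] .
    have "\<theta> (\<eta> \<otimes> \<omega>) \<omega>' = (\<rho>' ^^ k) (\<theta> (\<eta> \<otimes> \<omega>) \<omega>)"
      unfolding k by (rule intertwine_funpow[OF cyc h(2)]) (use \<theta>_rho c in auto)
    also have "\<dots> = \<theta> \<eta> \<omega>'"
      unfolding k eq by (rule intertwine_funpow[OF cyc h(2), symmetric]) (use \<theta>_rho h in auto)
    finally show ?thesis .
  qed
  have const: "\<theta> h \<omega> = \<theta> \<one> \<omega>" if "h \<in> carrier G" "\<omega> \<in> \<Omega>" for h \<omega>
    using that by (induction rule: generator_induct) (auto simp: step)
  have f\<omega>: "f \<omega> = \<theta> \<one> \<omega>" if "\<omega> \<in> \<Omega>" for \<omega>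
  proof -
    have "f (\<one> \<otimes> \<omega>) = f \<one> \<otimes> \<theta> \<one> \<omega>" using f_eq that by blast
    moreover have "\<omega> \<in> carrier G" "\<theta> \<one> \<omega> \<in> carrier G" using that gens \<theta>_in N.gens by auto
    ultimately show ?thesis using f1 by simp
  qed
  have f_gen: "f (\<eta> \<otimes> \<omega>) = f \<eta> \<otimes> f \<omega>" if "\<eta> \<in> carrier G" "\<omega> \<in> \<Omega>" for \<eta> \<omega>
    using f_eq[OF that] const[OF that] f\<omega>[OF that(2)] by metis
  have mult: "f (\<eta> \<otimes> h) = f \<eta> \<otimes> f h" if "h \<in> carrier G" "\<eta> \<in> carrier G" for \<eta> h
    using that
  proof (induction rule: generator_induct)
    case one
    then show ?case using f1 fc by simp
  next
    case (step h \<omega>)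
    have c: "\<omega> \<in> carrier G" "f \<omega> \<in> carrier G" using step gens fc by auto
    have "f (\<eta> \<otimes> (h \<otimes> \<omega>)) = f (\<eta> \<otimes> h \<otimes> \<omega>)" using step c by (simp add: m_assoc)
    also have "\<dots> = f (\<eta> \<otimes> h) \<otimes> f \<omega>" using step f_gen by simp
    also have "\<dots> = f \<eta> \<otimes> f (h \<otimes> \<omega>)" using step c fc f_gen by (simp add: m_assoc)
    finally show ?case .
  qed
  show "f \<in> iso G G" using bf fc mult by (auto simp: iso_def hom_def)
  show g1: "g (\<one>, \<omega>) = (\<one>, f \<omega>)" if "\<omega> \<in> \<Omega>" for \<omega> using g_eq[of \<one> \<omega>] f1 f\<omega> that by simp
  show "f (\<rho> \<omega>) = \<rho>' (f \<omega>)" if "\<omega> \<in> \<Omega>" for \<omega> using f\<omega> \<theta>_rho rho_in that by simp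
  show "f ` \<Omega> = \<Omega>'"
  proof (intro subset_antisym subsetI)
    fix \<omega>' assume "\<omega>' \<in> \<Omega>'"
    then have "(\<one>, \<omega>') \<in> g ` (carrier G \<times> \<Omega>)" using bg by (auto simp: bij_betw_def)
    then obtain \<eta> \<omega> where *: "\<eta> \<in> carrier G" "\<omega> \<in> \<Omega>" "g (\<eta>, \<omega>) = (\<one>, \<omega>')" by auto
    then have "\<omega>' = f \<omega>" using g_eq[of \<eta> \<omega>] const[of \<eta> \<omega>] f\<omega>[of \<omega>] by (metis snd_conv)
    then show "\<omega>' \<in> f ` \<Omega>" using * by simp
  qed (use f\<omega> \<theta>_in in auto)
qed

text \<open>Left translations are automorphisms of a Cayley map; composing with translation by the
  inverse of \<open>f \<one>\<close> gives the normalisation that \<open>map_iso_hom\<close> asks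
  for.\<close>

lemma map_iso_imp_group_iso:
  assumes N: "involutory_cayley_map G \<Omega>' \<rho>'"
    and iso: "cayley_map G \<Omega> \<rho> \<cong>\<^sub>M cayley_map G \<Omega>' \<rho>'"
  obtains f where "f \<in> iso G G" "f ` \<Omega> = \<Omega>'" "\<And>\<omega>. \<omega> \<in> \<Omega> \<Longrightarrow> f (\<rho> \<omega>) = \<rho>' (f \<omega>)"
proof -
  interpret N: involutory_cayley_map G \<Omega>' \<rho>' by fact
  obtain f g where iso: "oriented_map_iso (cayley_map G \<Omega> \<rho>) (cayley_map G \<Omega>' \<rho>') f g"
    using iso by (auto simp: oriented_maps_isomorphic_def)
  define c where "c = inv (f \<one>)"
  have bf: "bij_betw f (carrier G) (carrier G)" and bg: "bij_betw g (carrier G \<times> \<Omega>) (carrier G \<times> \<Omega>')"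
    using iso by (auto simp: oriented_map_iso_def cayley_map_def)
  have fc: "f \<eta> \<in> carrier G" if "\<eta> \<in> carrier G" for \<eta>
    using bf that by (auto simp: bij_betw_def)
  have c: "c \<in> carrier G" using fc by (simp add: c_def)
  have canc: "inv c \<otimes> (c \<otimes> \<eta>) = \<eta>" "c \<otimes> (inv c \<otimes> \<eta>) = \<eta>" if "\<eta> \<in> carrier G" for \<eta>
    using that c m_assoc[of "inv c" c \<eta>] m_assoc[of c "inv c" \<eta>] by simp_all
  have bc: "bij_betw (\<lambda>\<eta>. c \<otimes> \<eta>) (carrier G) (carrier G)"
    by (rule bij_betw_byWitness[where f' = "\<lambda>\<eta>. inv c \<otimes> \<eta>"]) (use c canc in auto)
  define t where "t = (\<lambda>(\<eta>, \<omega>::'a). (c \<otimes> \<eta>, \<omega>))"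
  have bt: "bij_betw t (carrier G \<times> \<Omega>') (carrier G \<times> \<Omega>')"
    by (rule bij_betw_byWitness[where f' = "\<lambda>(\<eta>, \<omega>). (inv c \<otimes> \<eta>, \<omega>)"])
      (use c canc in \<open>auto simp: t_def\<close>)
  have "oriented_map_iso (cayley_map G \<Omega> \<rho>) (cayley_map G \<Omega>' \<rho>') (\<lambda>\<eta>. c \<otimes> f \<eta>) (t \<circ> g)"
    unfolding oriented_map_iso_def
  proof (intro conjI ballI)
    show "bij_betw (\<lambda>\<eta>. c \<otimes> f \<eta>) (verts (cayley_map G \<Omega> \<rho>)) (verts (cayley_map G \<Omega>' \<rho>'))"
      using bij_betw_trans[OF bf bc] by (simp add: cayley_map_def comp_def)
    show "bij_betw (t \<circ> g) (arcs (cayley_map G \<Omega> \<rho>)) (arcs (cayley_map G \<Omega>' \<rho>'))"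
      using bij_betw_trans[OF bg bt] by (simp add: cayley_map_def)
    fix d assume d: "d \<in> arcs (cayley_map G \<Omega> \<rho>)"
    obtain \<eta> \<omega> where d': "d = (\<eta>, \<omega>)" "\<eta> \<in> carrier G" "\<omega> \<in> \<Omega>" using d by (auto simp: cayley_map_def)
    obtain a b where ab: "g d = (a, b)" by (cases "g d")
    have "g d \<in> carrier G \<times> \<Omega>'" using bg d' by (auto simp: bij_betw_def)
    then have abc: "a \<in> carrier G" "b \<in> carrier G" using ab N.gens by auto
    have *: "tail (cayley_map G \<Omega>' \<rho>') (a, b) = f \<eta>" "head (cayley_map G \<Omega>' \<rho>') (a, b) = f (\<eta> \<otimes> \<omega>)"
      "rot (cayley_map G \<Omega>' \<rho>') (a, b) = g (\<eta>, \<rho> \<omega>)"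
      using iso d unfolding oriented_map_iso_def ab[symmetric] by (auto simp: cayley_map_def d')
    then have *: "a = f \<eta>" "a \<otimes> b = f (\<eta> \<otimes> \<omega>)" "g (\<eta>, \<rho> \<omega>) = (a, \<rho>' b)"
      by (auto simp: cayley_map_def)
    show "tail (cayley_map G \<Omega>' \<rho>') ((t \<circ> g) d) = c \<otimes> f (tail (cayley_map G \<Omega> \<rho>) d)"
      "rot (cayley_map G \<Omega>' \<rho>') ((t \<circ> g) d) = (t \<circ> g) (rot (cayley_map G \<Omega> \<rho>) d)"
      using * ab by (simp_all add: cayley_map_def d' t_def)
    show "head (cayley_map G \<Omega>' \<rho>') ((t \<circ> g) d) = c \<otimes> f (head (cayley_map G \<Omega> \<rho>) d)"
      using *(2) ab abc c by (simp add: cayley_map_def d' t_def m_assoc)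
  qed
  moreover have "c \<otimes> f \<one> = \<one>" using fc by (simp add: c_def)
  ultimately show thesis
    by (intro that[of "\<lambda>\<eta>. c \<otimes> f \<eta>"] map_iso_hom[OF N])
qed

text \<open>Arc-transitivity moves an arc at the identity to the next one there. Such an
  automorphism fixes the identity, so it is a group automorphism commuting with \<rho>; it agrees
  with \<rho> at one generator and hence on the whole cycle.\<close>

lemma regular_imp_rotation_extends:
  assumes "regular_map (cayley_map G \<Omega> \<rho>)"
  obtains f where "f \<in> iso G G" "\<And>\<omega>. \<omega> \<in> \<Omega> \<Longrightarrow> f \<omega> = \<rho> \<omega>"
proof -
  obtain \<omega>0 where \<omega>0: "\<omega>0 \<in> \<Omega>" using cyc by (auto simp: cyclic_on_def)
  have "(\<one>, \<omega>0) \<in> arcs (cayley_map G \<Omega> \<rho>)" "(\<one>, \<rho> \<omega>0) \<in> arcs (cayley_map G \<Omega> \<rho>)"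
    using \<omega>0 rho_in by (auto simp: cayley_map_def)
  then obtain f g where iso: "oriented_map_iso (cayley_map G \<Omega> \<rho>) (cayley_map G \<Omega> \<rho>) f g"
    and g: "g (\<one>, \<omega>0) = (\<one>, \<rho> \<omega>0)"
    using assms unfolding regular_map_def by blast
  have "tail (cayley_map G \<Omega> \<rho>) (g (\<one>, \<omega>0)) = f \<one>"
    using iso \<omega>0 by (auto simp: oriented_map_iso_def cayley_map_def)
  then have f1: "f \<one> = \<one>" using g by (simp add: cayley_map_def)
  note * = map_iso_hom[OF involutory_cayley_map_axioms iso f1]
  have eq: "f \<omega>0 = \<rho> \<omega>0" using *(4)[OF \<omega>0] g by simp
  have "f \<omega> = \<rho> \<omega>" if \<omega>: "\<omega> \<in> \<Omega>" for \<omega>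
  proof -
    obtain k where k: "\<omega> = (\<rho> ^^ k) \<omega>0" using cyclic_on_power[OF cyc \<omega>0 \<omega>] .
    have "f \<omega> = (\<rho> ^^ k) (f \<omega>0)"
      unfolding k by (rule intertwine_funpow[OF cyc \<omega>0]) (rule *(3))
    then show ?thesis unfolding k eq using funpow_swap1[of \<rho> k \<omega>0] by simp
  qed
  then show thesis using that *(1) by blast
qed

text \<open>Besides the isomorphism it transports \<open>cayley_map_data\<close>, which is how a
  normal form inherits generation from the given map.\<close>

lemma group_iso_imp_map_iso:
  assumes f: "f \<in> iso G G" and rho': "\<And>\<omega>. \<omega> \<in> \<Omega> \<Longrightarrow> \<rho>' (f \<omega>) = f (\<rho> \<omega>)"
  shows "cayley_map_data G (f ` \<Omega>) \<rho>'" "cayley_map G \<Omega> \<rho> \<cong>\<^sub>M cayley_map G (f ` \<Omega>) \<rho>'"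
proof -
  interpret f: group_hom G G f by unfold_locales (use f in \<open>auto simp: iso_def\<close>)
  have bf: "bij_betw f (carrier G) (carrier G)" using f by (auto simp: iso_def)
  then have inj: "inj_on f (carrier G)" and im: "f ` carrier G = carrier G" by (auto simp: bij_betw_def)
  have "\<one> \<notin> \<Omega>" using data by (auto simp: cayley_map_data_def)
  moreover have "x = \<one>" if "x \<in> \<Omega>" "f x = \<one>" for x
    by (rule inj_onD[OF inj]) (use that gens f.hom_one in auto)
  ultimately have "\<one> \<notin> f ` \<Omega>" by force
  moreover have "m_inv G ` f ` \<Omega> = f ` \<Omega>"
    unfolding image_image
  proof (rule image_cong[OF refl])
    fix x assume "x \<in> \<Omega>"
    then show "inv (f x) = f x" using f.hom_inv[of x] inv_gen[of x] gens by auto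
  qed
  moreover have "generate G (f ` \<Omega>) = carrier G"
    using f.generate_img[OF gens] generates im by simp
  moreover have "cyclic_on \<rho>' (f ` \<Omega>)" by (rule cyclic_on_image[OF cyc]) (rule rho')
  ultimately show "cayley_map_data G (f ` \<Omega>) \<rho>'"
    using gens finite_G f.hom_closed by (auto simp: cayley_map_data_def is_group)
  have "oriented_map_iso (cayley_map G \<Omega> \<rho>) (cayley_map G (f ` \<Omega>) \<rho>') f (map_prod f f)"
    unfolding oriented_map_iso_def
  proof (intro conjI ballI)
    have "bij_betw f \<Omega> (f ` \<Omega>)" using inj gens by (auto simp: bij_betw_def intro: inj_on_subset)
    then show "bij_betw (map_prod f f) (arcs (cayley_map G \<Omega> \<rho>)) (arcs (cayley_map G (f ` \<Omega>) \<rho>'))"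
      using bij_betw_map_prod[OF bf] by (simp add: cayley_map_def)
  qed (use bf gens rho' in \<open>auto simp: cayley_map_def\<close>)
  then show "cayley_map G \<Omega> \<rho> \<cong>\<^sub>M cayley_map G (f ` \<Omega>) \<rho>'"
    unfolding oriented_maps_isomorphic_def by blast
qed

end

section \<open>Automorphisms of PSL(2,p)\<close>

lemma psl_eq: "psl A = {A, - A}"
  by (auto simp: psl_def r_coset_def SL2_def SL2_scalars_def mat_uminus)

lemma psl_eq_iff: "psl A = psl B \<longleftrightarrow> A = B \<or> A = - B"
  unfolding psl_eq doubleton_eq_iff by auto

lemma psl_uminus [simp]: "psl (- A) = psl A"
  by (simp add: psl_eq_iff)

lemma carrier_PSL2: "carrier PSL2 = psl ` {A. det A = 1}"
  by (auto simp: PSL2_def FactGroup_def RCOSETS_def psl_def SL2_def)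

lemma psl_in_carrier [simp]: "det A = 1 \<Longrightarrow> psl A \<in> carrier PSL2"
  by (auto simp: carrier_PSL2)

lemma mult_PSL2 [simp]: "psl A \<otimes>\<^bsub>PSL2\<^esub> psl B = psl (A ** B)"
  by (auto simp: PSL2_def FactGroup_def set_mult_def SL2_def psl_eq)

lemma one_PSL2: "\<one>\<^bsub>PSL2\<^esub> = psl (mat 1)"
proof -
  have "- (mat 1 :: 'a^2^2) = mat (- 1)" by (simp add: mat2_simps)
  then show ?thesis by (simp add: PSL2_def FactGroup_def SL2_scalars_def psl_eq)
qed

lemma pgl_eq: "pgl A = {mat c ** A | c. c \<noteq> 0}"
  by (auto simp: pgl_def r_coset_def GL2_def GL2_scalars_def)

lemma mult_PGL2 [simp]: "pgl A \<otimes>\<^bsub>PGL2\<^esub> pgl B = pgl (A ** B)"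
proof -
  have "(mat c ** A) ** (mat d ** B) = mat (c * d) ** (A ** B)" for c d
    by (simp add: mat_left_move[of A] flip: matrix_mul_assoc)
  note eq = this
  have "(\<Union>X\<in>pgl A. \<Union>Y\<in>pgl B. {X ** Y}) = pgl (A ** B)"
  proof (intro subset_antisym subsetI)
    fix Z assume "Z \<in> (\<Union>X\<in>pgl A. \<Union>Y\<in>pgl B. {X ** Y})"
    then obtain c d where "c \<noteq> 0" "d \<noteq> 0" "Z = (mat c ** A) ** (mat d ** B)" by (auto simp: pgl_eq)
    then show "Z \<in> pgl (A ** B)" unfolding eq pgl_eq by auto
  next
    fix Z assume "Z \<in> pgl (A ** B)"
    then obtain c where c: "c \<noteq> 0" "Z = mat c ** (A ** B)" by (auto simp: pgl_eq)
    then have "Z = (mat c ** A) ** B" by (simp add: matrix_mul_assoc)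
    moreover have "B \<in> pgl B" by (auto simp: pgl_eq intro: exI[of _ 1])
    moreover have "mat c ** A \<in> pgl A" using c by (auto simp: pgl_eq)
    ultimately show "Z \<in> (\<Union>X\<in>pgl A. \<Union>Y\<in>pgl B. {X ** Y})" by blast
  qed
  then show ?thesis by (simp add: PGL2_def FactGroup_def set_mult_def GL2_def)
qed

lemma one_PGL2: "\<one>\<^bsub>PGL2\<^esub> = pgl (mat 1)"
  by (auto simp: PGL2_def FactGroup_def GL2_scalars_def pgl_eq)

lemma pow_PGL2: "pgl A [^]\<^bsub>PGL2\<^esub> (k::nat) = pgl (mpow A k)"
proof (induction k)
  case (Suc k)
  have "pgl A [^]\<^bsub>PGL2\<^esub> Suc k = pgl A [^]\<^bsub>PGL2\<^esub> k \<otimes>\<^bsub>PGL2\<^esub> pgl A"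
    by (simp add: nat_pow_def)
  then show ?case by (simp only: Suc mult_PGL2 mpow_Suc2)
qed (simp add: nat_pow_def one_PGL2)

lemma inv_GL2:
  assumes "det S \<noteq> 0" shows "inv\<^bsub>GL2\<^esub> S = minv S"
proof -
  have grp: "group (GL2 :: ('a^2^2) monoid)"
  proof (rule groupI)
    fix x :: "'a^2^2" assume "x \<in> carrier GL2"
    then have "det x \<noteq> 0" by (simp add: GL2_def invertible_det_nz)
    then have "minv x \<in> carrier GL2 \<and> minv x \<otimes>\<^bsub>GL2\<^esub> x = \<one>\<^bsub>GL2\<^esub>"
      by (simp add: GL2_def invertible_det_nz)
    then show "\<exists>y\<in>carrier GL2. y \<otimes>\<^bsub>GL2\<^esub> x = \<one>\<^bsub>GL2\<^esub>" by blast
  qed (simp_all add: GL2_def invertible_det_nz matrix_mul_assoc)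
  show ?thesis
    by (rule group.inv_equality[OF grp]) (use assms in \<open>simp_all add: GL2_def invertible_det_nz\<close>)
qed

definition act :: "'a::field^2^2 \<Rightarrow> 'a^2^2 \<Rightarrow> 'a^2^2" where
  "act S A = S ** A ** minv S"

lemma act_eq_iff: "det S \<noteq> 0 \<Longrightarrow> act S A = B \<longleftrightarrow> S ** A = B ** S"
  unfolding act_def by (metis minv_cancel(3,4))

lemma act_mult: "det S \<noteq> 0 \<Longrightarrow> act S (A ** B) = act S A ** act S B"
  by (simp add: act_def flip: matrix_mul_assoc)

lemma det_act [simp]: "det S \<noteq> 0 \<Longrightarrow> det (act S A) = det A"
  by (simp add: act_def det_minv)

lemma act_uminus [simp]: "act S (- A) = - act S A"
  by (simp add: act_def)

lemma act_act: "det S \<noteq> 0 \<Longrightarrow> det T \<noteq> 0 \<Longrightarrow> act S (act T A) = act (S ** T) A"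
  by (simp add: act_def minv_mult matrix_mul_assoc)

lemma act_scal [simp]: "c \<noteq> 0 \<Longrightarrow> det S \<noteq> 0 \<Longrightarrow> act (mat c ** S) A = act S A"
proof -
  assume "c \<noteq> 0" "det S \<noteq> 0"
  moreover have "act S A ** (mat c ** S) = mat c ** S ** A"
    unfolding mat_left_move[of "act S A"] using \<open>det S \<noteq> 0\<close> by (simp add: act_def matrix_mul_assoc)
  ultimately show ?thesis by (subst act_eq_iff) simp_all
qed

lemma act_minv [simp]: "det S \<noteq> 0 \<Longrightarrow> act (minv S) (act S A) = A" "det S \<noteq> 0 \<Longrightarrow> act S (act (minv S) A) = A"
  by (simp_all add: act_def flip: matrix_mul_assoc)

lemma act_cancel: "det S \<noteq> 0 \<Longrightarrow> act S A = act S B \<longleftrightarrow> A = B"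
  by (metis act_minv(1))

lemma act_one: "act (mat 1) A = A"
  by (simp add: act_eq_iff)

lemma psl_act_cancel: "det S \<noteq> 0 \<Longrightarrow> psl (act S A) = psl (act S B) \<longleftrightarrow> psl A = psl B"
  by (simp add: psl_eq_iff act_cancel flip: act_uminus)

lemma psl_act_cong: "psl A = psl B \<Longrightarrow> psl (act S A) = psl (act S B)"
  by (auto simp: psl_eq_iff)

lemma psl_mult_cong: "psl A = psl A' \<Longrightarrow> psl B = psl B' \<Longrightarrow> psl (A ** B) = psl (A' ** B')"
  by (auto simp: psl_eq_iff)

lemma psl_mpow_cong: "psl A = psl B \<Longrightarrow> psl (mpow A k) = psl (mpow B k)"
proof (induction k)
  case (Suc k)
  then show ?case unfolding mpow.simps by (intro psl_mult_cong) auto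
qed simp

text \<open>Scalars cancel in S A S^-1, so all representatives in \<open>pgl S\<close> give the same
  conjugates and the comprehension in \<open>conj_act\<close> collapses to a single class.\<close>

lemma conj_act_psl:
  assumes "det S \<noteq> 0" shows "conj_act (pgl S) (psl A) = psl (act S A)"
proof -
  have "S' ** A' ** inv\<^bsub>GL2\<^esub> S' = act S A'" if "S' \<in> pgl S" for S' A'
  proof -
    obtain c where c: "S' = mat c ** S" "c \<noteq> 0" using \<open>S' \<in> pgl S\<close> by (auto simp: pgl_eq)
    then have "S' ** A' ** inv\<^bsub>GL2\<^esub> S' = act S' A'" using assms by (simp add: inv_GL2 act_def)
    then show ?thesis using c assms by simp
  qed
  note * = this
  have mult: "X \<otimes>\<^bsub>GL2\<^esub> Y = X ** Y" for X Y :: "'a^2^2" by (simp add: GL2_def)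
  have conj: "conj_act (pgl S) (psl A) = {act S A' | S' A'. S' \<in> pgl S \<and> A' \<in> psl A}"
    unfolding conj_act_def mult
  proof (intro subset_antisym subsetI)
    fix B assume "B \<in> {S' ** A' ** inv\<^bsub>GL2\<^esub> S' | S' A'. S' \<in> pgl S \<and> A' \<in> psl A}"
    then obtain S' A' where "S' \<in> pgl S" "A' \<in> psl A" "B = act S A'" using * by blast
    then show "B \<in> {act S A' | S' A'. S' \<in> pgl S \<and> A' \<in> psl A}" by blast
  next
    fix B assume "B \<in> {act S A' | S' A'. S' \<in> pgl S \<and> A' \<in> psl A}"
    then obtain S' A' where "S' \<in> pgl S" "A' \<in> psl A" "B = S' ** A' ** inv\<^bsub>GL2\<^esub> S'" using * by auto
    then show "B \<in> {S' ** A' ** inv\<^bsub>GL2\<^esub> S' | S' A'. S' \<in> pgl S \<and> A' \<in> psl A}" by blast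
  qed
  have "S \<in> pgl S" by (auto simp: pgl_eq intro: exI[of _ 1])
  then have "conj_act (pgl S) (psl A) = act S ` psl A" unfolding conj by blast
  also have "\<dots> = psl (act S A)" by (simp add: psl_eq)
  finally show ?thesis .
qed

section \<open>Automorphisms, normalised on generators\<close>

context quadratic_extension
begin

text \<open>Over the prime field the root subgroup is generated by \<beta>. This is what leaves no
  room for field automorphisms in \<open>PSL2_automorphism\<close>.\<close>

lemma beta_pow: obtains m where "mat2 1 x 0 (1::'a) = mpow mat_\<beta> m"
proof -
  obtain m where "x = of_nat m" using prime_field_of_nat[OF prime, of x] by blast
  then show ?thesis using that[of m] by (simp add: mpow_beta)
qed

text \<open>The order p - 1 of \<open>e\<close> exceeds 4, so e^4 is not 1. The inequalities for e^2
  solve the equations for the images of \<open>torus_elt\<close> and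
  \<open>weyl_elt\<close>.\<close>

lemma e_square: "e \<noteq> 0" "e\<^sup>2 \<noteq> 1" "e\<^sup>2 \<noteq> - 1"
proof -
  have "e ^ 4 \<noteq> 1"
  proof
    assume "e ^ 4 = 1"
    then have "(CARD('a) - 1) dvd 4" using generator_power_eq_1_iff[OF gen_e, of 4] by blast
    then have "CARD('a) - 1 \<le> 4" by (rule dvd_imp_le) simp
    then show False using gt5 by simp
  qed
  then have "e\<^sup>2 * e\<^sup>2 \<noteq> 1" by (simp flip: power_add)
  then show "e\<^sup>2 \<noteq> 1" "e\<^sup>2 \<noteq> - 1" by force+
  show "e \<noteq> 0" using gen_e by (simp add: generates_units_def)
qed

lemma two_nonzero: "(2::'a) \<noteq> 0"
  using small_numerals_nonzero[OF prime gt5] by blast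

lemma double_eq_0: "x + x = 0 \<longleftrightarrow> x = (0::'a)"
  using two_nonzero by (simp flip: mult_2)

text \<open>The sign case is a vanishing sum, so that entries come out doubled and
  \<open>double_eq_0\<close> applies.\<close>

lemma psl_eq_cases:
  assumes "psl A = psl B"
  obtains "A = B" | "A + B = 0"
  using assms by (auto simp: psl_eq_iff)

text \<open>It suffices to commute up to sign with the two elementary unipotents. The sign -1 would
  force the determinant to vanish, and commuting with both leaves the scalars.\<close>

lemma centralizer_scalar:
  fixes S :: "'a^2^2"
  assumes "det S \<noteq> 0" "\<And>A. det A = 1 \<Longrightarrow> psl (act S A) = psl A"
  shows "scalar S"
proof -
  obtain a b c d where S: "S = mat2 a b c d" by (rule mat2_cases)
  have *: "psl (S ** A) = psl (A ** S)" if "det A = 1" for A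
    using assms(2)[OF that] psl_mult_cong[of "act S A" A S S] assms(1) by (simp add: act_def)
  have det: "a * d - b * c \<noteq> 0" using assms(1) by (simp add: S mat2_simps)
  have "det (mat2 1 1 0 (1::'a)) = 1" "det (mat2 1 0 1 (1::'a)) = 1" by (simp_all add: mat2_simps)
  note ** = this[THEN *]
  have "c = 0 \<and> a = d"
    using **(1)
  proof (cases rule: psl_eq_cases)
    case 2
    then have "a + (a + c) = 0" "c + c = 0" "c + d + d = 0" by (simp_all add: S mat2_simps add_ac)
    then have "a = 0" "d = 0" "c = 0" using double_eq_0 by auto
    then show ?thesis using det by simp
  qed (simp_all add: S mat2_simps)
  moreover have "b = 0"
    using **(2)
  proof (cases rule: psl_eq_cases)
    case 2
    then have "a + (a + b) = 0" "b + b = 0" "b + d + d = 0" by (simp_all add: S mat2_simps add_ac)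
    then have "a = 0" "d = 0" "b = 0" using double_eq_0 by auto
    then show ?thesis using det by simp
  qed (simp_all add: S mat2_simps)
  ultimately show ?thesis by (simp add: S scalar_mat2)
qed

text \<open>A choice of matrix representatives for an injective endomorphism of PSL(2). Being a
  choice, it is multiplicative only up to sign, but its values can be computed with
  entrywise.\<close>

definition proj_endo :: "('a^2^2 \<Rightarrow> 'a^2^2) \<Rightarrow> bool" where
  "proj_endo F \<longleftrightarrow> (\<forall>A. det A = 1 \<longrightarrow> det (F A) = 1) \<and>
     (\<forall>A B. det A = 1 \<longrightarrow> det B = 1 \<longrightarrow> psl (F (A ** B)) = psl (F A ** F B)) \<and>
     (\<forall>A B. det A = 1 \<longrightarrow> det B = 1 \<longrightarrow> psl (F A) = psl (F B) \<longrightarrow> psl A = psl B)"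

lemma proj_endoD:
  assumes "proj_endo F" "det A = 1"
  shows "det (F A) = 1" "det B = 1 \<Longrightarrow> psl (F (A ** B)) = psl (F A ** F B)"
    "det B = 1 \<Longrightarrow> psl (F A) = psl (F B) \<Longrightarrow> psl A = psl B"
  using assms unfolding proj_endo_def by blast+

lemma proj_endo_act:
  assumes "proj_endo F" "det P \<noteq> 0" shows "proj_endo (\<lambda>A. act P (F A))"
  unfolding proj_endo_def
proof (intro conjI allI impI)
  fix A B :: "'a^2^2" assume A: "det A = 1"
  show "det (act P (F A)) = 1" using proj_endoD(1)[OF assms(1) A] assms(2) by simp
  assume B: "det B = 1"
  show "psl (act P (F (A ** B))) = psl (act P (F A) ** act P (F B))"
    unfolding act_mult[OF assms(2), symmetric] by (rule psl_act_cong[OF proj_endoD(2)[OF assms(1) A B]])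
  assume "psl (act P (F A)) = psl (act P (F B))"
  then show "psl A = psl B" unfolding psl_act_cancel[OF assms(2)] by (rule proj_endoD(3)[OF assms(1) A B])
qed

lemma proj_endo_one: assumes "proj_endo F" shows "psl (F (mat 1)) = psl (mat 1)"
proof -
  have d: "det (F (mat 1)) \<noteq> 0" using proj_endoD(1)[OF assms, of "mat 1"] by simp
  have "psl (F (mat 1)) = psl (F (mat 1) ** F (mat 1))"
    using proj_endoD(2)[OF assms, of "mat 1" "mat 1"] by simp
  then have "F (mat 1) ** mat 1 = F (mat 1) ** F (mat 1) \<or> F (mat 1) ** mat 1 = F (mat 1) ** (- F (mat 1))"
    by (simp add: psl_eq_iff)
  then have "mat 1 = F (mat 1) \<or> mat 1 = - F (mat 1)" unfolding cancel_left[OF d] .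
  then show ?thesis using psl_eq_iff[of "mat 1" "F (mat 1)"] by simp
qed

lemma proj_endo_mpow:
  assumes "proj_endo F" "det A = 1" shows "psl (F (mpow A k)) = psl (mpow (F A) k)"
proof (induction k)
  case (Suc k)
  have "psl (F (A ** mpow A k)) = psl (F A ** F (mpow A k))"
    by (rule proj_endoD(2)[OF assms]) (simp add: assms)
  also have "\<dots> = psl (F A ** mpow (F A) k)" by (rule psl_mult_cong) (simp_all add: Suc)
  finally show ?case by simp
qed (simp add: proj_endo_one[OF assms(1)])

lemma det_beta [simp]: "det mat_\<beta> = 1"
  by (simp add: mat_\<beta>_def mat2_simps)

lemma det_alpha: "det (mat_\<alpha> e) = e"
  by (simp add: mat_\<alpha>_def mat2_simps)

lemma scalar_psl: "psl A = psl B \<Longrightarrow> scalar A \<longleftrightarrow> scalar B"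
proof -
  have "- B = mat (- 1) ** B" by (simp add: mat_uminus)
  then show "psl A = psl B \<Longrightarrow> scalar A \<longleftrightarrow> scalar B"
    using scalar_scal[of "- 1" B] by (auto simp: psl_eq_iff)
qed

lemma scalar_det1: "scalar A \<Longrightarrow> det A = 1 \<Longrightarrow> psl A = psl (mat 1)"
proof -
  assume "scalar A" "det A = 1"
  then obtain c where c: "A = mat c" "c\<^sup>2 = 1" by (auto simp: scalar_def)
  then have "c = 1 \<or> c = - 1" by (simp add: power2_eq_1_iff)
  then show ?thesis using c psl_uminus[of "mat 1"] by (auto simp: mat2_simps)
qed

text \<open>The image is nonscalar and its p-th power is scalar. In PGL(2) the split and nonsplit
  elements have orders dividing p - 1 or p + 1, both prime to p, so only the unipotent case of
  \<open>trichotomy\<close> survives.\<close>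

lemma proj_endo_beta:
  assumes F: "proj_endo F"
  obtains P where "det P \<noteq> 0" "psl (act P (F mat_\<beta>)) = psl mat_\<beta>"
proof -
  define B where "B = F mat_\<beta>"
  have dB: "det B = 1" using proj_endoD(1)[OF F] by (simp add: B_def)
  have nB: "\<not> scalar B"
  proof
    assume "scalar B"
    then have "psl B = psl (F (mat 1))" using scalar_det1 dB proj_endo_one[OF F] by simp
    then have "psl (mat_\<beta> :: 'a^2^2) = psl (mat 1)" unfolding B_def using proj_endoD(3)[OF F, of mat_\<beta> "mat 1"] by simp
    then have "scalar (mat_\<beta> :: 'a^2^2)" using scalar_psl by (metis scalar_mat)
    then show False by (simp add: mat_\<beta>_def scalar_mat2)
  qed
  have "mpow mat_\<beta> CARD('a) = (mat 1 :: 'a^2^2)"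
    using CHAR_prime_card[OF prime] of_nat_CHAR[where 'a = 'a] by (simp add: mpow_beta mat_mat2)
  then have "psl (mpow B CARD('a)) = psl (mat 1)"
    using proj_endo_mpow[OF F, of mat_\<beta> "CARD('a)"] proj_endo_one[OF F] by (simp add: B_def)
  then have sB: "scalar (mpow B CARD('a))" using scalar_psl by (metis scalar_mat)
  have cop: "coprime (CARD('a) - 1) CARD('a)"
    using coprime_diff_one_left_nat[of "CARD('a)"] gt5 by auto
  have cop': "coprime (CARD('a) + 1) CARD('a)" by (simp add: coprime_commute)
  have dB0: "det B \<noteq> 0" using dB by simp
  show thesis using dB0 nB
  proof (cases rule: trichotomy)
    case (unipotent P c)
    \<comment> \<open>Determinants turn the scalar \<open>c\<close> into a sign, which PSL(2) does
      not see.\<close>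
    have "det P * det B = c\<^sup>2 * det P" using arg_cong[OF unipotent(3), of det] by simp
    then have "c\<^sup>2 = 1" using unipotent(1) dB by simp
    then have "c = 1 \<or> c = - 1" by (simp add: power2_eq_1_iff)
    moreover have "act P B = mat c ** mat_\<beta>" using unipotent by (simp add: act_eq_iff)
    ultimately have "psl (act P B) = psl mat_\<beta>" by (auto simp: mat_uminus)
    then show ?thesis using that unipotent B_def by blast
  next
    case (split P c k)
    have "scalar (mpow (mpow (mat_\<alpha> e) k) CARD('a))"
      using scalar_conj[OF mpow_conj_scal[OF split(3)], of "CARD('a)"] split sB by auto
    then have "(CARD('a) - 1) dvd k * CARD('a)" unfolding mpow_mult[symmetric] scalar_mpow_alpha[OF gen_e] .
    then have "(CARD('a) - 1) dvd k" using cop coprime_dvd_mult_left_iff by blast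
    then have "scalar (mpow (mat_\<alpha> e) k)" using scalar_mpow_alpha[OF gen_e] by blast
    then show ?thesis using scalar_conj[OF split(3,1,2)] nB by blast
  next
    case (nonsplit P c k)
    have "scalar (mpow (mpow g0 k) CARD('a))"
      using scalar_conj[OF mpow_conj_scal[OF nonsplit(3)], of "CARD('a)"] nonsplit sB by auto
    then have "(CARD('a) + 1) dvd k * CARD('a)" unfolding mpow_mult[symmetric] scalar_mpow_gamma .
    then have "(CARD('a) + 1) dvd k" using cop' coprime_dvd_mult_left_iff by blast
    then have "scalar (mpow g0 k)" using scalar_mpow_gamma by blast
    then show ?thesis using scalar_conj[OF nonsplit(3,1,2)] nB by blast
  qed
qed

definition torus_elt :: "'a^2^2" where "torus_elt = mat2 e 0 0 (1 / e)"
definition weyl_elt :: "'a^2^2" where "weyl_elt = mat2 0 (- 1) 1 0"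

lemma det_torus_elt [simp]: "det torus_elt = 1" using e_square by (simp add: torus_elt_def mat2_simps)
lemma det_weyl_elt [simp]: "det weyl_elt = 1" by (simp add: weyl_elt_def mat2_simps)

text \<open>\<open>torus_elt\<close> conjugates \<beta> to \<beta>^m with m representing e^2. The
  image obeys the same relation, so it is upper triangular with diagonal (e, 1/e) up to sign; a
  unipotent, which commutes with \<beta>, clears its corner.\<close>

lemma proj_endo_torus:
  assumes F: "proj_endo F" and F\<beta>: "psl (F mat_\<beta>) = psl mat_\<beta>"
  obtains x where "psl (act (mat2 1 x 0 1) (F torus_elt)) = psl torus_elt"
proof -
  obtain A B C D where Ft: "F torus_elt = mat2 A B C D" by (rule mat2_cases)
  obtain m where m: "mat2 1 (e\<^sup>2) 0 1 = mpow mat_\<beta> m" by (rule beta_pow)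
  have det: "A * D - B * C = 1" using proj_endoD(1)[OF F, of torus_elt] by (simp add: Ft mat2_simps)
  have "torus_elt ** mat_\<beta> = mpow mat_\<beta> m ** torus_elt"
    unfolding m[symmetric] using e_square by (simp add: torus_elt_def mat_\<beta>_def mat2_simps power2_eq_square)
  then have "psl (F torus_elt ** F mat_\<beta>) = psl (F (mpow mat_\<beta> m) ** F torus_elt)"
    using proj_endoD(2)[OF F, of torus_elt mat_\<beta>] proj_endoD(2)[OF F, of "mpow mat_\<beta> m" torus_elt] by simp
  also have "\<dots> = psl (mpow (F mat_\<beta>) m ** F torus_elt)"
    by (intro psl_mult_cong proj_endo_mpow[OF F]) simp_all
  also have "\<dots> = psl (mpow mat_\<beta> m ** F torus_elt)" by (rule psl_mult_cong[OF psl_mpow_cong[OF F\<beta>] refl])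
  finally have "psl (F torus_elt ** mat_\<beta>) = psl (mat2 1 (e\<^sup>2) 0 1 ** F torus_elt)"
    unfolding m using psl_mult_cong[OF refl F\<beta>, of "F torus_elt"] by simp
  then have CAD: "C = 0 \<and> A = e\<^sup>2 * D"
  proof (cases rule: psl_eq_cases)
    case 1
    then show ?thesis by (simp add: Ft mat_\<beta>_def mat2_simps add.commute)
  next
    case 2
    then have "C + C = 0" "A + (A + e\<^sup>2 * C) = 0" by (simp_all add: Ft mat_\<beta>_def mat2_simps)
    then have "C = 0" "A = 0" using double_eq_0 by auto
    then show ?thesis using det by simp
  qed
  then have C: "C = 0" and AD: "A = e\<^sup>2 * D" by auto
  then have "(e * D)\<^sup>2 = 1" using det by (simp add: power2_eq_square algebra_simps)
  then have eD: "e * D = 1 \<or> e * D = - 1" by (simp add: power2_eq_1_iff)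
  define \<epsilon> where "\<epsilon> = e * D"
  have \<epsilon>: "\<epsilon> = 1 \<or> \<epsilon> = - 1" "D = \<epsilon> / e" "A = \<epsilon> * e"
    using eD AD e_square by (auto simp: \<epsilon>_def power2_eq_square)
  \<comment> \<open>Conjugation by the unipotent with parameter \<open>x\<close> shifts the corner
    by a multiple of e - 1/e, which is nonzero because e^2 is not 1.\<close>
  define x where "x = \<epsilon> * B / (e - 1 / e)"
  have nz: "e - 1 / e \<noteq> 0" using e_square by (simp add: field_simps power2_eq_square)
  have "\<epsilon> * (x * (e - 1 / e)) = B" using \<epsilon>(1) nz by (auto simp: x_def)
  then have "mat2 1 x 0 1 ** F torus_elt = mat \<epsilon> ** torus_elt ** mat2 1 x 0 1"
    unfolding Ft by (simp add: C \<epsilon>(2,3) torus_elt_def mat2_simps algebra_simps)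
  then have "act (mat2 1 x 0 1) (F torus_elt) = mat \<epsilon> ** torus_elt" by (subst act_eq_iff) (simp_all add: mat2_simps)
  then have "psl (act (mat2 1 x 0 1) (F torus_elt)) = psl torus_elt" using \<epsilon>(1) by (auto simp: mat_uminus)
  then show thesis by (rule that)
qed

text \<open>Write t for \<open>torus_elt\<close> and w for \<open>weyl_elt\<close>. The relation t w
  t = w makes the image antidiagonal, and (w \<beta>)^3 = -1 then fixes its entries up to a common
  sign.\<close>

lemma proj_endo_weyl:
  assumes F: "proj_endo F" and F\<beta>: "psl (F mat_\<beta>) = psl mat_\<beta>" and Ft: "psl (F torus_elt) = psl torus_elt"
  shows "psl (F weyl_elt) = psl weyl_elt"
proof -
  obtain A B C D where Fw: "F weyl_elt = mat2 A B C D" by (rule mat2_cases)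
  have det: "A * D - B * C = 1" using proj_endoD(1)[OF F, of weyl_elt] by (simp add: Fw mat2_simps)
  have "torus_elt ** (weyl_elt ** torus_elt) = weyl_elt" using e_square by (simp add: torus_elt_def weyl_elt_def mat2_simps)
  then have "psl (F weyl_elt) = psl (F torus_elt ** F (weyl_elt ** torus_elt))" using proj_endoD(2)[OF F, of torus_elt "weyl_elt ** torus_elt"] by simp
  also have "\<dots> = psl (torus_elt ** (F weyl_elt ** torus_elt))"
    using psl_mult_cong[OF Ft, of "F (weyl_elt ** torus_elt)" "F weyl_elt ** torus_elt"] proj_endoD(2)[OF F, of weyl_elt torus_elt]
      psl_mult_cong[OF refl Ft, of "F weyl_elt"] by simp
  finally have "psl (F weyl_elt) = psl (torus_elt ** (F weyl_elt ** torus_elt))" .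
  then have AD: "A = 0 \<and> D = 0"
  proof (cases rule: psl_eq_cases)
    case 1
    then have "A = e\<^sup>2 * A" "D = D / e\<^sup>2" by (simp_all add: Fw torus_elt_def mat2_simps power2_eq_square)
    then have "A * (1 - e\<^sup>2) = 0" "D * (1 - e\<^sup>2) = 0" using e_square by (simp_all add: field_simps)
    then show ?thesis using e_square by auto
  next
    case 2
    then have "A + e\<^sup>2 * A = 0" "B + B = 0" using e_square
      by (simp_all add: Fw torus_elt_def mat2_simps power2_eq_square ac_simps)
    then have "A * (1 + e\<^sup>2) = 0" "B = 0" using double_eq_0 by (auto simp: algebra_simps)
    moreover have "1 + e\<^sup>2 \<noteq> 0" using e_square by (metis add.commute eq_neg_iff_add_eq_0)
    ultimately show ?thesis using det by simp
  qed
  have BC: "B * C = - 1"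
  proof -
    have "- (B * C) = 1" using AD det by simp
    then have "- (- (B * C)) = - 1" by (simp only:)
    then show ?thesis by simp
  qed
  have "mpow (weyl_elt ** mat_\<beta>) 3 = - mat 1" by (simp add: weyl_elt_def mat_\<beta>_def mat2_simps numeral_3_eq_3)
  moreover have dd: "det (weyl_elt ** mat_\<beta>) = 1" by simp
  ultimately have "psl (F (- mat 1)) = psl (mpow (F (weyl_elt ** mat_\<beta>)) 3)"
    using proj_endo_mpow[OF F dd, of 3] by simp
  \<comment> \<open>\<open>proj_endo\<close> does not say that F respects signs, so its value at -1
    is found from w^2 = -1.\<close>
  moreover have "psl (F (- mat 1)) = psl (mat 1)"
  proof -
    have "mpow weyl_elt 2 = - mat 1" by (simp add: weyl_elt_def mat2_simps numeral_2_eq_2)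
    then have "psl (F (- mat 1)) = psl (mpow (F weyl_elt) 2)" using proj_endo_mpow[OF F det_weyl_elt, of 2] by simp
    also have "mpow (F weyl_elt) 2 = - mat 1" using AD BC by (simp add: Fw mat2_simps numeral_2_eq_2 mult.commute[of C])
    finally show ?thesis by simp
  qed
  moreover have "psl (F (weyl_elt ** mat_\<beta>)) = psl (F weyl_elt ** mat_\<beta>)"
    using proj_endoD(2)[OF F, of weyl_elt mat_\<beta>] psl_mult_cong[OF refl F\<beta>, of "F weyl_elt"] by simp
  then have "psl (mpow (F (weyl_elt ** mat_\<beta>)) 3) = psl (mpow (F weyl_elt ** mat_\<beta>) 3)"
    by (rule psl_mpow_cong)
  ultimately have "scalar (mpow (F weyl_elt ** mat_\<beta>) 3)" using scalar_psl by (metis scalar_mat)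
  then have "C * (B * C) + C * (C * C) = 0" using AD
    by (simp add: Fw mat_\<beta>_def mat2_simps numeral_3_eq_3 scalar_mat2 algebra_simps)
  moreover note BC
  ultimately have "C * (C\<^sup>2 - 1) = 0" "C \<noteq> 0" by (auto simp: algebra_simps power2_eq_square)
  then have "C = 1 \<or> C = - 1" by (simp add: power2_eq_1_iff)
  then show ?thesis unfolding Fw using AD BC by (auto simp: weyl_elt_def psl_eq_iff mat2_simps)
qed

text \<open>The matrices fixed up to sign are closed under products. They include both root
  subgroups, hence all matrices with c nonzero as products of three unipotents, and a factor
  \<open>weyl_elt\<close> reaches c = 0.\<close>

lemma proj_endo_id:
  assumes F: "proj_endo F" and F\<beta>: "psl (F mat_\<beta>) = psl mat_\<beta>" and Fw: "psl (F weyl_elt) = psl weyl_elt"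
    and "det A = 1"
  shows "psl (F A) = psl A"
proof -
  define K where "K = {A. det A = 1 \<and> psl (F A) = psl A}"
  have K_mult: "A ** B \<in> K" if "A \<in> K" "B \<in> K" for A B
    using that proj_endoD(2)[OF F, of A B] psl_mult_cong[of "F A" A "F B" B] by (simp add: K_def)
  have b: "mat_\<beta> \<in> K" and w: "weyl_elt \<in> K" by (auto simp: K_def F\<beta> Fw)
  have one: "mat 1 \<in> K" using proj_endo_one[OF F] by (simp add: K_def)
  have U: "mat2 1 x 0 1 \<in> K" for x
  proof -
    obtain m where m: "mat2 1 x 0 1 = mpow mat_\<beta> m" by (rule beta_pow)
    have "mpow mat_\<beta> m \<in> K" by (induction m) (auto intro: one K_mult b)
    then show ?thesis by (simp add: m)
  qed
  have w': "- weyl_elt \<in> K"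
  proof -
    have "- weyl_elt = weyl_elt ** (weyl_elt ** weyl_elt)" by (simp add: weyl_elt_def mat2_simps)
    then show ?thesis using K_mult w by metis
  qed
  have L: "mat2 1 0 x 1 \<in> K" for x
  proof -
    have "mat2 1 0 x 1 = weyl_elt ** mat2 1 (- x) 0 1 ** (- weyl_elt)" by (simp add: weyl_elt_def mat2_simps)
    then show ?thesis using K_mult w w' U by metis
  qed
  have big: "mat2 a b c d \<in> K" if "a * d - b * c = 1" "c \<noteq> 0" for a b c d
  proof -
    \<comment> \<open>These make the diagonal entries of the product of three unipotents equal to
      \<open>a\<close> and \<open>d\<close>; the determinant then gives the corner
      \<open>b\<close>.\<close>
    define p q where "p = (a - 1) / c" and "q = (d - 1) / c"
    have pq: "p * c = a - 1" "q * c = d - 1" using that by (simp_all add: p_def q_def)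
    have "(a * q + p) * c = a * (q * c) + p * c" by (simp add: algebra_simps)
    also have "\<dots> = b * c" unfolding pq using that by (simp add: algebra_simps)
    finally have "(a * q + p) * c = b * c" .
    then have "a * q + p = b" using that by simp
    moreover have "mat2 1 p 0 1 ** mat2 1 0 c 1 ** mat2 1 q 0 1 = mat2 (1 + p * c) ((1 + p * c) * q + p) c (q * c + 1)"
      by (simp add: mat2_simps mult.commute)
    ultimately have "mat2 1 p 0 1 ** mat2 1 0 c 1 ** mat2 1 q 0 1 = mat2 a b c d" unfolding pq by simp
    then show ?thesis using K_mult[OF K_mult[OF U L] U] by metis
  qed
  obtain a b c d where A: "A = mat2 a b c d" by (rule mat2_cases)
  have det: "a * d - b * c = 1" using \<open>det A = 1\<close> by (simp add: A mat2_simps)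
  have "A \<in> K"
  proof (cases "c = 0")
    case True
    then have "mat2 b (- a) d (- c) \<in> K" using det by (intro big) auto
    moreover have "A = mat2 b (- a) d (- c) ** (- weyl_elt)" by (simp add: A weyl_elt_def mat2_simps)
    ultimately show ?thesis using K_mult w' by metis
  qed (use big A det in auto)
  then show ?thesis by (simp add: K_def)
qed

text \<open>Representatives of f are conjugated by \<open>P\<close> to fix \<beta> and by a
  unipotent \<open>Q\<close> to fix the torus element as well. Then they fix everything up to sign,
  so f is conjugation by the inverse of Q P.\<close>

lemma PSL2_automorphism:
  fixes f :: "('a^2^2) set \<Rightarrow> ('a^2^2) set"
  assumes "f \<in> iso PSL2 PSL2"
  obtains P where "det P \<noteq> 0" "\<And>A. det A = 1 \<Longrightarrow> f (psl A) = psl (act P A)"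
proof -
  have hom: "f \<in> hom PSL2 PSL2" and inj: "inj_on f (carrier PSL2)"
    using assms by (auto simp: iso_def bij_betw_def)
  have "\<forall>A. \<exists>B. det A = 1 \<longrightarrow> det B = 1 \<and> f (psl A) = psl B"
  proof
    fix A :: "'a^2^2"
    show "\<exists>B. det A = 1 \<longrightarrow> det B = 1 \<and> f (psl A) = psl B"
    proof (cases "det A = 1")
      case True
      then have "f (psl A) \<in> carrier PSL2" using hom by (auto simp: hom_def)
      then show ?thesis by (auto simp: carrier_PSL2)
    qed auto
  qed
  then obtain F where F: "\<And>A. det A = 1 \<Longrightarrow> det (F A) = 1" "\<And>A. det A = 1 \<Longrightarrow> f (psl A) = psl (F A)"
    by metis
  have F0: "proj_endo F"
    unfolding proj_endo_def
  proof (intro conjI allI impI)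
    fix A B :: "'a^2^2" assume AB: "det A = 1" "det B = 1"
    have "f (psl A \<otimes>\<^bsub>PSL2\<^esub> psl B) = f (psl A) \<otimes>\<^bsub>PSL2\<^esub> f (psl B)"
      using hom AB by (intro hom_mult) auto
    then show "psl (F (A ** B)) = psl (F A ** F B)" using AB F by simp
    assume "psl (F A) = psl (F B)"
    then have "f (psl A) = f (psl B)" using F AB by simp
    then show "psl A = psl B" using inj AB by (auto dest: inj_onD)
  qed (rule F)
  obtain P where P: "det P \<noteq> 0" "psl (act P (F mat_\<beta>)) = psl mat_\<beta>"
    using proj_endo_beta[OF F0] by blast
  have F1: "proj_endo (\<lambda>A. act P (F A))" by (rule proj_endo_act[OF F0 P(1)])
  obtain x where x: "psl (act (mat2 1 x 0 1) (act P (F torus_elt))) = psl torus_elt"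
    using proj_endo_torus[OF F1 P(2)] by blast
  define Q where "Q = mat2 1 x 0 (1::'a)"
  have Q: "det Q \<noteq> 0" by (simp add: Q_def mat2_simps)
  have F2: "proj_endo (\<lambda>A. act Q (act P (F A)))" by (rule proj_endo_act[OF F1 Q])
  have b: "psl (act Q (act P (F mat_\<beta>))) = psl mat_\<beta>"
  proof -
    have "act Q mat_\<beta> = mat_\<beta>" unfolding act_eq_iff[OF Q] by (simp add: Q_def mat_\<beta>_def mat2_simps add.commute)
    then show ?thesis using psl_act_cong[OF P(2), of Q] by simp
  qed
  note id = proj_endo_id[OF F2 b proj_endo_weyl[OF F2 b x[folded Q_def]]]
  show thesis
  proof (rule that[of "minv (Q ** P)"])
    show "det (minv (Q ** P)) \<noteq> 0" using P Q by simp
    fix A :: "'a^2^2" assume A: "det A = 1"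
    have "psl (act (Q ** P) (F A)) = psl A" using id[OF A] P Q by (simp add: act_act)
    then have "psl (act (minv (Q ** P)) (act (Q ** P) (F A))) = psl (act (minv (Q ** P)) A)"
      by (rule psl_act_cong)
    then show "f (psl A) = psl (act (minv (Q ** P)) A)" using F A P Q by simp
  qed
qed

end

section \<open>Regular maps as pairs of matrices\<close>

lemma conj_act_pow:
  "det S \<noteq> 0 \<Longrightarrow> conj_act (pgl S [^]\<^bsub>PGL2\<^esub> (i::nat)) (psl A) = psl (act (mpow S i) A)"
  by (simp add: pow_PGL2 conj_act_psl)

lemma conj_orbit_eq:
  assumes "det S \<noteq> 0"
  shows "conj_orbit (pgl S) (psl A) = {psl (act (mpow S i) A) | i. i \<ge> 1}"
  unfolding conj_orbit_def by (simp add: conj_act_pow[OF assms])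

lemma conj_act_iso:
  fixes P :: "'a::field^2^2"
  assumes "det P \<noteq> 0" shows "conj_act (pgl P) \<in> iso PSL2 PSL2"
proof -
  have "bij_betw (conj_act (pgl P)) (carrier PSL2) (carrier PSL2)"
    by (rule bij_betw_byWitness[where f' = "conj_act (pgl (minv P))"])
      (use assms in \<open>auto simp: carrier_PSL2 conj_act_psl\<close>)
  moreover have "conj_act (pgl P) \<in> hom PSL2 PSL2"
    by (rule homI) (use assms in \<open>auto simp: carrier_PSL2 conj_act_psl act_mult\<close>)
  ultimately show ?thesis by (simp add: iso_def)
qed

lemma square_traceless:
  fixes A :: "'a::field^2^2"
  assumes "det A = 1" "tr A = 0" shows "A ** A = - mat 1"
proof -
  obtain a b c d where A: "A = mat2 a b c d" by (rule mat2_cases)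
  have "d = - a" using assms(2) by (simp add: A mat2_simps add_eq_0_iff)
  moreover have "a * a + b * c = - (a * (- a) - b * c)" by simp
  then have "a * a + b * c = - 1" using assms(1) \<open>d = - a\<close> by (simp only: A det_mat2)
  ultimately show ?thesis by (simp add: A mat2_simps algebra_simps)
qed

text \<open>By Cayley-Hamilton the square of \<open>A\<close> is tr(A) A - 1. If it is scalar while
  the trace is nonzero, \<open>A\<close> is scalar and so trivial in PSL(2).\<close>

lemma involution_traceless:
  fixes A :: "'a::field^2^2"
  assumes "det A = 1" "psl A \<otimes>\<^bsub>PSL2\<^esub> psl A = \<one>\<^bsub>PSL2\<^esub>" "psl A \<noteq> \<one>\<^bsub>PSL2\<^esub>"
  shows "tr A = 0"
proof (rule ccontr)
  assume t: "tr A \<noteq> 0"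
  obtain a b c d where A: "A = mat2 a b c d" by (rule mat2_cases)
  have "scalar (A ** A)" using assms(2) unfolding mult_PSL2 one_PSL2 psl_eq_iff by (auto simp: scalar_def mat2_simps)
  then have "b * (a + d) = 0" "c * (a + d) = 0" "(a - d) * (a + d) = 0"
    by (simp_all add: A mat2_simps scalar_mat2 algebra_simps)
  then have "b = 0" "c = 0" "a = d" using t by (simp_all add: A mat2_simps)
  then have "A = mat a" "a * a = 1" using assms(1) by (simp_all add: A mat2_simps)
  then have "psl A = psl (mat 1)"
    using psl_uminus[of "mat 1"] by (auto simp: mat2_simps square_eq_1_iff)
  then show False using assms(3) one_PSL2 by metis
qed

lemma traceless_cases:
  assumes "tr V = (0::'a::field)" obtains X Y Z where "V = mat2 X Y Z (- X)"
proof -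
  obtain X Y Z W where V: "V = mat2 X Y Z W" by (rule mat2_cases)
  then have "W = - X" using assms by (simp add: mat2_simps add_eq_0_iff)
  then show ?thesis using V that by blast
qed

context quadratic_extension
begin

text \<open>A family of fewer than \<open>p\<close> lines cannot be permuted by a nontrivial unipotent subgroup, unless
  it is fixed pointwise.\<close>

lemma unipotent_orbit:
  fixes F :: "('a^2^2) set" and U :: "'a \<Rightarrow> 'a^2^2"
  assumes F: "finite F" "card F < CARD('a)" and nz: "V \<noteq> 0"
    and U: "\<And>x. det (U x) = 1"
    and R: "\<And>x. \<exists>v\<in>F. \<exists>l. U x ** V = mat l ** v ** U x"
  obtains x y a b where "x \<noteq> y" "a \<noteq> 0" "b \<noteq> 0" "mat a ** act (U x) (V) = mat b ** act (U y) (V)"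
proof -
  obtain j l where j: "\<And>x. j x \<in> F" and l: "\<And>x. U x ** V = mat (l x) ** j x ** U x"
    using R by metis
  have "card (range j) \<le> card F" using j F(1) by (intro card_mono) auto
  then have "\<not> inj_on j UNIV" using F(2) pigeonhole[of j UNIV] by simp
  then obtain x y where xy: "x \<noteq> y" "j x = j y" by (auto simp: inj_on_def)
  have a: "act (U x) (V) = mat (l x) ** j x" for x
    using l U[of x] by (simp add: act_eq_iff)
  have "l x \<noteq> 0" for x
  proof
    assume "l x = 0"
    then have "act (U x) (V) = 0" unfolding a by (simp add: mat_def matrix_matrix_mult_def vec_eq_iff)
    then have "U x ** V = 0 ** U x" using act_eq_iff[of "U x"] U by simp
    also have "\<dots> = U x ** 0" by (simp add: matrix_matrix_mult_def vec_eq_iff)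
    finally have "U x ** V = U x ** 0" .
    moreover have "det (U x) \<noteq> 0" using U[of x] by simp
    ultimately have "V = 0" using cancel_left by blast
    then show False using nz by simp
  qed
  then show thesis using xy a that[of x y "l y" "l x"] by (simp add: mult.commute)
qed

text \<open>By \<open>unipotent_orbit\<close> two distinct upper unipotents send \<open>V\<close> to
  the same line. The entries of the conjugates are polynomials in the parameter, and proportionality
  leaves only the nilpotent line that upper unipotents fix. Lower unipotents then kill the remaining
  entry \<open>Y\<close>.\<close>

lemma no_small_stable_set:
  fixes F :: "('a^2^2) set"
  assumes F: "finite F" "card F < CARD('a)" and V: "V \<in> F" "tr V = 0" "V \<noteq> 0"
    and R: "\<And>g v. det g = 1 \<Longrightarrow> v \<in> F \<Longrightarrow> \<exists>v'\<in>F. \<exists>l. g ** v = mat l ** v' ** g"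
  shows False
proof -
  obtain X Y Z where V0: "V = mat2 X Y Z (- X)" using traceless_cases V(2) by blast
  have mU: "minv (mat2 1 x 0 1) = mat2 1 (- x) 0 1" "minv (mat2 1 0 x 1) = mat2 1 0 (- x) 1" for x :: 'a
    by (simp_all add: minv_def mat2_simps)
  have aU: "act (mat2 1 x 0 1) V = mat2 (X + x * Z) (Y - x * X - x * (X + x * Z)) Z (- X - x * Z)" for x
    unfolding act_def V0 mU by (simp add: mat2_simps algebra_simps)
  have det: "det (mat2 1 x 0 1) = (1::'a)" for x by (simp add: mat2_simps)
  have R0: "\<exists>v\<in>F. \<exists>l. mat2 1 x 0 1 ** V = mat l ** v ** mat2 1 x 0 1" for x
    using R[OF det V(1)] .
  obtain x y a b where xy: "x \<noteq> y" "a \<noteq> 0" "b \<noteq> 0"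
    "mat a ** act (mat2 1 x 0 1) V = mat b ** act (mat2 1 y 0 1) V"
    by (rule unipotent_orbit[where V = V and U = "\<lambda>x. mat2 1 x 0 1", OF F V(3) det R0])
  then have 1: "a * Z = b * Z" "a * (X + x * Z) = b * (X + y * Z)"
    "a * (Y - x * X - x * (X + x * Z)) = b * (Y - y * X - y * (X + y * Z))"
    unfolding aU mat_mat2 mat2_mult by simp_all
  have "Z = 0"
  proof (rule ccontr)
    assume "Z \<noteq> 0"
    then have "a = b" using 1(1) mult_right_cancel by blast
    then have "X + x * Z = X + y * Z" using 1(2) xy(3) mult_left_cancel by blast
    then show False using \<open>Z \<noteq> 0\<close> xy(1) by simp
  qed
  have "X = 0"
  proof (rule ccontr)
    assume "X \<noteq> 0"
    have "a * X = b * X" using 1(2) unfolding \<open>Z = 0\<close> by simp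
    then have "a = b" using \<open>X \<noteq> 0\<close> mult_right_cancel by blast
    then have "Y - x * X - x * (X + x * Z) = Y - y * X - y * (X + y * Z)" using 1(3) xy(3) mult_left_cancel by blast
    then have "2 * (x * X) = 2 * (y * X)" unfolding \<open>Z = 0\<close> by (auto simp: mult_2 algebra_simps)
    then show False using \<open>X \<noteq> 0\<close> xy(1) two_nonzero by simp
  qed
  have aL: "act (mat2 1 0 x 1) V = mat2 (- x * Y) Y (- x * (x * Y)) (x * Y)" for x
    unfolding act_def V0 mU \<open>X = 0\<close> \<open>Z = 0\<close> by (simp add: mat2_simps algebra_simps)
  have det: "det (mat2 1 0 x 1) = (1::'a)" for x by (simp add: mat2_simps)
  have R0: "\<exists>v\<in>F. \<exists>l. mat2 1 0 x 1 ** V = mat l ** v ** mat2 1 0 x 1" for x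
    using R[OF det V(1)] .
  obtain x y a b where xy: "x \<noteq> y" "a \<noteq> 0" "b \<noteq> 0"
    "mat a ** act (mat2 1 0 x 1) V = mat b ** act (mat2 1 0 y 1) V"
    by (rule unipotent_orbit[where V = V and U = "\<lambda>x. mat2 1 0 x 1", OF F V(3) det R0])
  then have 2: "a * Y = b * Y" "a * (x * Y) = b * (y * Y)"
    unfolding aL mat_mat2 mat2_mult by simp_all
  have "Y = 0"
  proof (rule ccontr)
    assume "Y \<noteq> 0"
    then have "a = b" using 2(1) mult_right_cancel by blast
    then have "x * Y = y * Y" using 2(2) xy(3) mult_left_cancel by blast
    then show False using \<open>Y \<noteq> 0\<close> xy(1) by simp
  qed
  then show False using V(3) \<open>X = 0\<close> \<open>Z = 0\<close> by (simp add: V0 mat2_simps)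
qed

end

locale matrix_map = quadratic_extension e w1 w2 \<iota> s
  for e w1 w2 :: "'a::{field,finite}" and \<iota> :: "'a \<Rightarrow> 'b::{field,finite}" and s :: 'b +
  fixes \<Omega> :: "('a^2^2) set set" and \<rho> :: "('a^2^2) set \<Rightarrow> ('a^2^2) set" and S A :: "'a^2^2"
  assumes map: "involutory_cayley_map PSL2 \<Omega> \<rho>"
    and det_S: "det S \<noteq> 0" and det_A: "det A = 1" and tr_A: "tr A = 0"
    and \<Omega>_eq: "\<Omega> = conj_orbit (pgl S) (psl A)"
    and \<rho>_eq: "\<And>\<omega>. \<omega> \<in> \<Omega> \<Longrightarrow> \<rho> \<omega> = conj_act (pgl S) \<omega>"

text \<open>The automorphism extending the rotation is conjugation by a matrix \<open>P\<close>,
  which serves as \<open>S\<close>; a representative of any one generator serves as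
  \<open>A\<close>, and it is traceless because the generator is an involution.\<close>

lemma (in quadratic_extension) regular_matrix_map:
  fixes \<Omega> :: "('a^2^2) set set"
  assumes map: "involutory_cayley_map PSL2 \<Omega> \<rho>" and reg: "regular_map (cayley_map PSL2 \<Omega> \<rho>)"
  obtains S A where "matrix_map e w1 w2 \<iota> s \<Omega> \<rho> S A"
proof -
  interpret involutory_cayley_map PSL2 \<Omega> \<rho> by fact
  obtain f where f: "f \<in> iso PSL2 PSL2" "\<And>\<omega>. \<omega> \<in> \<Omega> \<Longrightarrow> f \<omega> = \<rho> \<omega>"
    using regular_imp_rotation_extends[OF reg] by blast
  obtain P where P: "det P \<noteq> 0" "\<And>A. det A = 1 \<Longrightarrow> f (psl A) = psl (act P A)"
    using PSL2_automorphism[OF f(1)] by blast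
  obtain \<omega>0 where \<omega>0: "\<omega>0 \<in> \<Omega>" "\<Omega> = orbit \<rho> \<omega>0" using cyc by (auto simp: cyclic_on_def)
  have generator_representative: "\<exists>B. det B = 1 \<and> \<omega> = psl B" if "\<omega> \<in> \<Omega>" for \<omega>
    using that gens by (auto simp: carrier_PSL2)
  obtain A where A: "det A = 1" "\<omega>0 = psl A" using generator_representative \<omega>0 by blast
  have rho: "\<rho> \<omega> = conj_act (pgl P) \<omega>" if "\<omega> \<in> \<Omega>" for \<omega>
    using generator_representative[OF that] P f(2)[OF that] by (auto simp: conj_act_psl)
  have pow: "(\<rho> ^^ k) \<omega>0 = psl (act (mpow P k) A)" for k
  proof (induction k)
    case (Suc k)
    have "(\<rho> ^^ k) \<omega>0 \<in> \<Omega>" using cyclic_on_funpow_in[OF cyc \<omega>0(1)] .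
    then show ?case using rho[of "(\<rho> ^^ k) \<omega>0"] Suc P by (simp add: conj_act_psl act_act)
  qed (simp add: A act_one)
  \<comment> \<open>\<open>orbit\<close> collects positive iterates, which matches the index range
    of \<open>conj_orbit\<close>.\<close>
  have "\<Omega> = {psl (act (mpow P i) A) | i. i \<ge> 1}"
    unfolding \<omega>0(2) orbit_altdef pow by (simp add: Suc_le_eq)
  then have "\<Omega> = conj_orbit (pgl P) (psl A)" using conj_orbit_eq[OF P(1)] by metis
  moreover have "tr A = 0"
    using involution_traceless[OF A(1)] \<omega>0(1) invol unfolding A(2) type_II_def by metis
  ultimately show thesis
    by (intro that[of P A] matrix_map.intro quadratic_extension_axioms matrix_map_axioms.intro map P A rho)
qed

section \<open>The order of the rotation, invariant lines, and isomorphism as conjugacy\<close>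

context matrix_map
begin

sublocale involutory_cayley_map PSL2 \<Omega> \<rho> by (rule map)

lemma generator_representative: "\<omega> \<in> \<Omega> \<Longrightarrow> \<exists>B. det B = 1 \<and> \<omega> = psl B"
  using gens by (auto simp: carrier_PSL2)

lemma carrier_representative: "h \<in> carrier PSL2 \<Longrightarrow> \<exists>B. det B = 1 \<and> h = psl B"
  by (auto simp: carrier_PSL2)

text \<open>Conjugation by \<open>T\<close> is an automorphism; fixing the generators it is the
  identity, and PSL(2) has trivial centraliser in PGL(2).\<close>

lemma conj_fixing_scalar:
  assumes T: "det T \<noteq> 0" and fix_\<Omega>: "\<And>\<omega>. \<omega> \<in> \<Omega> \<Longrightarrow> conj_act (pgl T) \<omega> = \<omega>"
  shows "scalar T"
proof (rule centralizer_scalar[OF T])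
  have hom: "conj_act (pgl T) \<in> hom PSL2 PSL2" using conj_act_iso[OF T] by (auto simp: iso_def)
  have [simp]: "conj_act (pgl T) h = h" if "h \<in> carrier PSL2" for h
    using that
  proof (induction rule: generator_induct)
    case one
    then show ?case unfolding one_PSL2 conj_act_psl[OF T] by (simp add: act_def T)
  next
    case (step h \<omega>)
    then show ?case using hom_mult[OF hom, of h \<omega>] fix_\<Omega> gens by auto
  qed
  then show "psl (act T B) = psl B" if "det B = 1" for B
    unfolding conj_act_psl[OF T, symmetric] by (simp add: that)
qed

lemma rotation_power: "\<omega> \<in> \<Omega> \<Longrightarrow> (\<rho> ^^ k) \<omega> = conj_act (pgl (mpow S k)) \<omega>"
proof (induction k)
  case 0
  then obtain B where "det B = 1" "\<omega> = psl B" using generator_representative by blast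
  then show ?case by (simp add: conj_act_psl act_one)
next
  case (Suc k)
  obtain B where B: "det B = 1" "\<omega> = psl B" using generator_representative Suc by blast
  have "(\<rho> ^^ k) \<omega> \<in> \<Omega>" using cyclic_on_funpow_in[OF cyc Suc.prems] .
  then show ?case using \<rho>_eq[of "(\<rho> ^^ k) \<omega>"] Suc B det_S by (simp add: conj_act_psl act_act)
qed

text \<open>\<open>conj_orbit\<close> starts at exponent 1, so the class of \<open>A\<close> itself
  is reached only because the rotation is periodic.\<close>

lemma base_in: "psl A \<in> \<Omega>"
proof -
  obtain \<omega> where "\<omega> \<in> \<Omega>" using cyc by (auto simp: cyclic_on_def)
  then obtain i where i: "\<omega> = psl (act (mpow S i) A)" unfolding \<Omega>_eq conj_orbit_eq[OF det_S] by blast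
  have "(\<rho> ^^ (i * card \<Omega>)) \<omega> = \<omega>" using cyclic_on_fixpoint_iff[OF cyc \<open>\<omega> \<in> \<Omega>\<close>] by simp
  \<comment> \<open>Chosen so that i + j is a multiple of the cycle length: rotating by
    \<open>j\<close> undoes the i-th conjugation.\<close>
  define j where "j = i * card \<Omega> - i"
  have pos: "card \<Omega> > 0" using \<open>\<omega> \<in> \<Omega>\<close> finite_cyclic_on[OF cyc] by (auto simp: card_gt_0_iff)
  then have ji: "i + j = i * card \<Omega>" by (cases "card \<Omega>") (auto simp: j_def)
  define \<omega>' where "\<omega>' = (\<rho> ^^ j) \<omega>"
  have \<omega>': "\<omega>' \<in> \<Omega>" unfolding \<omega>'_def using cyclic_on_funpow_in[OF cyc \<open>\<omega> \<in> \<Omega>\<close>] .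
  have "conj_act (pgl (mpow S i)) \<omega>' = \<omega>"
    using rotation_power[OF \<omega>', of i] \<open>(\<rho> ^^ (i * card \<Omega>)) \<omega> = \<omega>\<close> unfolding \<omega>'_def ji[symmetric] by (simp add: funpow_add)
  moreover obtain B where B: "det B = 1" "\<omega>' = psl B" using generator_representative[OF \<omega>'] by blast
  ultimately have "psl (act (mpow S i) B) = psl (act (mpow S i) A)" using i det_S by (simp add: conj_act_psl)
  then have "psl B = psl A" using det_S by (simp add: psl_act_cancel)
  then show ?thesis using \<omega>' B by simp
qed

text \<open>A scalar power fixes the class of \<open>A\<close>, so k is a multiple of the cycle
  length. Conversely, such a power fixes every generator and \<open>conj_fixing_scalar\<close>
  applies. Thus the valency is the order of \<open>S\<close> in PGL(2).\<close>

lemma scalar_power_iff: "scalar (mpow S k) \<longleftrightarrow> card \<Omega> dvd k"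
proof
  assume "scalar (mpow S k)"
  then obtain c where c: "mpow S k = mat c" by (auto simp: scalar_def)
  then have "det (mpow S k) = c\<^sup>2" by simp
  then have "c \<noteq> 0" using det_S by auto
  then have "act (mpow S k) A = A" unfolding c by (simp add: act_eq_iff mat_times_comm[of A])
  then have "(\<rho> ^^ k) (psl A) = psl A" using rotation_power[OF base_in, of k] det_S by (simp add: conj_act_psl)
  then show "card \<Omega> dvd k" using cyclic_on_fixpoint_iff[OF cyc base_in] by simp
next
  assume k: "card \<Omega> dvd k"
  show "scalar (mpow S k)"
  proof (rule conj_fixing_scalar)
    fix \<omega> assume "\<omega> \<in> \<Omega>"
    then show "conj_act (pgl (mpow S k)) \<omega> = \<omega>"
      using cyclic_on_fixpoint_iff[OF cyc, of \<omega> k] rotation_power[of \<omega> k] k by simp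
  qed (use det_S in simp)
qed

text \<open>The property \<open>R\<close> of sending lines of \<open>F\<close> to lines of
  \<open>F\<close> is written without inverses so that it composes. It holds for \<open>S\<close>
  and \<open>A\<close>, hence for all generators and for every matrix of determinant 1, against
  \<open>no_small_stable_set\<close>.\<close>

lemma no_invariant_set:
  fixes F :: "('a^2^2) set"
  assumes F: "finite F" "F \<noteq> {}" "card F < CARD('a)" and FV: "\<And>v. v \<in> F \<Longrightarrow> tr v = 0 \<and> v \<noteq> 0"
    and FS: "\<And>v. v \<in> F \<Longrightarrow> \<exists>v'\<in>F. \<exists>l. S ** v = mat l ** v' ** S"
    and FA: "\<And>v. v \<in> F \<Longrightarrow> \<exists>v'\<in>F. \<exists>l. A ** v = mat l ** v' ** A"
  shows False
proof -
  define R where "R g \<longleftrightarrow> (\<forall>v\<in>F. \<exists>v'\<in>F. \<exists>l. g ** v = mat l ** v' ** g)" for g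
  have R_mult: "R (g ** h)" if "R g" "R h" for g h
    unfolding R_def
  proof
    fix v assume "v \<in> F"
    then obtain v1 l where v1: "v1 \<in> F" "h ** v = mat l ** v1 ** h" using \<open>R h\<close> by (auto simp: R_def)
    then obtain v2 l' where v2: "v2 \<in> F" "g ** v1 = mat l' ** v2 ** g" using \<open>R g\<close> by (auto simp: R_def)
    have "g ** h ** v = g ** (mat l ** (v1 ** h))" using v1(2) by (simp add: matrix_mul_assoc[symmetric])
    also have "\<dots> = mat l ** (g ** v1) ** h" unfolding mat_left_move[of g] by (simp add: matrix_mul_assoc)
    also have "\<dots> = mat (l * l') ** v2 ** (g ** h)" unfolding v2(2) by (simp add: matrix_mul_assoc)
    finally show "\<exists>v'\<in>F. \<exists>l. g ** h ** v = mat l ** v' ** (g ** h)" using v2(1) by blast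
  qed
  have R_mat: "R (mat c)" for c
    unfolding R_def
  proof
    fix v assume "v \<in> F"
    moreover have "mat c ** v = mat 1 ** v ** mat c" by (simp add: mat_times_comm[of v])
    ultimately show "\<exists>v'\<in>F. \<exists>l. mat c ** v = mat l ** v' ** mat c" by blast
  qed
  have R_minus: "R (- g)" if "R g" for g
    using R_mult[OF R_mat[of "- 1"] that] by (simp add: mat_uminus)
  have R_pow: "R (mpow S k)" for k
  proof (induction k)
    case (Suc k)
    then show ?case unfolding mpow.simps by (intro R_mult) (use FS in \<open>auto simp: R_def\<close>)
  qed (simp add: R_mat)
  have RA: "R A" using FA by (simp add: R_def)
  have pos: "card \<Omega> > 0" using base_in finite_cyclic_on[OF cyc] by (auto simp: card_gt_0_iff)
  have R_inv: "R (minv (mpow S i))" for i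
  proof -
    \<comment> \<open>Some power of \<open>S\<close> is scalar, so up to a scalar the inverse of
      \<open>mpow S i\<close> is a positive power; this reduces inverses to products.\<close>
    have "i + (card \<Omega> - 1) * i = card \<Omega> * i" using pos by (cases "card \<Omega>") auto
    then have "mpow S i ** mpow S ((card \<Omega> - 1) * i) = mpow S (card \<Omega> * i)" by (metis mpow_add)
    moreover have "scalar (mpow S (card \<Omega> * i))" using scalar_power_iff by simp
    ultimately obtain d where d: "mpow S i ** mpow S ((card \<Omega> - 1) * i) = mat d" by (auto simp: scalar_def)
    from arg_cong[OF this, of det] have "d \<noteq> 0" using det_S by auto
    then have "mpow S i ** (mat (1/d) ** mpow S ((card \<Omega> - 1) * i)) = mat 1"
      unfolding mat_left_move[of "mpow S i"] d by simp
    then have "minv (mpow S i) = mat (1/d) ** mpow S ((card \<Omega> - 1) * i)" by (rule minv_unique)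
    then show ?thesis using R_mult R_mat R_pow by metis
  qed
  have R_\<Omega>: "R B" if B: "psl B \<in> \<Omega>" for B
  proof -
    obtain i where i: "psl B = psl (act (mpow S i) A)" using B unfolding \<Omega>_eq conj_orbit_eq[OF det_S] by blast
    have R_act: "R (act (mpow S i) A)" unfolding act_def by (intro R_mult R_pow R_inv RA)
    have "B = act (mpow S i) A \<or> B = - act (mpow S i) A" using i by (simp only: psl_eq_iff)
    then show ?thesis
    proof
      assume "B = act (mpow S i) A" then show ?thesis using R_act by (simp only:)
    next
      assume "B = - act (mpow S i) A" then show ?thesis using R_minus[OF R_act] by (simp only:)
    qed
  qed
  have R_psl: "R B \<longleftrightarrow> R C" if "psl B = psl C" for B C
  proof -
    have "B = C \<or> B = - C" using that by (simp only: psl_eq_iff)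
    then show ?thesis
    proof
      assume eq: "B = - C"
      have "R (- (- C))" if "R (- C)" using R_minus[OF that] .
      then show ?thesis unfolding eq using R_minus[of C] by (simp only: minus_minus) blast
    qed (simp only:)
  qed
  have all: "\<forall>B. det B = 1 \<longrightarrow> h = psl B \<longrightarrow> R B" if "h \<in> carrier PSL2" for h
    using that
  proof (induction rule: generator_induct)
    case one
    show ?case
    proof (intro allI impI)
      fix B :: "'a^2^2" assume "\<one>\<^bsub>PSL2\<^esub> = psl B"
      then have "psl B = psl (mat 1)" unfolding one_PSL2 by (rule sym)
      then show "R B" using R_psl[of B "mat 1"] R_mat[of 1] by blast
    qed
  next
    case (step h \<omega>)
    obtain C where C: "det C = 1" "h = psl C" using carrier_representative[OF step(1)] by blast
    obtain D where D: "det D = 1" "\<omega> = psl D" using generator_representative[OF step(2)] by blast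
    have "R (C ** D)" using step C D R_\<Omega> by (intro R_mult) auto
    moreover have "h \<otimes>\<^bsub>PSL2\<^esub> \<omega> = psl (C ** D)" using C D by simp
    ultimately show ?case
      using R_psl[of _ "C ** D"] by (intro allI impI) (metis (no_types))
  qed
  obtain v where v: "v \<in> F" using F(2) by blast
  show False
  proof (rule no_small_stable_set[OF F(1,3) v])
    show "tr v = 0" "v \<noteq> 0" using FV[OF v] by simp_all
    fix g u :: "'a^2^2" assume g: "det g = 1" "u \<in> F"
    then have "R g" using all[of "psl g"] by simp
    then show "\<exists>v'\<in>F. \<exists>l. g ** u = mat l ** v' ** g" using g by (simp add: R_def)
  qed
qed

text \<open>An isomorphism is conjugation by a matrix \<open>P\<close> that matches the rotations,
  but it may send the class of \<open>A\<close> to the conjugate of \<open>A'\<close> by some power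
  of \<open>S'\<close>. Correcting \<open>P\<close> by the inverse of that power, which commutes
  with \<open>S'\<close>, matches the involutions too. Conversely, conjugation by \<open>T\<close>
  carries over both the map and its validity.\<close>

lemma iso_CM_iff:
  assumes S': "det S' \<noteq> 0" and A': "det A' = 1" "tr A' = 0"
  shows "CM_valid (pgl S') (psl A') \<and> cayley_map PSL2 \<Omega> \<rho> \<cong>\<^sub>M CM (pgl S') (psl A') \<longleftrightarrow>
    (\<exists>T c. det T \<noteq> 0 \<and> c \<noteq> 0 \<and> T ** S = mat c ** S' ** T \<and> psl (T ** A) = psl (A' ** T))"
    (is "?L \<longleftrightarrow> ?R")
proof
  assume L: ?L
  define \<Omega>' where "\<Omega>' = conj_orbit (pgl S') (psl A')"
  have \<Omega>': "\<Omega>' = {psl (act (mpow S' i) A') | i. i \<ge> 1}" unfolding \<Omega>'_def by (rule conj_orbit_eq[OF S'])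
  have valid: "cayley_map_data PSL2 \<Omega>' (conj_act (pgl S'))" using L by (simp add: CM_valid_def \<Omega>'_def)
  have "type_II PSL2 \<Omega>'"
    unfolding type_II_def
  proof
    fix \<omega> assume "\<omega> \<in> \<Omega>'"
    then obtain i where i: "\<omega> = psl (act (mpow S' i) A')" unfolding \<Omega>' by blast
    have d: "det (mpow S' i) \<noteq> 0" using S' by simp
    have "\<omega> \<otimes>\<^bsub>PSL2\<^esub> \<omega> = psl (act (mpow S' i) (A' ** A'))" unfolding i by (simp add: act_mult[OF d])
    also have "\<dots> = \<one>\<^bsub>PSL2\<^esub>" unfolding square_traceless[OF A'] one_PSL2 using d by (simp add: act_def)
    finally show "\<omega> \<noteq> \<one>\<^bsub>PSL2\<^esub> \<and> \<omega> \<otimes>\<^bsub>PSL2\<^esub> \<omega> = \<one>\<^bsub>PSL2\<^esub>"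
      using \<open>\<omega> \<in> \<Omega>'\<close> valid by (auto simp: cayley_map_data_def)
  qed
  then have N: "involutory_cayley_map PSL2 \<Omega>' (conj_act (pgl S'))"
    using valid by (intro involutory_cayley_map.intro involutory_cayley_map_axioms.intro is_group)
  have "cayley_map PSL2 \<Omega> \<rho> \<cong>\<^sub>M cayley_map PSL2 \<Omega>' (conj_act (pgl S'))"
    using L by (simp add: CM_def \<Omega>'_def)
  then obtain f where f: "f \<in> iso PSL2 PSL2" "f ` \<Omega> = \<Omega>'"
    "\<And>\<omega>. \<omega> \<in> \<Omega> \<Longrightarrow> f (\<rho> \<omega>) = conj_act (pgl S') (f \<omega>)"
    using map_iso_imp_group_iso[OF N] by blast
  obtain P where P: "det P \<noteq> 0" "\<And>A. det A = 1 \<Longrightarrow> f (psl A) = psl (act P A)"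
    using PSL2_automorphism[OF f(1)] by blast
  have "f (psl A) \<in> \<Omega>'" using f(2) base_in by blast
  then obtain i where i: "psl (act P A) = psl (act (mpow S' i) A')" unfolding \<Omega>' P(2)[OF det_A] by blast
  \<comment> \<open>\<open>P ** S\<close> and \<open>S' ** P\<close> act alike on \<Omega>, so their
    quotient fixes all generators and is scalar.\<close>
  define T where "T = minv (P ** S) ** (S' ** P)"
  have "scalar T"
  proof (rule conj_fixing_scalar)
    fix \<omega> assume \<omega>: "\<omega> \<in> \<Omega>"
    obtain B where B: "det B = 1" "\<omega> = psl B" using generator_representative[OF \<omega>] by blast
    have "psl (act (P ** S) B) = psl (act (S' ** P) B)"
      using f(3)[OF \<omega>] \<rho>_eq[OF \<omega>] B P det_S S' by (simp add: conj_act_psl act_act)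
    then have "psl (act (minv (P ** S)) (act (P ** S) B)) = psl (act (minv (P ** S)) (act (S' ** P) B))"
      by (rule psl_act_cong)
    then have "psl B = psl (act T B)" using P det_S S' by (simp add: T_def act_act act_one)
    moreover have "det T \<noteq> 0" using P det_S S' by (simp add: T_def)
    ultimately show "conj_act (pgl T) \<omega> = \<omega>" unfolding B(2) by (metis conj_act_psl)
  qed (use P det_S S' in \<open>simp add: T_def\<close>)
  then obtain d where d: "T = mat d" by (auto simp: scalar_def)
  have "d \<noteq> 0"
  proof
    assume "d = 0"
    have "det T = d\<^sup>2" unfolding d by (rule det_scal)
    then have "det T = 0" using \<open>d = 0\<close> by simp
    then show False using P det_S S' by (simp add: T_def)
  qed
  have "P ** S ** T = S' ** P" unfolding T_def using P det_S by simp
  then have "mat d ** (P ** S) = S' ** P" unfolding d by (simp add: mat_times_comm[of "P ** S"])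
  then have "mat (1/d) ** (mat d ** (P ** S)) = mat (1/d) ** (S' ** P)" by simp
  then have PS: "P ** S = mat (1/d) ** (S' ** P)" using \<open>d \<noteq> 0\<close> by simp
  define U where "U = minv (mpow S' i)"
  have di: "det (mpow S' i) \<noteq> 0" using S' by simp
  have US: "U ** S' = S' ** U"
  proof -
    have "mpow S' i ** (U ** S') = S'" unfolding U_def using di by simp
    moreover have "mpow S' i ** (S' ** U) = S'"
    proof -
      have "mpow S' i ** (S' ** U) = (mpow S' i ** S') ** U" by (simp add: matrix_mul_assoc)
      also have "mpow S' i ** S' = S' ** mpow S' i" by (metis mpow.simps(2) mpow_Suc2)
      finally show ?thesis unfolding U_def using di by simp
    qed
    ultimately show ?thesis using cancel_left[OF di] by metis
  qed
  have dU: "det U \<noteq> 0" unfolding U_def using di by simp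
  show ?R
  proof (intro exI conjI)
    show "det (U ** P) \<noteq> 0" using dU P by simp
    show "1 / d \<noteq> 0" using \<open>d \<noteq> 0\<close> by simp
    have "U ** P ** S = U ** (mat (1/d) ** (S' ** P))" unfolding PS[symmetric] by (simp add: matrix_mul_assoc)
    also have "\<dots> = mat (1/d) ** (U ** S' ** P)" unfolding mat_left_move[of U] by (simp add: matrix_mul_assoc)
    also have "\<dots> = mat (1/d) ** S' ** (U ** P)" unfolding US by (simp add: matrix_mul_assoc)
    finally show "U ** P ** S = mat (1/d) ** S' ** (U ** P)" .
    have "psl (act U (act P A)) = psl A'" using psl_act_cong[OF i, of U] di by (simp add: U_def)
    then have "psl (act (U ** P) A ** (U ** P)) = psl (A' ** (U ** P))"
      using dU P by (intro psl_mult_cong) (simp_all add: act_act)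
    then show "psl (U ** P ** A) = psl (A' ** (U ** P))" using dU P unfolding act_def by simp
  qed
next
  assume ?R
  then obtain T c where T: "det T \<noteq> 0" "c \<noteq> 0" "T ** S = mat c ** S' ** T" "psl (T ** A) = psl (A' ** T)"
    by blast
  define f where "f = conj_act (pgl T)"
  have f: "f \<in> iso PSL2 PSL2" unfolding f_def by (rule conj_act_iso[OF T(1)])
  have TA: "psl (act T A) = psl A'"
    using psl_mult_cong[OF T(4) refl, of "minv T"] T(1) by (simp add: act_def)
  have TS: "act T (act (mpow S i) B) = act (mpow S' i) (act T B)" for i B
  proof -
    have "T ** mpow S i = mat (c ^ i) ** (mpow S' i ** T)"
      using mpow_conj_scal[OF T(3)] by (simp add: matrix_mul_assoc)
    then have "act (T ** mpow S i) B = act (mpow S' i ** T) B" using T S' by simp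
    then show ?thesis using T S' det_S by (simp add: act_act)
  qed
  have f\<Omega>: "f ` \<Omega> = conj_orbit (pgl S') (psl A')"
  proof -
    have fi: "f (psl (act (mpow S i) A)) = psl (act (mpow S' i) A')" for i
      unfolding f_def conj_act_psl[OF T(1)] TS by (rule psl_act_cong[OF TA])
    have "f ` \<Omega> = {f (psl (act (mpow S i) A)) | i. i \<ge> 1}"
      unfolding \<Omega>_eq conj_orbit_eq[OF det_S] by blast
    then show ?thesis unfolding fi conj_orbit_eq[OF S'] .
  qed
  have fr: "conj_act (pgl S') (f \<omega>) = f (\<rho> \<omega>)" if \<omega>: "\<omega> \<in> \<Omega>" for \<omega>
  proof -
    obtain B where B: "det B = 1" "\<omega> = psl B" using generator_representative[OF \<omega>] by blast
    show ?thesis using TS[of 1 B] \<rho>_eq[OF \<omega>] B T S' det_S by (simp add: f_def conj_act_psl)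
  qed
  note * = group_iso_imp_map_iso[OF f fr, unfolded f\<Omega>]
  show ?L using * by (simp add: CM_valid_def CM_def)
qed

end

section \<open>Groups generated by three involutions\<close>

lemma tr_add: "tr (A + B) = tr A + tr (B::'a::field^2^2)"
  and tr_diff: "tr (A - B) = tr A - tr (B::'a::field^2^2)"
  and tr_uminus: "tr (- A) = - tr (A::'a::field^2^2)"
  and tr_zero: "tr (0::'a^2^2) = 0"
  by (simp_all add: tr_def)

lemma tr_scal: "tr (mat c ** A) = c * tr (A::'a::field^2^2)"
  by (cases A rule: mat2_cases) (simp add: mat2_simps algebra_simps)

lemma tr_mat: "tr (mat c :: 'a::field^2^2) = 2 * c"
  by (simp add: mat2_simps)

lemma mat_ring:
  fixes A B C :: "'a::field^2^2"
  shows "A ** (B + C) = A ** B + A ** C" "(A + B) ** C = A ** C + B ** C"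
    "A ** (B - C) = A ** B - A ** C" "(A - B) ** C = A ** C - B ** C"
    "A ** 0 = 0" "0 ** A = 0"
  by (simp_all add: vec_eq_iff matrix_matrix_mult_def algebra_simps sum.distrib sum_subtractf)

lemma mat_zero: "(mat 0 :: 'a::field^2^2) = 0" "mat 0 ** A = (0::'a::field^2^2)"
  by (simp_all add: mat_mat2 mat2_arith) (cases A rule: mat2_cases, simp add: mat2_simps)

text \<open>The polarised Cayley-Hamilton identity for traceless matrices; in particular orthogonal
  ones anticommute.\<close>

lemma anticommutator:
  fixes A B :: "'a::field^2^2"
  assumes "tr A = 0" "tr B = 0"
  shows "A ** B + B ** A = mat (tr (A ** B))"
proof -
  obtain a b c where A: "A = mat2 a b c (- a)" using traceless_cases[OF assms(1)] .
  obtain a' b' c' where B: "B = mat2 a' b' c' (- a')" using traceless_cases[OF assms(2)] .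
  show ?thesis by (simp add: A B mat2_simps algebra_simps)
qed

text \<open>Conjugation by the involution of an \<open>A\<close> with \<open>A\<^sup>2 = -1\<close> is the half-turn
  \<open>v \<mapsto> -v - tr(vA)A\<close> of the quadratic space of traceless matrices.\<close>

lemma half_turn:
  fixes A v v' :: "'a::field^2^2"
  assumes "tr v = 0" "tr A = 0" "det A = 1" and "- v - mat (tr (v ** A)) ** A = mat l ** v'"
  shows "A ** v = mat l ** v' ** A"
proof -
  have "mat l ** v' ** A = - (v ** A) - mat (tr (v ** A)) ** (A ** A)"
    unfolding assms(4)[symmetric] by (simp add: mat_ring matrix_mul_assoc)
  also have "\<dots> = - (v ** A) + mat (tr (v ** A))"
    unfolding square_traceless[OF assms(3,2)] by simp
  also have "\<dots> = A ** v" unfolding anticommutator[OF assms(1,2), symmetric] by simp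
  finally show ?thesis ..
qed

lemma tr_act: "det S \<noteq> 0 \<Longrightarrow> tr (act S A) = tr A"
  using tr_conj[of S A "act S A"] act_eq_iff by metis

lemma act_intertwine: "det S \<noteq> 0 \<Longrightarrow> S ** A = act S A ** S"
  using act_eq_iff by metis

lemma tr_act_mult: "det S \<noteq> 0 \<Longrightarrow> tr (act S A ** act S B) = tr (A ** B)"
  by (simp add: tr_act flip: act_mult)

lemma act_zero_iff: "det S \<noteq> 0 \<Longrightarrow> act S A = 0 \<longleftrightarrow> A = 0"
  using act_cancel[of S A 0] by (simp add: act_def mat_ring)

text \<open>Rodrigues' formula in matrix form. \<open>mat x - mat y ** J\<close> is the adjugate of
  the torus element, so the left side is conjugation scaled by the determinant; the anticommutator
  yields J A J = 2a J - \<delta> A.\<close>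

lemma rotation_formula:
  fixes A J :: "'a::field^2^2"
  assumes "tr A = 0" "tr J = 0" "J ** J = mat \<delta>" "tr (J ** A) = 2 * a"
  shows "(mat x + mat y ** J) ** A ** (mat x - mat y ** J) =
    mat (x\<^sup>2 + \<delta> * y\<^sup>2) ** A + mat (x * y) ** (J ** A - A ** J) - mat (2 * a * y\<^sup>2) ** J"
proof -
  have JA: "J ** A = mat (2 * a) - A ** J"
    using anticommutator[OF assms(2,1)] assms(4) by (simp add: algebra_simps)
  then have "J ** A ** J = mat (2 * a) ** J - A ** (J ** J)"
    by (simp add: mat_ring matrix_mul_assoc)
  then have JAJ: "J ** A ** J = mat (2 * a) ** J - mat \<delta> ** A"
    unfolding assms(3) by (simp add: mat_times_comm)
  have "(mat x + mat y ** J) ** A ** (mat x - mat y ** J) =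
    mat (x * x) ** A - mat (x * y) ** (A ** J) + mat (x * y) ** (J ** A) - mat (y * y) ** (J ** A ** J)"
    by (cases A rule: mat2_cases, cases J rule: mat2_cases) (simp add: mat2_simps algebra_simps)
  also have "\<dots> = mat (x\<^sup>2 + \<delta> * y\<^sup>2) ** A + mat (x * y) ** (J ** A - A ** J) - mat (2 * a * y\<^sup>2) ** J"
    unfolding JAJ
    by (cases A rule: mat2_cases, cases J rule: mat2_cases) (simp add: mat2_simps algebra_simps power2_eq_square)
  finally show ?thesis .
qed

lemma torus_form_mult:
  fixes J :: "'a::field^2^2"
  assumes "J ** J = mat \<delta>"
  shows "(mat x + mat y ** J) ** (mat x' + mat y' ** J) =
    mat (x * x' + \<delta> * y * y') + mat (x * y' + y * x') ** J"
proof -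
  have "(mat x + mat y ** J) ** (mat x' + mat y' ** J) =
    mat (x * x') + mat (x * y' + y * x') ** J + mat (y * y') ** (J ** J)"
    by (cases J rule: mat2_cases) (simp add: mat2_simps algebra_simps)
  then show ?thesis unfolding assms by (simp add: mat2_simps algebra_simps)
qed

lemma mpow_torus_form:
  fixes J :: "'a::field^2^2"
  assumes "J ** J = mat \<delta>"
  obtains x y where "mpow (mat r + mat q ** J) k = mat x + mat y ** J"
proof -
  have "\<exists>x y. mpow (mat r + mat q ** J) k = mat x + mat y ** J"
  proof (induction k)
    case 0
    show ?case by (rule exI[of _ 1], rule exI[of _ 0]) (simp add: mat_zero)
  next
    case (Suc k)
    then show ?case using torus_form_mult[OF assms] by (metis mpow.simps(2))
  qed
  then show thesis using that by blast
qed

section \<open>Small valencies and small configurations of axes\<close>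

context matrix_map
begin

lemma gt6: "CARD('a) > 6"
  using gt5 prime_card_even[OF prime gt5] by (cases "CARD('a) = 6") auto

text \<open>By \<open>iso_CM_iff\<close> this is isomorphism with a valid
  \<open>CM (pgl S') (psl A')\<close> when S' is invertible and A' is traceless of determinant
  1.\<close>

definition conj_to :: "'a^2^2 \<Rightarrow> 'a^2^2 \<Rightarrow> bool" where
  "conj_to S' A' \<longleftrightarrow>
    (\<exists>T c. det T \<noteq> 0 \<and> c \<noteq> 0 \<and> T ** S = mat c ** S' ** T \<and> psl (T ** A) = psl (A' ** T))"

lemma conj_to_scalar_power: "conj_to S' A' \<Longrightarrow> scalar (mpow S' k) \<longleftrightarrow> card \<Omega> dvd k"
proof -
  assume "conj_to S' A'"
  then obtain T c where T: "det T \<noteq> 0" "c \<noteq> 0" "T ** S = mat c ** S' ** T" by (auto simp: conj_to_def)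
  have "scalar (mpow S k) \<longleftrightarrow> scalar (mpow S' k)"
    using scalar_conj[OF mpow_conj_scal[OF T(3)] T(1)] T(2) by simp
  then show ?thesis using scalar_power_iff by simp
qed

text \<open>Carries the set back to \<open>S\<close> and \<open>A\<close> by conjugation with the
  inverse of the matrix that realises \<open>conj_to\<close>.\<close>

lemma conj_to_no_invariant_set:
  fixes F :: "('a^2^2) set"
  assumes conj: "conj_to S' A'" and F: "finite F" "F \<noteq> {}" "card F < CARD('a)"
    and FV: "\<And>v. v \<in> F \<Longrightarrow> tr v = 0 \<and> v \<noteq> 0"
    and FS: "\<And>v. v \<in> F \<Longrightarrow> \<exists>v'\<in>F. \<exists>l. S' ** v = mat l ** v' ** S'"
    and FA: "\<And>v. v \<in> F \<Longrightarrow> \<exists>v'\<in>F. \<exists>l. A' ** v = mat l ** v' ** A'"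
  shows False
proof -
  obtain T c where T: "det T \<noteq> 0" "c \<noteq> 0" "T ** S = mat c ** S' ** T" "psl (T ** A) = psl (A' ** T)"
    using conj by (auto simp: conj_to_def)
  define Q where "Q = minv T"
  have dQ: "det Q \<noteq> 0" using T by (simp add: Q_def)
  \<comment> \<open>The factor \<open>k\<close> covers both ambiguities, the scalar in the relation
    for \<open>S\<close> and the sign in that for \<open>A\<close>; it enters both sides
    alike.\<close>
  have transfer: "X ** act Q v = mat l ** act Q v' ** X"
    if X: "X = mat k ** (Q ** X' ** T)" and v: "X' ** v = mat l ** v' ** X'" for X X' v v' k l
  proof -
    have "X ** act Q v = mat k ** (Q ** (X' ** v) ** T)"
      unfolding X act_def Q_def using T(1) by (simp add: matrix_mul_assoc)
    also have "\<dots> = mat k ** (mat l ** (Q ** v' ** X' ** T))"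
      unfolding v by (simp add: mat_left_move[of Q] flip: matrix_mul_assoc)
    also have "\<dots> = mat l ** (mat k ** (Q ** v' ** X' ** T))" by (simp add: mult.commute)
    also have "Q ** v' ** X' ** T = act Q v' ** (Q ** X' ** T)"
      unfolding act_def Q_def using T(1) by (simp add: matrix_mul_assoc)
    also have "mat k ** \<dots> = act Q v' ** X" unfolding X by (rule mat_left_move[symmetric])
    finally show ?thesis by (simp add: matrix_mul_assoc)
  qed
  have XS: "S = mat c ** (Q ** S' ** T)"
  proof -
    have "S = Q ** (T ** S)" unfolding Q_def using T(1) by simp
    also have "\<dots> = mat c ** (Q ** S' ** T)"
      unfolding T(3) by (simp add: mat_left_move[of Q] flip: matrix_mul_assoc)
    finally show ?thesis .
  qed
  have "\<exists>k. A = mat k ** (Q ** A' ** T)"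
  proof -
    have "A = Q ** (T ** A)" unfolding Q_def using T(1) by simp
    moreover have "T ** A = A' ** T \<or> T ** A = mat (- 1) ** (A' ** T)"
      using T(4) by (simp add: psl_eq_iff mat_uminus)
    ultimately have "A = Q ** (A' ** T) \<or> A = Q ** (mat (- 1) ** (A' ** T))" by metis
    then have "A = mat 1 ** (Q ** A' ** T) \<or> A = mat (- 1) ** (Q ** A' ** T)"
      unfolding mat_left_move[of Q] by (simp add: matrix_mul_assoc)
    then show ?thesis by blast
  qed
  then obtain k where XA: "A = mat k ** (Q ** A' ** T)" by blast
  show False
  proof (rule no_invariant_set[of "act Q ` F"])
    show "card (act Q ` F) < CARD('a)" using F card_image_le[OF F(1), of "act Q"] by linarith
    fix v assume "v \<in> act Q ` F"
    then obtain u where u: "u \<in> F" "v = act Q u" by blast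
    show "tr v = 0 \<and> v \<noteq> 0" using FV[OF u(1)] dQ by (simp add: u tr_act act_zero_iff)
    show "\<exists>v'\<in>act Q ` F. \<exists>l. S ** v = mat l ** v' ** S"
      using FS[OF u(1)] transfer[OF XS] unfolding u(2) by blast
    show "\<exists>v'\<in>act Q ` F. \<exists>l. A ** v = mat l ** v' ** A"
      using FA[OF u(1)] transfer[OF XA] unfolding u(2) by blast
  qed (use F in auto)
qed

text \<open>Otherwise both S^2 and A^2 are scalar, and the commutator v = AS - SA satisfies Sv = -vS
  and Av = -vA, so its line is invariant. If v = 0, the line of \<open>A\<close> is
  invariant.\<close>

lemma card_gt_2: "card \<Omega> > 2"
proof (rule ccontr)
  assume "\<not> card \<Omega> > 2"
  moreover have "card \<Omega> > 0" using base_in finite_cyclic_on[OF cyc] by (auto simp: card_gt_0_iff)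
  ultimately have "card \<Omega> = 1 \<or> card \<Omega> = 2" by linarith
  then have "card \<Omega> dvd 2" by auto
  then have "scalar (mpow S 2)" using scalar_power_iff by blast
  then obtain c where SS: "S ** S = mat c" by (auto simp: scalar_def numeral_2_eq_2)
  have AA: "A ** A = mat (- 1)" using square_traceless[OF det_A tr_A] by (simp add: mat2_simps)
  have A0: "A \<noteq> 0" using det_A by (auto simp: det_2)
  define v where "v = A ** S - S ** A"
  show False
  proof (cases "v = 0")
    case True
    then have "S ** A = mat 1 ** A ** S" by (simp add: v_def)
    then show False
      by (intro no_invariant_set[of "{A}"]) (use gt5 tr_A A0 in \<open>auto intro: exI[of _ 1]\<close>)
  next
    case False
    have Sv: "S ** v = S ** A ** S - mat c ** A" and vS: "v ** S = A ** mat c - S ** A ** S"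
      by (simp_all add: v_def mat_ring matrix_mul_assoc SS) (simp add: SS flip: matrix_mul_assoc)
    have S: "S ** v = mat (- 1) ** v ** S"
      unfolding Sv mat_uminus mul_uminus vS by (simp add: mat_times_comm)
    have Av: "A ** v = mat (- 1) ** S - A ** S ** A" and vA: "v ** A = A ** S ** A - S ** mat (- 1)"
      by (simp_all add: v_def mat_ring matrix_mul_assoc AA) (simp add: AA flip: matrix_mul_assoc)
    have A: "A ** v = mat (- 1) ** v ** A"
      unfolding Av mat_uminus mul_uminus vA by (simp add: mat_times_comm mat_uminus)
    have "tr v = 0" by (simp add: v_def tr_diff tr_commute[of A S])
    then show False
      by (intro no_invariant_set[of "{v}"]) (use gt5 False S A in auto)
  qed
qed

text \<open>For pairwise traces \<open>t = 0, -1\<close> or \<open>t\<^sup>2 + t = 1\<close> the three involutions generate a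
  Klein four-group, an octahedral or an icosahedral group.  The lines below are, respectively, the axes
  of the three involutions, the three fourfold axes, and the six fivefold axes.\<close>

lemma three_involutions:
  assumes conj: "conj_to S' W0" and t: "t = 0 \<or> t = - 1 \<or> t\<^sup>2 + t = 1"
    and W: "tr W0 = 0" "tr W1 = 0" "tr W2 = 0" "det W0 = 1" "det W1 = 1" "det W2 = 1"
    and S': "S' ** W0 = W1 ** S'" "S' ** W1 = W2 ** S'" "S' ** W2 = W0 ** S'"
    and tW: "tr (W0 ** W1) = t" "tr (W1 ** W2) = t" "tr (W2 ** W0) = t"
  shows False
proof -
  have tW': "tr (W1 ** W0) = t" "tr (W2 ** W1) = t" "tr (W0 ** W2) = t"
    using tW by (simp_all add: tr_commute)
  have m1: "tr (- mat 1 :: 'a^2^2) = - 2" by (simp add: mat2_simps)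
  have tWW: "tr (W0 ** W0) = - 2" "tr (W1 ** W1) = - 2" "tr (W2 ** W2) = - 2"
    unfolding square_traceless[OF W(4,1)] square_traceless[OF W(5,2)] square_traceless[OF W(6,3)]
    by (rule m1)+
  have W_nz: "W0 \<noteq> 0" "W1 \<noteq> 0" "W2 \<noteq> 0" using W by (auto simp: det_2)
  note trs = tr_add tr_diff tr_scal tr_uminus mat_ring tW tW' tWW W tr_commute
  \<comment> \<open>\<open>S'\<close> permutes these cyclically, and the half-turn of
    \<open>W0\<close> exchanges the lines of \<open>u1\<close> and \<open>u2\<close> for every t.
    Its effect on \<open>u0\<close> depends on t: the trace 2t + 2 vanishes for t = -1.\<close>
  define u0 u1 u2 where "u0 = W1 + W2 - W0" and "u1 = W2 + W0 - W1" and "u2 = W0 + W1 - W2"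
  have S_u: "S' ** u0 = mat 1 ** u1 ** S'" "S' ** u1 = mat 1 ** u2 ** S'" "S' ** u2 = mat 1 ** u0 ** S'"
    by (simp_all add: u0_def u1_def u2_def mat_ring S')
  have tr_u: "tr u0 = 0" "tr u1 = 0" "tr u2 = 0"
    by (simp_all add: u0_def u1_def u2_def tr_add tr_diff W)
  have tr_uW: "tr (u0 ** W0) = 2 * t + 2" "tr (u1 ** W0) = - 2" "tr (u2 ** W0) = - 2" "tr (u0 ** W1) = - 2"
    by (simp_all add: u0_def u1_def u2_def tr_add tr_diff mat_ring tW tW' tWW)
  have u_nz: "u0 \<noteq> 0" "u1 \<noteq> 0" "u2 \<noteq> 0"
    using tr_uW two_nonzero by (auto simp: mat_ring tr_zero)
  have A_u: "W0 ** u1 = mat 1 ** u2 ** W0" "W0 ** u2 = mat 1 ** u1 ** W0"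
  proof (rule half_turn)
    show "- u1 - mat (tr (u1 ** W0)) ** W0 = mat 1 ** u2"
      unfolding tr_uW unfolding u1_def u2_def by
        (cases W0 rule: mat2_cases, cases W1 rule: mat2_cases, cases W2 rule: mat2_cases, simp add: mat2_simps)
  next
    show "W0 ** u2 = mat 1 ** u1 ** W0"
    proof (rule half_turn)
      show "- u2 - mat (tr (u2 ** W0)) ** W0 = mat 1 ** u1"
        unfolding tr_uW unfolding u1_def u2_def by
          (cases W0 rule: mat2_cases, cases W1 rule: mat2_cases, cases W2 rule: mat2_cases, simp add: mat2_simps)
    qed (use W tr_u in auto)
  qed (use W tr_u in auto)
  from t consider "t = 0" | "t = - 1" | "t\<^sup>2 + t = 1" by blast
  then show False
  proof cases
    case 1
    have S_W: "S' ** W0 = mat 1 ** W1 ** S'" "S' ** W1 = mat 1 ** W2 ** S'" "S' ** W2 = mat 1 ** W0 ** S'"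
      by (simp_all add: S')
    have A_W: "W0 ** W0 = mat 1 ** W0 ** W0" "W0 ** W1 = mat (- 1) ** W1 ** W0" "W0 ** W2 = mat (- 1) ** W2 ** W0"
      using anticommutator[OF W(1,2)] anticommutator[OF W(1,3)] tW tW'
      by (simp_all add: 1 mat_zero mat_uminus add_eq_0_iff add_eq_0_iff2)
    have card_le: "card {W0, W1, W2} \<le> 3"
      using card_length[of "[W0, W1, W2]"] by simp
    show False
    proof (rule conj_to_no_invariant_set[OF conj, of "{W0, W1, W2}"])
      show "card {W0, W1, W2} < CARD('a)" using card_le gt6 by simp
      fix v assume v: "v \<in> {W0, W1, W2}"
      show "tr v = 0 \<and> v \<noteq> 0" using v W(1-3) W_nz by auto
      show "\<exists>v'\<in>{W0, W1, W2}. \<exists>l. S' ** v = mat l ** v' ** S'" using v S_W by blast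
      show "\<exists>v'\<in>{W0, W1, W2}. \<exists>l. W0 ** v = mat l ** v' ** W0" using v A_W by blast
    qed simp_all
  next
    case 2
    have A_u0: "W0 ** u0 = mat (- 1) ** u0 ** W0"
      by (rule half_turn) (use W tr_u in \<open>simp_all add: tr_uW 2 mat_zero mat_uminus\<close>)
    have card_le: "card {u0, u1, u2} \<le> 3"
      using card_length[of "[u0, u1, u2]"] by simp
    show False
    proof (rule conj_to_no_invariant_set[OF conj, of "{u0, u1, u2}"])
      show "card {u0, u1, u2} < CARD('a)" using card_le gt6 by simp
      fix v assume v: "v \<in> {u0, u1, u2}"
      show "tr v = 0 \<and> v \<noteq> 0" using v tr_u u_nz by auto
      show "\<exists>v'\<in>{u0, u1, u2}. \<exists>l. S' ** v = mat l ** v' ** S'" using v S_u by blast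
      show "\<exists>v'\<in>{u0, u1, u2}. \<exists>l. W0 ** v = mat l ** v' ** W0" using v A_u A_u0 by blast
    qed simp_all
  next
    case 3
    then have t1: "t * (t + 1) = 1" by (simp add: power2_eq_square algebra_simps)
    \<comment> \<open>The half-turn of \<open>W0\<close> sends \<open>u0\<close> to the line of W1 +
      W2 + (2t + 1) W0. Here it is scaled by t, with t(2t + 1) = 2 - t.\<close>
    define v0 v1 v2 where "v0 = mat t ** (W1 + W2) + mat (2 - t) ** W0"
      and "v1 = mat t ** (W2 + W0) + mat (2 - t) ** W1" and "v2 = mat t ** (W0 + W1) + mat (2 - t) ** W2"
    have S_v: "S' ** v0 = mat 1 ** v1 ** S'" "S' ** v1 = mat 1 ** v2 ** S'" "S' ** v2 = mat 1 ** v0 ** S'"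
      unfolding v0_def v1_def v2_def mat_ring mat_left_move[of S'] S' by (simp_all add: matrix_mul_assoc mat_ring)
    have tr_v: "tr v0 = 0" "tr v1 = 0" "tr v2 = 0"
      by (simp_all add: v0_def v1_def v2_def tr_add tr_scal W)
    have assoc: "tr (mat c ** X ** Y) = c * tr (X ** Y)" for c and X Y :: "'a^2^2"
      by (simp add: tr_scal flip: matrix_mul_assoc)
    have torus_elt: "t * t = 1 - t" using t1 by (simp add: algebra_simps)
    have tr_vW: "tr (v0 ** W0) = - 2" "tr (v1 ** W0) = 0" "tr (v2 ** W0) = 0"
      "tr (v1 ** W1) = - 2" "tr (v2 ** W2) = - 2"
      by (simp_all add: v0_def v1_def v2_def mat_ring tr_add assoc tW tW' tWW, simp_all add: algebra_simps torus_elt)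
    have v_nz: "v0 \<noteq> 0" "v1 \<noteq> 0" "v2 \<noteq> 0"
      using tr_vW two_nonzero by (auto simp: mat_ring tr_zero)
    \<comment> \<open>These two axes are orthogonal to \<open>W0\<close>, so the half-turn reverses
      them.\<close>
    have A_v: "W0 ** v1 = mat (- 1) ** v1 ** W0" "W0 ** v2 = mat (- 1) ** v2 ** W0"
      by (rule half_turn; use W tr_v in \<open>simp add: tr_vW mat_zero mat_uminus\<close>)+
    have A_v0: "W0 ** v0 = mat (- t) ** u0 ** W0"
    proof (rule half_turn)
      show "- v0 - mat (tr (v0 ** W0)) ** W0 = mat (- t) ** u0"
        unfolding tr_vW unfolding v0_def u0_def by
          (cases W0 rule: mat2_cases, cases W1 rule: mat2_cases, cases W2 rule: mat2_cases, simp add: mat2_simps algebra_simps)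
    qed (use W tr_v in auto)
    have A_u0: "W0 ** u0 = mat (- (t + 1)) ** v0 ** W0"
    proof (rule half_turn)
      have e1: "- (t + 1) * t = - (t * (t + 1))" and e2: "- (t + 1) * (2 - t) = - ((t + 1) * (2 - t))"
        by (simp_all add: algebra_simps)
      have c: "(t + 1) * (2 - t) = 2 * t + 1" using torus_elt by (simp add: algebra_simps)
      have "mat (- (t + 1)) ** v0 = mat (- (t * (t + 1))) ** (W1 + W2) + mat (- ((t + 1) * (2 - t))) ** W0"
        unfolding v0_def mat_ring mat_mat_times' e1 e2 ..
      also have "\<dots> = - u0 - mat (2 * t + 2) ** W0"
        unfolding t1 c u0_def
        by (cases W0 rule: mat2_cases, cases W1 rule: mat2_cases, cases W2 rule: mat2_cases) (simp add: mat2_simps algebra_simps)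
      finally show "- u0 - mat (tr (u0 ** W0)) ** W0 = mat (- (t + 1)) ** v0" unfolding tr_uW ..
    qed (use W tr_u in auto)
    have card_le: "card {u0, u1, u2, v0, v1, v2} \<le> 6"
      using card_length[of "[u0, u1, u2, v0, v1, v2]"] by simp
    show False
    proof (rule conj_to_no_invariant_set[OF conj, of "{u0, u1, u2, v0, v1, v2}"])
      show "card {u0, u1, u2, v0, v1, v2} < CARD('a)" using card_le gt6 by simp
      fix v assume v: "v \<in> {u0, u1, u2, v0, v1, v2}"
      show "tr v = 0 \<and> v \<noteq> 0" using v tr_u tr_v u_nz v_nz by auto
      show "\<exists>v'\<in>{u0, u1, u2, v0, v1, v2}. \<exists>l. S' ** v = mat l ** v' ** S'" using v S_u S_v by blast
      show "\<exists>v'\<in>{u0, u1, u2, v0, v1, v2}. \<exists>l. W0 ** v = mat l ** v' ** W0" using v A_u A_v A_v0 A_u0 by blast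
    qed simp_all
  qed
qed

end

section \<open>Rotations in a torus: excluded parameters\<close>

text \<open>Common interface of the split and the nonsplit torus. \<open>N\<close> is the order of
  \<open>T\<close> in PGL(2), and \<nu> normalises the torus and inverts it. \<open>nf_ex\<close>
  says that the centraliser of \<open>J\<close> is transitive on the matrices \<open>B\<close> with
  a given trace against \<open>J\<close>; the excluded case a^2 = -\<delta>, where the span of
  \<open>J\<close> and \<open>B\<close> is degenerate or one-dimensional, is left to
  \<open>degenerate\<close>. The sign \<kappa> absorbs the different conventions of the two normal
  forms.\<close>

locale torus_map = matrix_map +
  fixes J T \<nu> :: "'a^2^2" and \<delta> \<kappa> r q :: 'a and N :: nat and nf :: "'a \<Rightarrow> 'a^2^2"
  assumes tr_J: "tr J = 0" and JJ: "J ** J = mat \<delta>" and \<delta>: "\<delta> \<noteq> 0"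
    and T_form: "T = mat r + mat q ** J" and det_T: "det T \<noteq> 0"
    and T_order: "scalar (mpow T k) \<longleftrightarrow> N dvd k" and N_pos: "N > 0"
    and \<nu>: "det \<nu> \<noteq> 0" "\<nu> ** J = - (J ** \<nu>)"
    and \<kappa>: "\<kappa>\<^sup>2 = 1"
    and nf: "det (nf a) = 1" "tr (nf a) = 0" "tr (J ** nf a) = \<kappa> * (2 * a)"
    and nf_ex: "tr B = 0 \<Longrightarrow> det B = 1 \<Longrightarrow> tr (J ** B) = \<kappa> * (2 * a) \<Longrightarrow> a\<^sup>2 \<noteq> - \<delta> \<Longrightarrow>
      \<exists>P. det P \<noteq> 0 \<and> P ** J = J ** P \<and> P ** B = nf a ** P"
    and degenerate: "tr B = 0 \<Longrightarrow> det B = 1 \<Longrightarrow> tr (J ** B) = 2 * a \<Longrightarrow> a\<^sup>2 = - \<delta> \<Longrightarrow>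
      \<exists>V. tr V = 0 \<and> V \<noteq> 0 \<and> (\<exists>l. B ** V = mat l ** V ** B) \<and>
        (\<forall>X. det X \<noteq> 0 \<longrightarrow> X ** J = J ** X \<longrightarrow> (\<exists>l. X ** V = mat l ** V ** X))"
begin

lemma form_commute: "(mat x + mat y ** J) ** J = J ** (mat x + mat y ** J)"
  unfolding mat_ring mat_left_move by (simp add: mat_times_comm[of J] flip: matrix_mul_assoc)

lemma det_form: "det (mat x + mat y ** J) = x\<^sup>2 - \<delta> * y\<^sup>2"
proof -
  obtain a b c where J: "J = mat2 a b c (- a)" using traceless_cases[OF tr_J] .
  have "\<delta> = a * a + b * c" using JJ by (simp add: J mat2_simps)
  then show ?thesis by (simp add: J mat2_simps algebra_simps power2_eq_square)
qed

lemma form_mult_conj: "(mat x + mat y ** J) ** (mat x - mat y ** J) = mat (x\<^sup>2 - \<delta> * y\<^sup>2)"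
proof -
  have eq: "mat x - mat y ** J = mat x + mat (- y) ** J"
    by (cases J rule: mat2_cases) (simp add: mat2_simps)
  show ?thesis unfolding eq torus_form_mult[OF JJ]
    by (simp add: mat_zero(2) power2_eq_square ac_simps)
qed

lemma J_nonscalar: "\<not> scalar J"
proof
  assume "scalar J"
  then obtain c where c: "J = mat c" by (auto simp: scalar_def)
  then have "c = 0" using tr_J two_nonzero by (simp add: mat2_simps flip: mult_2)
  then show False using JJ \<delta> by (simp add: c mat2_simps)
qed

lemma scalar_form: "scalar (mat x + mat y ** J) \<longleftrightarrow> y = 0"
proof
  assume "scalar (mat x + mat y ** J)"
  then obtain c where "mat x + mat y ** J = mat c" by (auto simp: scalar_def)
  then have "mat y ** J = mat (c - x)"
    by (cases J rule: mat2_cases) (auto simp: mat2_simps algebra_simps)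
  then have "scalar (mat y ** J)" by simp
  then show "y = 0" using scalar_scal J_nonscalar by blast
next
  assume "y = 0"
  then show "scalar (mat x + mat y ** J)" by (simp add: mat_zero)
qed

lemma anticommute_orthogonal:
  assumes "tr B = 0" "tr (J ** B) = 0" shows "B ** J = mat (- 1) ** J ** B"
proof -
  have "B ** J + J ** B = 0" using anticommutator[OF assms(1) tr_J] assms(2) tr_commute[of B J] by (simp add: mat_zero)
  then show ?thesis by (simp add: mat_uminus eq_neg_iff_add_eq_0)
qed

section \<open>Conditions forced on the trace parameter\<close>

context
  fixes S' A' and x y a :: 'a
  assumes conj: "conj_to S' A'" and S'_form: "S' = mat x + mat y ** J" and det_S': "det S' \<noteq> 0"
    and A': "tr A' = 0" "det A' = 1" "tr (J ** A') = 2 * a"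
begin

lemma S'_nonscalar: "y \<noteq> 0"
proof
  assume "y = 0"
  then have "scalar (mpow S' 1)" using scalar_form[of x y] by (simp add: S'_form)
  then have "card \<Omega> dvd 1" using conj_to_scalar_power[OF conj, of 1] by blast
  then show False using card_gt_2 by simp
qed

text \<open>If the trace vanishes, A' anticommutes with \<open>J\<close> and so preserves its line,
  as \<open>S'\<close> does.\<close>

lemma exclude_zero: "a \<noteq> 0"
proof
  assume a: "a = 0"
  have "\<exists>l. S' ** J = mat l ** J ** S'" using form_commute by (intro exI[of _ 1]) (simp add: S'_form)
  moreover have "\<exists>l. A' ** J = mat l ** J ** A'" using anticommute_orthogonal A' a by auto
  moreover have "J \<noteq> 0" using J_nonscalar by (metis mat_zero(1) scalar_mat)
  ultimately show False
    using conj_to_no_invariant_set[OF conj, of "{J}"] gt6 tr_J by auto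
qed

text \<open>Up to sign, a^2 + \<delta> is the Gram determinant of \<open>J\<close> and A' for half
  the trace form. When it vanishes, \<open>degenerate\<close> supplies a common invariant
  line.\<close>

lemma exclude_degenerate: "a\<^sup>2 \<noteq> - \<delta>"
proof
  assume "a\<^sup>2 = - \<delta>"
  then obtain V where V: "tr V = 0" "V \<noteq> 0" "\<exists>l. A' ** V = mat l ** V ** A'"
    "\<And>X. det X \<noteq> 0 \<Longrightarrow> X ** J = J ** X \<Longrightarrow> \<exists>l. X ** V = mat l ** V ** X"
    using degenerate[OF A'] by blast
  have "\<exists>l. S' ** V = mat l ** V ** S'" using V(4) det_S' form_commute by (simp add: S'_form)
  then show False using conj_to_no_invariant_set[OF conj, of "{V}"] gt6 V by auto
qed

text \<open>Matrix lifts of the generators with coherent signs: the power of \<open>S'\<close> at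
  the valency is scalar, so the sequence is periodic with no change of sign.\<close>

definition W :: "nat \<Rightarrow> 'a^2^2" where "W j = act (mpow S' j) A'"

lemma W_simps: "W 0 = A'" "W (Suc j) = act S' (W j)"
  using det_S' by (simp_all add: W_def act_one act_act)

lemma W_traceless: "tr (W j) = 0" "det (W j) = 1"
  using det_S' A' by (simp_all add: W_def tr_act)

lemma act_scalar: "scalar X \<Longrightarrow> det X \<noteq> 0 \<Longrightarrow> act X B = B"
  by (auto simp: scalar_def act_eq_iff mat_times_comm)

lemma W_periodic: "W (j + card \<Omega>) = W j"
proof -
  have "scalar (mpow S' (card \<Omega>))" using conj_to_scalar_power[OF conj] by simp
  then have "act (mpow S' (card \<Omega>)) A' = A'" using det_S' by (intro act_scalar) auto
  then show ?thesis using det_S' by (simp add: W_def mpow_add flip: act_act)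
qed

lemma S'_W: "S' ** W j = W (Suc j) ** S'"
  unfolding W_simps by (rule act_intertwine[OF det_S'])

lemma power_form:
  obtains u v where "mpow S' j = mat u + mat v ** J" "u\<^sup>2 - \<delta> * v\<^sup>2 \<noteq> 0"
proof -
  obtain u v where uv: "mpow S' j = mat u + mat v ** J"
    using mpow_torus_form[OF JJ, of x y j] unfolding S'_form .
  have "det (mpow S' j) \<noteq> 0" using det_S' by simp
  then show thesis using that[OF uv] unfolding uv det_form by blast
qed

text \<open>Both identities are cleared of the determinant of \<open>X\<close>. The second is
  \<open>rotation_formula\<close>; the first is its trace against A', where the commutator of
  \<open>J\<close> and A' contributes nothing.\<close>

lemma tr_A'_rot:
  assumes "X = mat u + mat v ** J" "det X \<noteq> 0"
  shows "(u\<^sup>2 - \<delta> * v\<^sup>2) * tr (A' ** act X A') = - 2 * (u\<^sup>2 + \<delta> * v\<^sup>2) - 4 * a\<^sup>2 * v\<^sup>2"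
    and "mat (u\<^sup>2 - \<delta> * v\<^sup>2) ** act X A' = mat (u\<^sup>2 + \<delta> * v\<^sup>2) ** A' + mat (u * v) ** (J ** A' - A' ** J)
      - mat (2 * a * v\<^sup>2) ** J"
proof -
  define d where "d = u\<^sup>2 - \<delta> * v\<^sup>2"
  have "X ** (mat u - mat v ** J) = mat d" unfolding assms(1) d_def by (rule form_mult_conj)
  then have "mat d ** minv X = minv X ** (X ** (mat u - mat v ** J))" by (simp add: mat_times_comm)
  then have Xi: "mat d ** minv X = mat u - mat v ** J" using assms(2) by simp
  have "mat d ** act X A' = X ** A' ** (mat d ** minv X)"
    unfolding act_def mat_left_move[of "X ** A'"] ..
  then show *: "mat d ** act X A' = mat (u\<^sup>2 + \<delta> * v\<^sup>2) ** A' + mat (u * v) ** (J ** A' - A' ** J)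
      - mat (2 * a * v\<^sup>2) ** J"
    unfolding Xi unfolding assms(1) rotation_formula[OF A'(1) tr_J JJ A'(3)] .
  have "d * tr (A' ** act X A') = tr (A' ** (mat d ** act X A'))"
    unfolding mat_left_move[of A'] tr_scal ..
  also have "\<dots> = (u\<^sup>2 + \<delta> * v\<^sup>2) * tr (A' ** A') + u * v * tr (A' ** (J ** A') - A' ** (A' ** J)) - 2 * a * v\<^sup>2 * tr (A' ** J)"
    unfolding * by (simp add: mat_ring mat_left_move[of A'] tr_add tr_diff tr_scal algebra_simps)
  also have "tr (A' ** (J ** A') - A' ** (A' ** J)) = 0"
    using tr_commute[of A' "A' ** J"] by (simp add: tr_diff flip: matrix_mul_assoc)
  also have "tr (A' ** A') = - 2" unfolding square_traceless[OF A'(2,1)] by (simp add: mat2_simps)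
  also have "tr (A' ** J) = 2 * a" using A'(3) tr_commute by metis
  finally show "d * tr (A' ** act X A') = - 2 * (u\<^sup>2 + \<delta> * v\<^sup>2) - 4 * a\<^sup>2 * v\<^sup>2"
    by (simp add: power2_eq_square algebra_simps)
qed

text \<open>The J-part of the cube of \<open>S'\<close> vanishes, so 3x^2 = -\<delta> y^2. Then the
  trace t of the product of two consecutive lifts satisfies
  \<open>\<delta> * t = \<delta> + 3 * a\<^sup>2\<close>, and the three claims deny t = 0, t = -1
  and t^2 + t = 1, the cases of \<open>three_involutions\<close>.\<close>

lemma exclude_3:
  assumes n: "card \<Omega> = 3"
  shows "3 * a\<^sup>2 \<noteq> - \<delta>" "3 * a\<^sup>2 \<noteq> - 2 * \<delta>" "9 * a ^ 4 + 9 * a\<^sup>2 * \<delta> + \<delta>\<^sup>2 \<noteq> 0"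
proof -
  have "scalar (mpow S' 3)" using conj_to_scalar_power[OF conj, of 3] n by simp
  moreover have "mpow S' 3 = mat (x * (x * x + \<delta> * y * y) + \<delta> * y * (x * y + y * x)) +
      mat (x * (x * y + y * x) + y * (x * x + \<delta> * y * y)) ** J"
    by (simp add: numeral_3_eq_3 S'_form torus_form_mult[OF JJ])
  ultimately have "x * (x * y + y * x) + y * (x * x + \<delta> * y * y) = 0" by (simp add: scalar_form)
  moreover have "x * (x * y + y * x) + y * (x * x + \<delta> * y * y) = y * (3 * x\<^sup>2 + \<delta> * y\<^sup>2)"
    by (simp add: algebra_simps power2_eq_square)
  ultimately have xy: "3 * x\<^sup>2 = - (\<delta> * y\<^sup>2)" using S'_nonscalar by (simp add: add_eq_0_iff2)
  define t where "t = tr (W 0 ** W 1)"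
  have "(x\<^sup>2 - \<delta> * y\<^sup>2) * t = - 2 * (x\<^sup>2 + \<delta> * y\<^sup>2) - 4 * a\<^sup>2 * y\<^sup>2"
    using tr_A'_rot(1)[OF S'_form det_S'] by (simp add: t_def W_simps)
  then have "3 * ((x\<^sup>2 - \<delta> * y\<^sup>2) * t) = 3 * (- 2 * (x\<^sup>2 + \<delta> * y\<^sup>2) - 4 * a\<^sup>2 * y\<^sup>2)" by simp
  then have "(3 * x\<^sup>2 - 3 * (\<delta> * y\<^sup>2)) * t = - 2 * (3 * x\<^sup>2) - 6 * (\<delta> * y\<^sup>2) - 12 * a\<^sup>2 * y\<^sup>2"
    by (simp add: algebra_simps)
  then have "4 * y\<^sup>2 * (\<delta> * t) = 4 * y\<^sup>2 * (\<delta> + 3 * a\<^sup>2)" unfolding xy by (simp add: algebra_simps)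
  moreover have "4 * y\<^sup>2 \<noteq> 0" using S'_nonscalar small_numerals_nonzero[OF prime gt5] by simp
  ultimately have t: "\<delta> * t = \<delta> + 3 * a\<^sup>2" using mult_left_cancel by blast
  have no: "\<not> (t = 0 \<or> t = - 1 \<or> t\<^sup>2 + t = 1)"
  proof
    assume t': "t = 0 \<or> t = - 1 \<or> t\<^sup>2 + t = 1"
    have W3: "W 3 = W 0" using W_periodic[of 0] n by simp
    have W2: "W (Suc 1) = W 2" "W (Suc 2) = W 3" by (simp_all add: numeral_2_eq_2 numeral_3_eq_3)
    have tr_shift: "tr (W (Suc i) ** W (Suc j)) = tr (W i ** W j)" for i j
      unfolding W_simps by (rule tr_act_mult[OF det_S'])
    have t12: "tr (W 1 ** W 2) = t" using tr_shift[of 0 1] W2 by (simp add: t_def)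
    have t20: "tr (W 2 ** W 0) = t" using tr_shift[of 1 2] W2 t12 W3 by simp
    have conj': "conj_to S' (W 0)" using conj by (simp add: W_simps)
    show False
      using three_involutions[OF conj' t' W_traceless(1) W_traceless(1) W_traceless(1)
          W_traceless(2) W_traceless(2) W_traceless(2), of 1 2] S'_W[of 0] S'_W[of 1] S'_W[of 2] t12 t20 W2 W3
      by (simp add: t_def)
  qed
  show "3 * a\<^sup>2 \<noteq> - \<delta>"
  proof
    assume "3 * a\<^sup>2 = - \<delta>"
    then show False using t no \<delta> by simp
  qed
  show "3 * a\<^sup>2 \<noteq> - 2 * \<delta>"
  proof
    assume "3 * a\<^sup>2 = - 2 * \<delta>"
    then have "\<delta> * t = \<delta> * (- 1)" using t by simp
    then show False using no \<delta> mult_left_cancel by blast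
  qed
  show "9 * a ^ 4 + 9 * a\<^sup>2 * \<delta> + \<delta>\<^sup>2 \<noteq> 0"
  proof
    assume 0: "9 * a ^ 4 + 9 * a\<^sup>2 * \<delta> + \<delta>\<^sup>2 = 0"
    have "\<delta>\<^sup>2 * (t\<^sup>2 + t - 1) = (\<delta> * t)\<^sup>2 + \<delta> * (\<delta> * t) - \<delta>\<^sup>2"
      by (simp add: algebra_simps power2_eq_square)
    also have "\<dots> = 9 * a ^ 4 + 9 * a\<^sup>2 * \<delta> + \<delta>\<^sup>2" unfolding t
      by (simp add: algebra_simps power2_eq_square power4_eq_xxxx)
    finally show False using 0 \<delta> no by simp
  qed
qed

text \<open>\<open>S'\<close> fixes the line of \<open>J\<close> and permutes the five lines
  \<open>V j\<close> cyclically. The half-turn of A' exchanges \<open>J\<close> with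
  \<open>V 0\<close>, and the vanishing polynomial forces it to fix each remaining line
  \<open>V j\<close> or to send it to \<open>V (5 - j)\<close>.\<close>

lemma exclude_5:
  assumes n: "card \<Omega> = 5"
  shows "5 * a ^ 4 + 5 * a\<^sup>2 * \<delta> + \<delta>\<^sup>2 \<noteq> 0"
proof
  assume 0: "5 * a ^ 4 + 5 * a\<^sup>2 * \<delta> + \<delta>\<^sup>2 = 0"
  \<comment> \<open>The negative of the image of \<open>J\<close> under the half-turn of
    \<open>W j\<close>, whose trace against \<open>J\<close> is 2a.\<close>
  define V where "V j = J + mat (2 * a) ** W j" for j
  have V5: "V (j mod 5) = V j" for j
  proof -
    have "V (i + 5 * k) = V i" for i k
      by (induction k) (use W_periodic n in \<open>simp_all add: V_def add.assoc[symmetric]\<close>, metis W_periodic add.assoc add.commute n)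
    from this[of "j mod 5" "j div 5"] show ?thesis by simp
  qed
  have trWJ: "tr (W j ** J) = 2 * a" for j
  proof (induction j)
    case 0
    show ?case using A'(3) tr_commute by (metis W_simps(1))
  next
    case (Suc j)
    have "act S' J = J" unfolding act_eq_iff[OF det_S'] unfolding S'_form by (rule form_commute)
    then have "tr (W (Suc j) ** J) = tr (act S' (W j) ** act S' J)" by (simp add: W_simps)
    then show ?case using Suc by (simp add: tr_act_mult[OF det_S'])
  qed
  have V_tr: "tr (V j) = 0" for j by (simp add: V_def tr_add tr_scal tr_J W_traceless)
  have J0: "J \<noteq> 0" using J_nonscalar by (metis mat_zero(1) scalar_mat)
  have V_W: "W j ** J = mat (- 1) ** V j ** W j" for j
  proof (rule half_turn)
    show "- J - mat (tr (J ** W j)) ** W j = mat (- 1) ** V j"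
      unfolding mat_uminus V_def using trWJ[of j] tr_commute[of J "W j"] by simp
  qed (use tr_J W_traceless in auto)
  have V_nz: "V j \<noteq> 0" for j
  proof
    assume "V j = 0"
    then have "W j ** J = W j ** 0" using V_W[of j] by (simp add: mat_ring)
    then show False using J0 cancel_left[of "W j" J 0] W_traceless(2)[of j] by simp
  qed
  have S_V: "S' ** V j = mat 1 ** V (Suc j) ** S'" for j
    unfolding V_def mat_ring mat_left_move[of S'] S'_W using form_commute by (simp add: S'_form matrix_mul_assoc mat_ring)
  have A_V0: "A' ** V 0 = mat (- 1) ** J ** A'"
  proof (rule half_turn)
    have "tr (V 0 ** A') = 2 * a + 2 * a * (- 2)"
    proof -
      have "tr (A' ** A') = - 2" unfolding square_traceless[OF A'(2,1)] by (simp add: mat2_simps)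
      moreover have "V 0 ** A' = J ** A' + mat (2 * a) ** (A' ** A')"
        by (simp only: V_def W_simps mat_ring matrix_mul_assoc)
      ultimately show ?thesis by (simp only: tr_add tr_scal A'(3))
    qed
    then show "- V 0 - mat (tr (V 0 ** A')) ** A' = mat (- 1) ** J"
      unfolding V_def W_simps by (cases A' rule: mat2_cases, cases J rule: mat2_cases) (simp add: mat2_simps)
  qed (use V_tr A' in auto)
  have A_V: "\<exists>k l. A' ** V j = mat l ** V k ** A'" if j: "1 \<le> j" "j < 5" for j
  proof -
    obtain u v where uv: "mpow S' j = mat u + mat v ** J" "u\<^sup>2 - \<delta> * v\<^sup>2 \<noteq> 0" by (rule power_form)
    define d where "d = u\<^sup>2 - \<delta> * v\<^sup>2"
    have "\<not> scalar (mpow S' j)" using conj_to_scalar_power[OF conj, of j] n j by (auto dest: dvd_imp_le)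
    then have v: "v \<noteq> 0" by (simp add: uv scalar_form)
    have "scalar (mpow (mpow S' j) 5)"
      using conj_to_scalar_power[OF conj, of "j * 5"] n by (simp flip: mpow_mult)
    moreover have "mpow (mpow S' j) 5 = mat (u ^ 5 + 10 * u ^ 3 * v\<^sup>2 * \<delta> + 5 * u * v ^ 4 * \<delta>\<^sup>2) +
        mat (v * (5 * u ^ 4 + 10 * u\<^sup>2 * v\<^sup>2 * \<delta> + v ^ 4 * \<delta>\<^sup>2)) ** J"
    proof -
      define X where "X = mat u + mat v ** J"
      have X2: "X ** X = mat (u\<^sup>2 + \<delta> * v\<^sup>2) + mat (2 * u * v) ** J"
        by (simp add: X_def torus_form_mult[OF JJ] power2_eq_square algebra_simps)
      have X4: "X ** X ** (X ** X) = mat (u ^ 4 + 6 * \<delta> * u\<^sup>2 * v\<^sup>2 + \<delta>\<^sup>2 * v ^ 4) + mat (4 * u ^ 3 * v + 4 * \<delta> * u * v ^ 3) ** J"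
        unfolding X2 torus_form_mult[OF JJ]
        by (simp add: power2_eq_square power3_eq_cube power4_eq_xxxx algebra_simps)
      have "mpow X 5 = X ** (X ** X ** (X ** X))"
        by (simp add: eval_nat_numeral matrix_mul_assoc)
      also have "\<dots> = mat (u * (u ^ 4 + 6 * \<delta> * u\<^sup>2 * v\<^sup>2 + \<delta>\<^sup>2 * v ^ 4) + \<delta> * v * (4 * u ^ 3 * v + 4 * \<delta> * u * v ^ 3)) +
          mat (u * (4 * u ^ 3 * v + 4 * \<delta> * u * v ^ 3) + v * (u ^ 4 + 6 * \<delta> * u\<^sup>2 * v\<^sup>2 + \<delta>\<^sup>2 * v ^ 4)) ** J"
        unfolding X4 by (simp add: X_def torus_form_mult[OF JJ])
      also have "u * (u ^ 4 + 6 * \<delta> * u\<^sup>2 * v\<^sup>2 + \<delta>\<^sup>2 * v ^ 4) + \<delta> * v * (4 * u ^ 3 * v + 4 * \<delta> * u * v ^ 3) =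
          u ^ 5 + 10 * u ^ 3 * v\<^sup>2 * \<delta> + 5 * u * v ^ 4 * \<delta>\<^sup>2" by (simp add: algebra_simps power_numeral_reduce)
      also have "u * (4 * u ^ 3 * v + 4 * \<delta> * u * v ^ 3) + v * (u ^ 4 + 6 * \<delta> * u\<^sup>2 * v\<^sup>2 + \<delta>\<^sup>2 * v ^ 4) =
          v * (5 * u ^ 4 + 10 * u\<^sup>2 * v\<^sup>2 * \<delta> + v ^ 4 * \<delta>\<^sup>2)" by (simp add: algebra_simps power_numeral_reduce)
      finally show ?thesis unfolding uv X_def .
    qed
    ultimately have P: "5 * u ^ 4 + 10 * u\<^sup>2 * v\<^sup>2 * \<delta> + v ^ 4 * \<delta>\<^sup>2 = 0" using v by (simp add: scalar_form)
    \<comment> \<open>Combines the relation for order five with the assumed one for a. The factors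
      on the left are the two possible behaviours of \<open>V j\<close>: under \<open>G\<close> it
      goes to \<open>V (5 - j)\<close>, under \<open>H\<close> its line is fixed.\<close>
    have "5 * ((4 * a\<^sup>2 * v\<^sup>2 - d) * (u\<^sup>2 + 3 * \<delta> * v\<^sup>2 + 4 * a\<^sup>2 * v\<^sup>2)) =
        16 * v ^ 4 * (5 * a ^ 4 + 5 * a\<^sup>2 * \<delta> + \<delta>\<^sup>2) - (5 * u ^ 4 + 10 * u\<^sup>2 * v\<^sup>2 * \<delta> + v ^ 4 * \<delta>\<^sup>2)"
      unfolding d_def by (simp add: algebra_simps power_numeral_reduce)
    then have "(4 * a\<^sup>2 * v\<^sup>2 - d) * (u\<^sup>2 + 3 * \<delta> * v\<^sup>2 + 4 * a\<^sup>2 * v\<^sup>2) = 0"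
      unfolding P 0 using small_numerals_nonzero[OF prime gt5] by simp
    then consider (G) "4 * a\<^sup>2 * v\<^sup>2 = d" | (H) "u\<^sup>2 + 3 * \<delta> * v\<^sup>2 + 4 * a\<^sup>2 * v\<^sup>2 = 0" by auto
    note GH = this
    define t where "t = tr (A' ** W j)"
    have td: "d * t = - 2 * (u\<^sup>2 + \<delta> * v\<^sup>2) - 4 * a\<^sup>2 * v\<^sup>2"
      using tr_A'_rot(1)[OF uv(1)] det_S' by (simp add: t_def W_def d_def)
    have trV: "tr (V j ** A') = 2 * a + 2 * a * t"
      using A'(3) tr_commute[of "W j" A'] by (simp add: V_def mat_ring tr_add tr_scal t_def flip: matrix_mul_assoc)
    have d: "d \<noteq> 0" using uv(2) by (simp add: d_def)
    show ?thesis
    proof (cases rule: GH)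
      case H
      have "d * t - d * (- 1) = - (u\<^sup>2 + 3 * \<delta> * v\<^sup>2 + 4 * a\<^sup>2 * v\<^sup>2)"
        unfolding td unfolding d_def by (simp add: algebra_simps)
      then have "d * t = d * (- 1)" unfolding H by (simp add: eq_neg_iff_add_eq_0)
      then have "t = - 1" using d mult_left_cancel by blast
      then have "A' ** V j = mat (- 1) ** V j ** A'"
        by (intro half_turn) (use V_tr A' trV in \<open>simp_all add: mat_zero mat_uminus\<close>)
      then show ?thesis by blast
    next
      case G
      \<comment> \<open>\<open>W (5 - j)\<close> is the conjugate of A' by the inverse of
        \<open>mpow S' j\<close>, which is u - vJ up to a scalar. In its sum with \<open>W j\<close>
        the commutator terms cancel, leaving the combination of A' and \<open>J\<close> that the
        half-turn of \<open>V j\<close> requires.\<close>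
      define W' where "W' = W (5 - j)"
      have "mpow S' j ** mpow S' (5 - j) = mpow S' 5" using j by (simp flip: mpow_add)
      then have "act (mpow S' j) W' = act (mpow S' 5) A'" using det_S' by (simp add: W'_def W_def act_act)
      also have "\<dots> = A'" using conj_to_scalar_power[OF conj, of 5] n det_S' by (intro act_scalar) auto
      finally have "act (minv (mpow S' j)) (act (mpow S' j) W') = act (minv (mpow S' j)) A'" by simp
      then have W': "W' = act (minv (mpow S' j)) A'" using det_S' by simp
      have inv: "minv (mpow S' j) = mat (1 / d) ** (mat u + mat (- v) ** J)"
      proof (rule minv_unique)
        have "mat u + mat (- v) ** J = mat u - mat v ** J" by (cases J rule: mat2_cases) (simp add: mat2_simps)
        then show "mpow S' j ** (mat (1 / d) ** (mat u + mat (- v) ** J)) = mat 1"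
          unfolding mat_left_move[of "mpow S' j"] using form_mult_conj[of u v] d by (simp add: uv(1) flip: d_def)
      qed
      define X where "X = mat u + mat (- v) ** J"
      have dX: "det X \<noteq> 0" using uv(2) unfolding X_def det_form by simp
      have W'X: "W' = act X A'" unfolding W' inv X_def[symmetric] using d dX by simp
      have dW': "mat d ** W' = mat (u\<^sup>2 + \<delta> * v\<^sup>2) ** A' - mat (u * v) ** (J ** A' - A' ** J) - mat (2 * a * v\<^sup>2) ** J"
        unfolding W'X using tr_A'_rot(2)[OF X_def dX] unfolding d_def
        by (cases A' rule: mat2_cases, cases J rule: mat2_cases) (simp add: mat2_simps)
      have dW: "mat d ** W j = mat (u\<^sup>2 + \<delta> * v\<^sup>2) ** A' + mat (u * v) ** (J ** A' - A' ** J) - mat (2 * a * v\<^sup>2) ** J"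
        unfolding W_def d_def using tr_A'_rot(2)[OF uv(1)] det_S' by simp
      have "d * (1 + t) = - 2 * (u\<^sup>2 + \<delta> * v\<^sup>2)" using td G by (simp add: algebra_simps)
      then have t': "2 * a * (d * (1 + t)) = - (4 * a * (u\<^sup>2 + \<delta> * v\<^sup>2))" by (simp only:) (simp add: algebra_simps)
      have "mat (2 * a) ** (mat d ** W j + mat d ** W') =
          mat (4 * a * (u\<^sup>2 + \<delta> * v\<^sup>2)) ** A' - mat (2 * (4 * a\<^sup>2 * v\<^sup>2)) ** J"
        unfolding dW dW'
        by (cases A' rule: mat2_cases, cases J rule: mat2_cases) (simp add: mat2_simps algebra_simps power2_eq_square)
      also have "\<dots> = mat (- (2 * a * (d * (1 + t)))) ** A' - mat (2 * d) ** J" unfolding t' G by simp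
      finally have sum: "mat (2 * a) ** (mat d ** W j + mat d ** W') =
          mat (- (2 * a * (d * (1 + t)))) ** A' - mat (2 * d) ** J" .
      have "mat d ** (- V j - mat (2 * a + 2 * a * t) ** A') - mat d ** (mat 1 ** V (5 - j)) =
          (mat (- (2 * a * (d * (1 + t)))) ** A' - mat (2 * d) ** J) - mat (2 * a) ** (mat d ** W j + mat d ** W')"
        unfolding V_def W'_def[symmetric]
        by (cases A' rule: mat2_cases, cases J rule: mat2_cases, cases "W j" rule: mat2_cases, cases W' rule: mat2_cases)
          (simp add: mat2_simps algebra_simps)
      also have "\<dots> = 0" unfolding sum by simp
      finally have "mat d ** (- V j - mat (tr (V j ** A')) ** A') = mat d ** (mat 1 ** V (5 - j))"
        unfolding trV by (simp only: right_minus_eq)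
      then have "- V j - mat (tr (V j ** A')) ** A' = mat 1 ** V (5 - j)" using scal_cancel[OF d] by blast
      then have "A' ** V j = mat 1 ** V (5 - j) ** A'" by (intro half_turn) (use V_tr A' in auto)
      then show ?thesis by blast
    qed
  qed
  define F where "F = insert J (V ` {..<5})"
  have VF: "V j \<in> F" for j
  proof -
    have "V (j mod 5) \<in> V ` {..<5}" by simp
    then show ?thesis unfolding F_def V5 by blast
  qed
  have "card (V ` {..<5}) \<le> 5" using card_image_le[of "{..<5}" V] by simp
  then have "card F \<le> 6" unfolding F_def by (simp add: card_insert_if)
  then have card: "card F < CARD('a)" using gt6 by simp
  show False
  proof (rule conj_to_no_invariant_set[OF conj _ _ card])
    show "finite F" "F \<noteq> {}" by (auto simp: F_def)
    fix f assume f: "f \<in> F"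
    then consider "f = J" | j where "j < 5" "f = V j" by (auto simp: F_def)
    note cases = this
    show "tr f = 0 \<and> f \<noteq> 0" by (cases rule: cases) (auto simp: tr_J J0 V_tr V_nz)
    show "\<exists>v'\<in>F. \<exists>l. S' ** f = mat l ** v' ** S'"
    proof (cases rule: cases)
      case 1
      have "S' ** J = mat 1 ** J ** S'" using form_commute by (simp add: S'_form)
      then show ?thesis using 1 f by blast
    next
      case (2 j)
      then show ?thesis using S_V[of j] VF by blast
    qed
    show "\<exists>v'\<in>F. \<exists>l. A' ** f = mat l ** v' ** A'"
    proof (cases rule: cases)
      case 1
      then show ?thesis using V_W[of 0] VF unfolding W_simps by blast
    next
      case (2 j)
      have "J \<in> F" by (simp add: F_def)
      show ?thesis
      proof (cases "j = 0")
        case True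
        then show ?thesis using A_V0 2 \<open>J \<in> F\<close> by blast
      next
        case False
        then show ?thesis using A_V[of j] 2 VF by (metis One_nat_def Suc_leI neq0_conv)
      qed
    qed
  qed
qed

end

end

section \<open>Rotations in a torus: normal forms\<close>

context matrix_map
begin

lemma conj_to_trans:
  assumes "conj_to S1 A1" "det P \<noteq> 0" "c \<noteq> 0" "P ** S1 = mat c ** S2 ** P" "psl (P ** A1) = psl (A2 ** P)"
  shows "conj_to S2 A2"
proof -
  obtain T d where T: "det T \<noteq> 0" "d \<noteq> 0" "T ** S = mat d ** S1 ** T" "psl (T ** A) = psl (A1 ** T)"
    using assms(1) by (auto simp: conj_to_def)
  have "P ** T ** S = P ** (mat d ** (S1 ** T))" using T(3) by (simp flip: matrix_mul_assoc)
  also have "\<dots> = mat d ** (P ** S1 ** T)" unfolding mat_left_move[of P] by (simp add: matrix_mul_assoc)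
  also have "\<dots> = mat (d * c) ** S2 ** (P ** T)" unfolding assms(4) by (simp add: matrix_mul_assoc)
  finally have 1: "P ** T ** S = mat (d * c) ** S2 ** (P ** T)" .
  have "psl (P ** (T ** A)) = psl (P ** (A1 ** T))" by (rule psl_mult_cong[OF refl T(4)])
  also have "P ** (A1 ** T) = P ** A1 ** T" by (rule matrix_mul_assoc)
  also have "psl (P ** A1 ** T) = psl (A2 ** P ** T)" by (rule psl_mult_cong[OF assms(5) refl])
  finally have 2: "psl (P ** T ** A) = psl (A2 ** (P ** T))" by (simp add: matrix_mul_assoc)
  show ?thesis unfolding conj_to_def
    by (rule exI[of _ "P ** T"], rule exI[of _ "d * c"]) (use 1 2 T assms in simp)
qed

lemma conj_to_unique:
  assumes "conj_to S1 A1" "conj_to S2 A2"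
  obtains P c where "det P \<noteq> 0" "c \<noteq> 0" "P ** S1 = mat c ** S2 ** P" "psl (P ** A1) = psl (A2 ** P)"
proof -
  obtain T d where T: "det T \<noteq> 0" "d \<noteq> 0" "T ** S = mat d ** S1 ** T" "psl (T ** A) = psl (A1 ** T)"
    using assms(1) by (auto simp: conj_to_def)
  obtain U c where U: "det U \<noteq> 0" "c \<noteq> 0" "U ** S = mat c ** S2 ** U" "psl (U ** A) = psl (A2 ** U)"
    using assms(2) by (auto simp: conj_to_def)
  define P where "P = U ** minv T"
  have PT: "P ** T = U" using T by (simp add: P_def)
  have "mat d ** (P ** S1) ** T = P ** (mat d ** S1 ** T)"
    using mat_left_move[of P d "S1 ** T"] by (simp add: matrix_mul_assoc)
  also have "\<dots> = mat c ** S2 ** P ** T"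
    unfolding T(3)[symmetric] using U(3) PT by (metis matrix_mul_assoc)
  finally have "mat d ** (P ** S1) = mat c ** S2 ** P" using cancel_right[OF T(1)] by blast
  then have "mat (1/d) ** (mat d ** (P ** S1)) = mat (1/d) ** (mat c ** S2 ** P)" by simp
  then have 1: "P ** S1 = mat (c / d) ** S2 ** P" using T(2) by (simp add: matrix_mul_assoc)
  have "psl (P ** (A1 ** T)) = psl (P ** (T ** A))" by (rule psl_mult_cong[OF refl T(4)[symmetric]])
  also have "P ** (T ** A) = U ** A" unfolding matrix_mul_assoc PT ..
  finally have "psl (P ** (A1 ** T)) = psl (A2 ** U)" using U(4) by simp
  then have "psl (P ** (A1 ** T) ** minv T) = psl (A2 ** U ** minv T)" by (rule psl_mult_cong) simp
  then have 2: "psl (P ** A1) = psl (A2 ** P)" using T(1) by (simp add: P_def matrix_mul_assoc)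
  show thesis by (rule that[of P "c / d"]) (use 1 2 T U in \<open>auto simp: P_def\<close>)
qed

lemma conj_to_traceless:
  assumes "conj_to S1 A1" "det A1 = 1" shows "tr A1 = 0"
proof -
  obtain T where T: "det T \<noteq> 0" "psl (T ** A) = psl (A1 ** T)"
    using assms(1) by (auto simp: conj_to_def)
  then have "T ** A = A1 ** T \<or> T ** A = (- A1) ** T" by (simp add: psl_eq_iff)
  then show ?thesis using tr_conj[of T A] T(1) tr_A tr_uminus[of A1] by (metis neg_equal_0_iff_equal)
qed

end

section \<open>Fusion in a torus and the normal form\<close>

context torus_map
begin

lemma commute_form:
  assumes "P ** J = J ** P" shows "P ** (mat u + mat v ** J) = (mat u + mat v ** J) ** P"
proof -
  have "P ** (mat u + mat v ** J) = mat u ** P + mat v ** (P ** J)"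
    unfolding mat_ring(1) mat_left_move[of P] mat_times_comm[of P] ..
  also have "\<dots> = (mat u + mat v ** J) ** P" unfolding assms mat_ring(2) matrix_mul_assoc ..
  finally show ?thesis .
qed

lemma anticommute_form:
  assumes "P ** J = - (J ** P)" shows "P ** (mat u + mat v ** J) = (mat u - mat v ** J) ** P"
proof -
  have "P ** (mat u + mat v ** J) = mat u ** P + mat v ** (P ** J)"
    unfolding mat_ring(1) mat_left_move[of P] mat_times_comm[of P] ..
  also have "\<dots> = (mat u - mat v ** J) ** P" unfolding assms mat_ring(4) by (simp add: matrix_mul_assoc)
  finally show ?thesis .
qed

lemma mpow_T_form: obtains u v where "mpow T j = mat u + mat v ** J"
  unfolding T_form by (rule mpow_torus_form[OF JJ])

lemma mpow_T_mod: obtains c where "c \<noteq> 0" "mpow T j = mat c ** mpow T (j mod N)"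
proof -
  have "scalar (mpow T (N * (j div N)))" using T_order by simp
  then obtain c where c: "mpow T (N * (j div N)) = mat c" by (auto simp: scalar_def)
  have "det (mat c :: 'a^2^2) \<noteq> 0" unfolding c[symmetric] using det_T by simp
  moreover have "mpow T j = mat c ** mpow T (j mod N)" unfolding c[symmetric] by (simp flip: mpow_add)
  ultimately show thesis using that by simp
qed

lemma mpow_T_proportional:
  assumes "mpow T i = mat c ** mpow T j" "c \<noteq> 0"
  shows "i mod N = j mod N"
proof -
  have *: "i mod N = j mod N" if "j \<le> i" "mpow T i = mat c ** mpow T j" for i j c
  proof -
    have "mpow T (i - j) ** mpow T j = mat c ** mpow T j" using that by (simp flip: mpow_add)
    then have "mpow T (i - j) = mat c" using cancel_right[of "mpow T j"] det_T by simp
    then have "N dvd i - j" using T_order by (metis scalar_mat)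
    then show ?thesis using that(1) by (simp add: mod_eq_dvd_iff_nat)
  qed
  show ?thesis
  proof (cases "j \<le> i")
    case True
    then show ?thesis using * assms by blast
  next
    case False
    have "mpow T j = mat (1/c) ** mpow T i" using assms by simp
    then show ?thesis using *[of i j "1/c"] False by simp
  qed
qed

text \<open>\<nu> inverts \<open>T\<close> modulo scalars, because it anticommutes with
  \<open>J\<close> and so turns r + qJ into its adjugate r - qJ.\<close>

lemma \<nu>_T: obtains c where "c \<noteq> 0" "T ** \<nu> ** T = mat c ** \<nu>"
proof -
  have "\<nu> ** T = (mat r - mat q ** J) ** \<nu>"
    unfolding T_form by (rule anticommute_form[OF \<nu>(2)])
  then have "T ** \<nu> ** T = T ** (mat r - mat q ** J) ** \<nu>" by (simp flip: matrix_mul_assoc)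
  also have "T ** (mat r - mat q ** J) = mat (r\<^sup>2 - \<delta> * q\<^sup>2)" unfolding T_form by (rule form_mult_conj)
  finally show thesis using that[of "r\<^sup>2 - \<delta> * q\<^sup>2"] det_T unfolding T_form det_form by blast
qed

lemma reverse_power: obtains c where "c \<noteq> 0" "mpow T j ** \<nu> ** mpow T j = mat c ** \<nu>"
proof -
  obtain c where c: "c \<noteq> 0" "T ** \<nu> ** T = mat c ** \<nu>" using \<nu>_T by blast
  have "mpow T j ** \<nu> ** mpow T j = mat (c ^ j) ** \<nu>"
  proof (induction j)
    case (Suc j)
    have "mpow T (Suc j) ** \<nu> ** mpow T (Suc j) = (T ** mpow T j) ** \<nu> ** (mpow T j ** T)"
      unfolding mpow_Suc2[of T j, symmetric] unfolding mpow.simps(2) ..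
    also have "\<dots> = T ** (mpow T j ** \<nu> ** mpow T j) ** T" by (simp add: matrix_mul_assoc)
    also have "\<dots> = T ** (mat (c ^ j) ** (\<nu> ** T))" unfolding Suc by (simp add: matrix_mul_assoc)
    also have "\<dots> = mat (c ^ j) ** (T ** \<nu> ** T)" unfolding mat_left_move[of T] by (simp add: matrix_mul_assoc)
    also have "\<dots> = mat (c ^ Suc j) ** \<nu>" unfolding c(2) by (simp add: mult.commute)
    finally show ?case .
  qed simp
  then show thesis by (rule that[rotated]) (use c(1) in simp)
qed

text \<open>Comparing traces matches the scalar parts, so PJ = m JP for some m, and J^2 = \<delta>
  forces m = 1 or m = -1. Accordingly \<open>P\<close> centralises the torus or inverts it.\<close>

lemma torus_fusion:
  assumes P: "det P \<noteq> 0" "c \<noteq> 0" "P ** mpow T i = mat c ** mpow T j ** P"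
    and ns: "\<not> scalar (mpow T i)"
  obtains "P ** J = J ** P" "i mod N = j mod N" | "(i + j) mod N = 0"
proof -
  obtain u v where i: "mpow T i = mat u + mat v ** J" by (rule mpow_T_form)
  obtain u' v' where j: "mpow T j = mat u' + mat v' ** J" by (rule mpow_T_form)
  have v: "v \<noteq> 0" using ns unfolding i scalar_form .
  have "tr (mpow T i) = tr (mat c ** mpow T j)" using tr_conj[OF P(3,1)] .
  then have "2 * u = 2 * (c * u')" unfolding i j tr_scal by (simp add: tr_add tr_scal tr_mat tr_J algebra_simps)
  then have u: "u = c * u'" using two_nonzero by simp
  have "mat u ** P + mat v ** (P ** J) = P ** mpow T i"
    unfolding i mat_ring(1) mat_left_move[of P] mat_times_comm[of P] ..
  also have "\<dots> = mat u ** P + mat (c * v') ** (J ** P)"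
    unfolding P(3) j u mat_ring mat_mat_times' matrix_mul_assoc mat_mat_times ..
  finally have PJ: "mat v ** (P ** J) = mat (c * v') ** (J ** P)" by simp
  define m where "m = c * v' / v"
  have "mat (1/v) ** (mat v ** (P ** J)) = mat (1/v) ** (mat (c * v') ** (J ** P))" by (simp only: PJ)
  moreover have "1 / v * v = 1" "1 / v * (c * v') = m" using v by (simp_all add: m_def)
  ultimately have PJm: "P ** J = mat m ** (J ** P)" by (simp only: mat_mat_times' matrix_mul_lid)
  have "mat \<delta> ** P = P ** (J ** J)" unfolding JJ by (rule mat_times_comm[symmetric])
  also have "\<dots> = P ** J ** J" by (rule matrix_mul_assoc)
  also have "\<dots> = mat m ** (J ** P) ** J" by (simp only: PJm)
  also have "\<dots> = mat m ** (J ** (P ** J))" by (simp only: matrix_mul_assoc)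
  also have "\<dots> = mat m ** (J ** (mat m ** (J ** P)))" by (simp only: PJm)
  also have "\<dots> = mat (m * m) ** (J ** J ** P)"
    by (simp only: mat_left_move[of J] mat_mat_times' matrix_mul_assoc[of J J P])
  also have "\<dots> = mat (m * m * \<delta>) ** P" by (simp only: JJ mat_mat_times')
  finally have "(mat \<delta> :: 'a^2^2) = mat (m * m * \<delta>)" by (simp only: cancel_right[OF P(1)])
  then have "\<delta> = m * m * \<delta>" by (simp only: mat_mat2 mat2_eq_iff)
  then have "m * m = 1" using \<delta> by (simp only: mult_cancel_right1) simp
  then consider "m = 1" | "m = - 1" by (auto simp: square_eq_1_iff)
  then show thesis
  proof cases
    case 1
    then have comm: "P ** J = J ** P" using PJm by simp
    then have "P ** T = T ** P" unfolding T_form by (rule commute_form)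
    then have "mpow T i ** P = mat c ** mpow T j ** P" unfolding P(3)[symmetric] by (rule mpow_intertwine[symmetric])
    then have "mpow T i = mat c ** mpow T j" using cancel_right[OF P(1)] by blast
    then have "i mod N = j mod N" using mpow_T_proportional P(2) by blast
    then show thesis using that(1) comm by blast
  next
    case 2
    then have "P ** J = - (J ** P)" using PJm by (simp add: mat_uminus)
    then have PT: "P ** mpow T i = (mat u - mat v ** J) ** P"
      unfolding i by (rule anticommute_form)
    then have "mat c ** mpow T j ** P = (mat u - mat v ** J) ** P" unfolding P(3) .
    then have "mat c ** mpow T j = mat u - mat v ** J" using cancel_right[OF P(1)] by blast
    then have "mat c ** (mpow T i ** mpow T j) = mpow T i ** (mat u - mat v ** J)"
      using mat_left_move[of "mpow T i" c "mpow T j"] by simp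
    also have "\<dots> = mat (u\<^sup>2 - \<delta> * v\<^sup>2)" unfolding i by (rule form_mult_conj)
    finally have "mat c ** mpow T (i + j) = mat (u\<^sup>2 - \<delta> * v\<^sup>2)" by (simp add: mpow_add)
    then have "scalar (mat c ** mpow T (i + j))" by simp
    then have "scalar (mpow T (i + j))" using scalar_scal P(2) by blast
    then show thesis using that(2) T_order by auto
  qed
qed

text \<open>With \<delta> = 1 and \<delta> = e these are the conditions of (ii) and (iii). The bound
  on \<open>u\<close> keeps one of the exponents u and n - u, whose rotations are exchanged by
  \<nu>.\<close>

definition admissible :: "'a \<Rightarrow> nat \<Rightarrow> bool" where
  "admissible a u \<longleftrightarrow> a \<noteq> 0 \<and> a\<^sup>2 \<noteq> - \<delta> \<and> gcd u (card \<Omega>) = 1 \<and> 1 \<le> u \<and> 2 * u < card \<Omega> \<and>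
    (card \<Omega> = 3 \<longrightarrow> 3 * a\<^sup>2 \<noteq> - \<delta> \<and> 3 * a\<^sup>2 \<noteq> - 2 * \<delta> \<and> 9 * a ^ 4 + 9 * a\<^sup>2 * \<delta> + \<delta>\<^sup>2 \<noteq> 0) \<and>
    (card \<Omega> = 5 \<longrightarrow> 5 * a ^ 4 + 5 * a\<^sup>2 * \<delta> + \<delta>\<^sup>2 \<noteq> 0)"

text \<open>The power of \<open>T\<close> has order n in PGL(2), so k = m k' with m = N / n and k'
  prime to n. Reducing k' modulo n costs a scalar, \<nu> brings the exponent below n / 2, and
  \<open>nf_ex\<close> moves the involution inside the centraliser of the torus. Both signs of the
  parameter occur because \<open>A1\<close> and \<open>- A1\<close> represent the same
  element.\<close>

lemma normal_form_exists:
  assumes n: "card \<Omega> dvd N" and conj: "conj_to (mpow T k) A0" and A0: "det A0 = 1"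
  obtains a u where "\<And>a'. a' = a \<or> a' = - a \<Longrightarrow> admissible a' u \<and> conj_to (mpow T (N * u div card \<Omega>)) (nf a')"
proof -
  define n m where "n = card \<Omega>" and "m = N div card \<Omega>"
  have n2: "n > 2" using card_gt_2 by (simp add: n_def)
  have Nm: "N = n * m" using n by (simp add: n_def m_def)
  have m0: "m > 0" using N_pos Nm by (cases m) auto
  have ord: "N dvd k * i \<longleftrightarrow> n dvd i" for i
    using conj_to_scalar_power[OF conj, of i] T_order[of "k * i"] by (simp add: n_def mpow_mult)
  have "n * m dvd k * n" using ord[of n] Nm by simp
  then have "m dvd k" using n2 by (simp add: mult.commute)
  then obtain k' where k': "k = m * k'" by blast
  have cop: "coprime k' n"
  proof -
    \<comment> \<open>A common divisor \<open>g\<close> would make the rotation trivial already at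
      the exponent n / g.\<close>
    define g where "g = gcd k' n"
    have "g dvd k'" "g dvd n" by (simp_all add: g_def)
    then obtain k1 n1 where kn: "k' = g * k1" "n = g * n1" by (auto elim!: dvdE)
    then have "k * n1 = N * k1" unfolding k' Nm by (simp add: ac_simps)
    then have "n dvd n1" using ord[of n1] by simp
    moreover have "n1 > 0" "g > 0" using kn(2) n2 by (auto intro!: Nat.gr0I)
    ultimately have "g * n1 \<le> 1 * n1" using dvd_imp_le[of n n1] kn(2) by simp
    then have "g \<le> 1" using \<open>n1 > 0\<close> by (simp only: mult_le_cancel2)
    then have "g = 1" using \<open>g > 0\<close> by simp
    then show ?thesis by (simp add: g_def coprime_iff_gcd_eq_1)
  qed
  define u0 where "u0 = k' mod n"
  have u0: "u0 < n" "coprime u0 n" using n2 cop by (simp_all add: u0_def coprime_mod_left_iff)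
  have "u0 \<noteq> 0"
  proof
    assume "u0 = 0"
    then show False using u0 n2 by simp
  qed
  have "2 * u0 \<noteq> n"
  proof
    assume "2 * u0 = n"
    then have "u0 dvd n" by auto
    then have "u0 dvd gcd u0 n" by (intro gcd_greatest dvd_refl)
    moreover have "gcd u0 n = 1" using u0(2) by (simp only: coprime_iff_gcd_eq_1)
    ultimately have "u0 = 1" by simp
    then show False using \<open>2 * u0 = n\<close> n2 by simp
  qed
  have T1: "conj_to (mpow T (m * u0)) A0"
  proof -
    obtain c where c: "c \<noteq> 0" "mpow T k = mat c ** mpow T (k mod N)" by (rule mpow_T_mod)
    have "k mod N = m * u0" unfolding k' Nm u0_def by (simp add: mult.commute[of n m])
    then show ?thesis using c by (intro conj_to_trans[OF conj, of "mat 1" c]) simp_all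
  qed
  obtain u A1 where u: "coprime u n" "1 \<le> u" "2 * u < n" and A1: "det A1 = 1" and conj1: "conj_to (mpow T (m * u)) A1"
  proof (cases "2 * u0 < n")
    case True
    then show thesis using that[OF u0(2) _ _ A0 T1] \<open>u0 \<noteq> 0\<close> by simp
  next
    case False
    define u where "u = n - u0"
    have "coprime u n" unfolding u_def using u0 gcd_diff2_nat[of u0 n] by (simp add: coprime_iff_gcd_eq_1)
    moreover have "1 \<le> u" "2 * u < n" using u0 False \<open>2 * u0 \<noteq> n\<close> by (auto simp: u_def)
    moreover have "conj_to (mpow T (m * u)) (act \<nu> A0)"
    proof -
      obtain c where c: "c \<noteq> 0" "mpow T (m * u) ** \<nu> ** mpow T (m * u) = mat c ** \<nu>" by (rule reverse_power)
      have "u0 + u = n" using u0 by (simp add: u_def)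
      then have "m * u0 + m * u = N" unfolding Nm distrib_left[symmetric] by (simp add: mult.commute)
      then have "mpow T (m * u0) ** mpow T (m * u) = mpow T N" by (simp flip: mpow_add)
      moreover have "scalar (mpow T N)" using T_order by simp
      ultimately obtain d where d: "mpow T (m * u0) ** mpow T (m * u) = mat d" by (auto simp: scalar_def)
      from arg_cong[OF this, of det] have "d \<noteq> 0" using det_T by auto
      have "mat c ** (\<nu> ** mpow T (m * u0)) = mat c ** \<nu> ** mpow T (m * u0)" by (simp add: matrix_mul_assoc)
      also have "\<dots> = mpow T (m * u) ** \<nu> ** (mpow T (m * u0) ** mpow T (m * u))"
        unfolding c(2)[symmetric] by (simp add: mpow_comm[of T "m * u0" "m * u"] flip: matrix_mul_assoc)
      also have "\<dots> = mat d ** (mpow T (m * u) ** \<nu>)" unfolding d by (rule mat_times_comm)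
      finally have "mat (1/c) ** (mat c ** (\<nu> ** mpow T (m * u0))) = mat (1/c) ** (mat d ** (mpow T (m * u) ** \<nu>))"
        by simp
      then have 1: "\<nu> ** mpow T (m * u0) = mat (d / c) ** mpow T (m * u) ** \<nu>" using c(1) by (simp add: matrix_mul_assoc)
      have "d / c \<noteq> 0" using c(1) \<open>d \<noteq> 0\<close> by simp
      moreover have "psl (\<nu> ** A0) = psl (act \<nu> A0 ** \<nu>)" using act_intertwine[OF \<nu>(1), of A0] by simp
      ultimately show ?thesis using conj_to_trans[OF T1 \<nu>(1) _ 1] by blast
    qed
    moreover have "det (act \<nu> A0) = 1" using \<nu>(1) A0 by simp
    ultimately show thesis using that by blast
  qed
  have trA1: "tr A1 = 0" by (rule conj_to_traceless[OF conj1 A1])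
  define b where "b = tr (J ** A1) / 2"
  have b: "tr (J ** A1) = 2 * b" using two_nonzero by (simp add: b_def)
  obtain x y where xy: "mpow T (m * u) = mat x + mat y ** J" by (rule mpow_T_form)
  have dT: "det (mpow T (m * u)) \<noteq> 0" using det_T by simp
  note excl = exclude_zero[OF conj1 xy dT trA1 A1 b] exclude_degenerate[OF conj1 xy dT trA1 A1 b]
    exclude_3[OF conj1 xy dT trA1 A1 b] exclude_5[OF conj1 xy dT trA1 A1 b]
  have \<kappa>\<kappa>: "\<kappa> * \<kappa> = 1" using \<kappa> by (simp add: power2_eq_square)
  have Nu: "N * u div card \<Omega> = m * u" unfolding Nm n_def[symmetric] using n2 by simp
  show thesis
  proof (rule that[of "\<kappa> * b" u])
    fix a' assume a': "a' = \<kappa> * b \<or> a' = - (\<kappa> * b)"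
    then have sq: "a'\<^sup>2 = b\<^sup>2" using \<kappa> by (auto simp: power_mult_distrib)
    have "a' ^ 4 = a'\<^sup>2 * a'\<^sup>2" "b ^ 4 = b\<^sup>2 * b\<^sup>2" by (simp_all flip: power_add)
    then have sq4: "a' ^ 4 = b ^ 4" unfolding sq by (simp only:)
    have "a' \<noteq> 0" using sq excl(1) by auto
    then have "admissible a' u" unfolding admissible_def sq sq4 n_def[symmetric]
      using excl u by (simp add: n_def coprime_iff_gcd_eq_1)
    moreover have "conj_to (mpow T (m * u)) (nf a')"
    proof -
      \<comment> \<open>The sign of the representative is chosen to make its trace against
        \<open>J\<close> that of the normal form.\<close>
      have "\<exists>B. tr B = 0 \<and> det B = 1 \<and> tr (J ** B) = \<kappa> * (2 * a') \<and> psl B = psl A1"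
      proof (cases "a' = \<kappa> * b")
        case True
        then have "\<kappa> * (2 * a') = (\<kappa> * \<kappa>) * (2 * b)" by (simp add: algebra_simps)
        then have eq: "\<kappa> * (2 * a') = 2 * b" unfolding \<kappa>\<kappa> by (simp only: mult_1)
        show ?thesis by (rule exI[of _ A1]) (simp only: trA1 A1 b eq)
      next
        case False
        then have "\<kappa> * (2 * a') = - ((\<kappa> * \<kappa>) * (2 * b))" using a' by (simp add: algebra_simps)
        then have eq: "\<kappa> * (2 * a') = - (2 * b)" unfolding \<kappa>\<kappa> by (simp only: mult_1)
        show ?thesis
          by (rule exI[of _ "- A1"]) (simp only: tr_uminus mul_uminus det_uminus2 psl_uminus minus_zero trA1 A1 b eq)
      qed
      then obtain B where B: "tr B = 0" "det B = 1" "tr (J ** B) = \<kappa> * (2 * a')" "psl B = psl A1" by blast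
      have "a'\<^sup>2 \<noteq> - \<delta>" using sq excl(2) by simp
      then obtain P where P: "det P \<noteq> 0" "P ** J = J ** P" "P ** B = nf a' ** P"
        using nf_ex[OF B(1-3)] by blast
      have "P ** T = T ** P" unfolding T_form by (rule commute_form[OF P(2)])
      then have "P ** mpow T (m * u) = mpow T (m * u) ** P" by (rule mpow_intertwine)
      moreover have "psl (P ** A1) = psl (nf a' ** P)"
        using psl_mult_cong[OF refl B(4), of P] P(3) by simp
      ultimately show ?thesis using P(1) by (intro conj_to_trans[OF conj1, of P 1]) simp_all
    qed
    ultimately show "admissible a' u \<and> conj_to (mpow T (N * u div card \<Omega>)) (nf a')" unfolding Nu by simp
  qed
qed

text \<open>\<open>torus_fusion\<close> gives equal exponents and a conjugating matrix commuting
  with \<open>J\<close>, under which the trace against \<open>J\<close> is invariant up to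
  sign.\<close>

lemma normal_form_unique:
  assumes n: "card \<Omega> dvd N"
    and 1: "admissible a u" "conj_to (mpow T (N * u div card \<Omega>)) (nf a)"
    and 2: "admissible a' u'" "conj_to (mpow T (N * u' div card \<Omega>)) (nf a')"
  shows "(a' = a \<or> a' = - a) \<and> u' = u"
proof -
  define n m where "n = card \<Omega>" and "m = N div card \<Omega>"
  have n2: "n > 2" using card_gt_2 by (simp add: n_def)
  have Nm: "N = n * m" using n by (simp add: n_def m_def)
  have m0: "m > 0" using N_pos Nm by (cases m) auto
  have Nu: "N * i div card \<Omega> = m * i" for i unfolding Nm n_def[symmetric] using n2 by simp
  have u: "1 \<le> u" "2 * u < n" "1 \<le> u'" "2 * u' < n" using 1 2 by (auto simp: admissible_def n_def)
  obtain P c where P: "det P \<noteq> 0" "c \<noteq> 0" "P ** mpow T (m * u) = mat c ** mpow T (m * u') ** P"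
    "psl (P ** nf a) = psl (nf a' ** P)"
    using conj_to_unique[OF 1(2) 2(2)] unfolding Nu by blast
  have lt: "m * i < N" if "i < n" for i using that m0 unfolding Nm by simp
  \<comment> \<open>Since u + u' is below n, the exponents cannot add up to 0 modulo
    \<open>N\<close>; this rules out the inverting case of \<open>torus_fusion\<close>.\<close>
  have "m * u < N" "m * u' < N" "m * (u + u') < N" using u by (auto intro!: lt)
  moreover have "m * u > 0" "m * (u + u') > 0" using u m0 by auto
  moreover have "\<not> scalar (mpow T (m * u))" using T_order \<open>m * u < N\<close> \<open>m * u > 0\<close> by (auto dest: dvd_imp_le)
  ultimately have P_comm: "P ** J = J ** P" and "m * u mod N = m * u' mod N"
    using torus_fusion[OF P(1-3)] by (auto simp: distrib_left)
  then have "m * u = m * u'" using \<open>m * u < N\<close> \<open>m * u' < N\<close> by simp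
  then have uu: "u' = u" using m0 by simp
  have PJ: "P ** (J ** B) = J ** (P ** B)" for B unfolding matrix_mul_assoc P_comm ..
  have "P ** nf a = nf a' ** P \<or> P ** nf a = - (nf a' ** P)" using P(4) by (simp only: psl_eq_iff)
  then have "tr (J ** nf a) = tr (J ** nf a') \<or> tr (J ** nf a) = - tr (J ** nf a')"
  proof
    assume "P ** nf a = nf a' ** P"
    then have "P ** (J ** nf a) = (J ** nf a') ** P" unfolding PJ by (simp add: matrix_mul_assoc)
    then show ?thesis using tr_conj P(1) by blast
  next
    assume "P ** nf a = - (nf a' ** P)"
    then have "P ** (J ** nf a) = (- (J ** nf a')) ** P" unfolding PJ by (simp add: matrix_mul_assoc)
    then show ?thesis using tr_conj P(1) tr_uminus by metis
  qed
  then have *: "\<kappa> * (2 * a) = \<kappa> * (2 * a') \<or> \<kappa> * (2 * a) = \<kappa> * (2 * (- a'))" unfolding nf(3) by auto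
  have "\<kappa> \<noteq> 0" using \<kappa> by auto
  then have "a = a' \<or> a = - a'" using * two_nonzero by (metis mult_left_cancel)
  then show ?thesis using uu by auto
qed

lemma normal_form:
  assumes "card \<Omega> dvd N" "conj_to (mpow T k) A0" "det A0 = 1"
  shows "\<exists>a u. \<forall>a' u'. admissible a' u' \<and> conj_to (mpow T (N * u' div card \<Omega>)) (nf a') \<longleftrightarrow>
    (a' = a \<or> a' = - a) \<and> u' = u"
proof -
  obtain a u where au: "\<And>a'. a' = a \<or> a' = - a \<Longrightarrow> admissible a' u \<and> conj_to (mpow T (N * u div card \<Omega>)) (nf a')"
    using normal_form_exists[OF assms] by blast
  show ?thesis
  proof (intro exI allI iffI)
    fix a' u' assume "admissible a' u' \<and> conj_to (mpow T (N * u' div card \<Omega>)) (nf a')"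
    then show "(a' = a \<or> a' = - a) \<and> u' = u"
      using normal_form_unique[OF assms(1)] au[of a] by blast
  next
    fix a' u' assume "(a' = a \<or> a' = - a) \<and> u' = u"
    then show "admissible a' u' \<and> conj_to (mpow T (N * u' div card \<Omega>)) (nf a')" using au by blast
  qed
qed

end

section \<open>The three kinds of rotations\<close>

context matrix_map
begin

lemma no_invariant_line:
  assumes "conj_to S' A'" "tr v = 0" "v \<noteq> 0" "S' ** v = mat l ** v ** S'" "A' ** v = mat l' ** v ** A'"
  shows False
proof (rule conj_to_no_invariant_set[OF assms(1), of "{v}"])
  show "\<exists>v'\<in>{v}. \<exists>l. S' ** u = mat l ** v' ** S'" if "u \<in> {v}" for u using that assms(4) by blast
  show "\<exists>v'\<in>{v}. \<exists>l. A' ** u = mat l ** v' ** A'" if "u \<in> {v}" for u using that assms(5) by blast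
qed (use gt6 assms in auto)

lemma order_cases:
  obtains (unipotent) A0 where "card \<Omega> = CARD('a)" "conj_to mat_\<beta> A0" "det A0 = 1"
  | (split) A0 k where "card \<Omega> dvd CARD('a) - 1" "conj_to (mpow (mat_\<alpha> e) k) A0" "det A0 = 1"
  | (nonsplit) A0 k where "card \<Omega> dvd CARD('a) + 1" "conj_to (mpow g0 k) A0" "det A0 = 1"
proof -
  have conj: "conj_to S0 (act P A) \<and> det (act P A) = 1"
    if "det P \<noteq> 0" "c \<noteq> 0" "P ** S = mat c ** S0 ** P" for P c S0
  proof -
    have "psl (P ** A) = psl (act P A ** P)" using act_intertwine[OF that(1), of A] by simp
    then have "conj_to S0 (act P A)" unfolding conj_to_def using that by blast
    then show ?thesis using that(1) det_A by simp
  qed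
  have ns: "\<not> scalar S"
  proof
    assume "scalar S"
    then have "card \<Omega> dvd 1" using scalar_power_iff[of 1] by simp
    then show False using card_gt_2 by simp
  qed
  show thesis using det_S ns
  proof (cases rule: trichotomy)
    case (unipotent P c)
    note * = conj[OF unipotent]
    have "card \<Omega> dvd k \<longleftrightarrow> CARD('a) dvd k" for k
      using conj_to_scalar_power[OF conjunct1[OF *], of k] scalar_mpow_beta[OF prime, of k] by blast
    then have "card \<Omega> = CARD('a)" using dvd_antisym dvd_refl by metis
    then show thesis using that(1) * by blast
  next
    case (split P c k)
    note * = conj[OF split]
    have "scalar (mpow (mpow (mat_\<alpha> e) k) (CARD('a) - 1))"
      unfolding mpow_mult[symmetric] scalar_mpow_alpha[OF gen_e] by (rule dvd_triv_right)
    then have "card \<Omega> dvd CARD('a) - 1" using conj_to_scalar_power[OF conjunct1[OF *]] by blast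
    then show thesis using that(2) * by blast
  next
    case (nonsplit P c k)
    note * = conj[OF nonsplit]
    have "scalar (mpow (mpow g0 k) (CARD('a) + 1))"
      unfolding mpow_mult[symmetric] scalar_mpow_gamma by (rule dvd_triv_right)
    then have "card \<Omega> dvd CARD('a) + 1" using conj_to_scalar_power[OF conjunct1[OF *]] by blast
    then show thesis using that(3) * by blast
  qed
qed

text \<open>A common divisor of p - 1 and p + 1 divides 2, while the valency exceeds 2. So the
  valency alone tells which case of \<open>order_cases\<close> occurs.\<close>

lemma orders_exclusive:
  "\<not> (card \<Omega> = CARD('a) \<and> card \<Omega> dvd CARD('a) - 1)"
  "\<not> (card \<Omega> = CARD('a) \<and> card \<Omega> dvd CARD('a) + 1)"
  "\<not> (card \<Omega> dvd CARD('a) - 1 \<and> card \<Omega> dvd CARD('a) + 1)"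
proof -
  show "\<not> (card \<Omega> = CARD('a) \<and> card \<Omega> dvd CARD('a) - 1)"
  proof
    assume "card \<Omega> = CARD('a) \<and> card \<Omega> dvd CARD('a) - 1"
    then have "CARD('a) \<le> CARD('a) - 1" using gt5 by (intro dvd_imp_le) auto
    then show False using gt5 by linarith
  qed
  show "\<not> (card \<Omega> = CARD('a) \<and> card \<Omega> dvd CARD('a) + 1)"
  proof
    assume "card \<Omega> = CARD('a) \<and> card \<Omega> dvd CARD('a) + 1"
    then have "CARD('a) dvd CARD('a) + 1" by metis
    then have "CARD('a) dvd 1" by (metis dvd_add_right_iff dvd_refl)
    then show False using gt5 by simp
  qed
  show "\<not> (card \<Omega> dvd CARD('a) - 1 \<and> card \<Omega> dvd CARD('a) + 1)"
  proof
    assume *: "card \<Omega> dvd CARD('a) - 1 \<and> card \<Omega> dvd CARD('a) + 1"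
    have "card \<Omega> dvd (CARD('a) + 1) - (CARD('a) - 1)" using * by (rule_tac dvd_diff_nat) blast+
    moreover have "(CARD('a) + 1) - (CARD('a) - 1) = 2" using gt5 by linarith
    ultimately have "card \<Omega> dvd 2" by simp
    then have "card \<Omega> \<le> 2" by (intro dvd_imp_le) auto
    then show False using card_gt_2 by simp
  qed
qed

lemma order_dvd: "card \<Omega> dvd CARD('a) * (CARD('a)\<^sup>2 - 1)"
proof -
  have "CARD('a)\<^sup>2 - 1 = (CARD('a) + 1) * (CARD('a) - 1)" using card_sq card_b by simp
  then have "(CARD('a) - 1) dvd CARD('a)\<^sup>2 - 1" "(CARD('a) + 1) dvd CARD('a)\<^sup>2 - 1"
    by (simp_all only: dvd_triv_left dvd_triv_right)
  moreover have "card \<Omega> = CARD('a) \<or> card \<Omega> dvd CARD('a) - 1 \<or> card \<Omega> dvd CARD('a) + 1"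
    using order_cases by blast
  ultimately show ?thesis by (auto intro: dvd_mult dvd_trans)
qed

text \<open>Up to scalars, the centraliser of \<beta> consists of upper unipotents. They clear the
  diagonal of \<open>A0\<close> and preserve its lower left entry \<open>Z\<close>, which is
  therefore the parameter, unique up to the sign of the representative.\<close>

lemma conj_to_unipotent_normal_form:
  assumes conj: "conj_to mat_\<beta> A0" and A0: "det A0 = 1"
  shows "\<exists>z::'a. \<forall>z'. z' \<noteq> 0 \<and> conj_to mat_\<beta> (mat_varpi z') \<longleftrightarrow> z' = z \<or> z' = - z"
proof -
  have "tr A0 = 0" by (rule conj_to_traceless[OF conj A0])
  then obtain X Y Z where A0_eq: "A0 = mat2 X Y Z (- X)" by (rule traceless_cases)
  have det: "- (X * X) - Y * Z = 1" using A0 by (simp add: A0_eq mat2_simps)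
  have Z: "Z \<noteq> 0"
  proof
    assume Z: "Z = 0"
    \<comment> \<open>\<open>A0\<close> would be upper triangular like \<beta>, so both would
      preserve this nilpotent line.\<close>
    define V :: "'a^2^2" where "V = mat2 0 1 0 0"
    have "A0 ** V = mat (- 1) ** V ** A0" "mat_\<beta> ** V = mat 1 ** V ** mat_\<beta>"
      by (simp_all add: A0_eq V_def Z mat_\<beta>_def mat2_simps)
    moreover have "V \<noteq> 0" "tr V = 0" by (simp_all add: V_def mat2_simps)
    ultimately show False using no_invariant_line[OF conj] by blast
  qed
  \<comment> \<open>The unipotent that moves the diagonal entry \<open>X\<close> to 0; the
    determinant then makes the upper right entry -1/Z.\<close>
  define P where "P = mat2 1 (- X / Z) 0 1"
  have "Y * Z = - (- (X * X) - Y * Z) - X * X" by simp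
  then have YZ: "Y * Z = - 1 - X * X" unfolding det .
  have "P ** A0 = mat_varpi Z ** P"
  proof -
    have "(Y + X / Z * X) * Z = - 1" using Z YZ by (simp add: algebra_simps)
    then have "Y + X / Z * X = - 1 / Z" by (rule eq_divide_imp[OF Z])
    then show ?thesis using Z by (simp add: P_def A0_eq mat_varpi_def mat2_simps)
  qed
  moreover have "P ** mat_\<beta> = mat 1 ** mat_\<beta> ** P" by (simp add: P_def mat_\<beta>_def mat2_simps)
  moreover have "det P \<noteq> 0" by (simp add: P_def mat2_simps)
  ultimately have cZ: "conj_to mat_\<beta> (mat_varpi Z)" using conj_to_trans[OF conj, of P 1] by simp
  show ?thesis
  proof (intro exI[of _ Z] allI iffI)
    fix z' assume "z' = Z \<or> z' = - Z"
    moreover have "conj_to mat_\<beta> (mat_varpi (- Z))"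
      by (rule conj_to_trans[OF cZ, of "mat 1" 1]) (simp_all add: psl_varpi_minus)
    ultimately show "z' \<noteq> 0 \<and> conj_to mat_\<beta> (mat_varpi z')" using cZ Z by auto
  next
    fix z' assume z': "z' \<noteq> 0 \<and> conj_to mat_\<beta> (mat_varpi z')"
    then obtain Q c where Q: "det Q \<noteq> 0" "c \<noteq> 0" "Q ** mat_\<beta> = mat c ** mat_\<beta> ** Q"
      "psl (Q ** mat_varpi Z) = psl (mat_varpi z' ** Q)"
      using conj_to_unique[OF cZ] by blast
    have "tr mat_\<beta> = tr (mat c ** mat_\<beta>)" using tr_conj[OF Q(3,1)] .
    then have "2 * c = 2 * 1" unfolding tr_scal by (simp add: mat_\<beta>_def mat2_simps)
    then have c: "c = 1" using two_nonzero mult_left_cancel by blast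
    obtain q1 q2 q3 q4 where Qe: "Q = mat2 q1 q2 q3 q4" by (rule mat2_cases)
    have "q3 = 0" "q4 = q1" using Q(3) unfolding c by (simp_all add: Qe mat_\<beta>_def mat2_simps)
    then have Qe': "Q = mat2 q1 q2 0 q1" using Qe by simp
    then have "q1 \<noteq> 0" using Q(1) by (auto simp: mat2_simps)
    have "q1 * Z = z' * q1 \<or> q1 * Z = - (z' * q1)"
      using Q(4) unfolding psl_eq_iff by (auto simp: Qe' mat_varpi_def mat2_simps)
    then have "q1 * Z = q1 * z' \<or> q1 * Z = q1 * (- z')" by (simp add: mult.commute)
    then have "Z = z' \<or> Z = - z'" using \<open>q1 \<noteq> 0\<close> mult_left_cancel by blast
    then show "z' = Z \<or> z' = - Z" by auto
  qed
qed

text \<open>With J = diag(1, -1), the trace against \<open>J\<close> is twice the first diagonal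
  entry. The constants r and q satisfy r + q = e and r - q = 1, the eigenvalues of \<alpha>.\<close>

lemma split_torus:
  "torus_map e w1 w2 \<iota> s \<Omega> \<rho> S A (mat2 1 0 0 (- 1)) (mat_\<alpha> e) (mat2 0 1 1 0) 1 1
    ((e + 1) / 2) ((e - 1) / 2) (CARD('a) - 1) mat_\<omega>_ii"
proof (intro torus_map.intro torus_map_axioms.intro matrix_map_axioms)
  have "(e + 1) / 2 + (e - 1) / 2 = e" "(e + 1) / 2 - (e - 1) / 2 = 1"
    using two_nonzero by (simp_all add: add_divide_distrib[symmetric] diff_divide_distrib[symmetric])
  then show "mat_\<alpha> e = mat ((e + 1) / 2) + mat ((e - 1) / 2) ** mat2 1 0 0 (- 1)"
    by (simp add: mat_\<alpha>_def mat2_simps)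
  show "det (mat_\<alpha> e) \<noteq> 0" using e_square by (simp add: det_alpha)
  show "CARD('a) - 1 > 0" using gt5 by simp
  show "scalar (mpow (mat_\<alpha> e) k) \<longleftrightarrow> CARD('a) - 1 dvd k" for k by (rule scalar_mpow_alpha[OF gen_e])
  show "det (mat_\<omega>_ii a) = 1" "tr (mat_\<omega>_ii a) = 0" "tr (mat2 1 0 0 (- 1) ** mat_\<omega>_ii a) = 1 * (2 * a)" for a
    by (simp_all add: mat_\<omega>_ii_def mat2_simps power2_eq_square)
  fix B :: "'a^2^2" and a :: 'a
  assume B: "tr B = 0" "det B = 1"
  obtain X Y Z where Be: "B = mat2 X Y Z (- X)" using traceless_cases[OF B(1)] .
  have det: "- (X * X) - Y * Z = 1" using B(2) by (simp add: Be mat2_simps)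
  have "Y * Z = - (X * X) - (- (X * X) - Y * Z)" by simp
  then have YZ: "Y * Z = - (X * X) - 1" unfolding det .
  have Xa: "X = a" if "tr (mat2 1 0 0 (- 1) ** B) = 2 * a"
  proof -
    have "2 * X = 2 * a" using that by (simp add: Be mat2_simps)
    then show ?thesis using two_nonzero mult_left_cancel by blast
  qed
  {
    assume "tr (mat2 1 0 0 (- 1) ** B) = 1 * (2 * a)" "a\<^sup>2 \<noteq> - 1"
    then have "X = a" "a\<^sup>2 + 1 \<noteq> 0" using Xa by (simp_all add: eq_neg_iff_add_eq_0)
    moreover have "- (a * a) - 1 = - (a\<^sup>2 + 1)" by (simp add: power2_eq_square)
    ultimately have a: "X = a" "- (X * X) - 1 \<noteq> 0" by (simp_all only: neg_equal_0_iff_equal not_False_eq_True)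
    then have Y: "Y \<noteq> 0" using YZ by auto
    have "Z = (- (X * X) - 1) / Y" using YZ Y by (simp add: eq_divide_eq mult.commute)
    then show "\<exists>P. det P \<noteq> 0 \<and> P ** mat2 1 0 0 (- 1) = mat2 1 0 0 (- 1) ** P \<and> P ** B = mat_\<omega>_ii a ** P"
      \<comment> \<open>A diagonal matrix scales \<open>Y\<close> to 1, and the determinant then
        fixes the last entry.\<close>
      using Y a by (intro exI[of _ "mat2 (1 / Y) 0 0 1"]) (simp add: Be mat_\<omega>_ii_def mat2_simps power2_eq_square)
  next
    assume "tr (mat2 1 0 0 (- 1) ** B) = 2 * a" "a\<^sup>2 = - 1"
    then have "- (X * X) - 1 = 0" using Xa by (simp add: power2_eq_square)
    then have "Y * Z = 0" using YZ by simp
    \<comment> \<open>Here \<open>B\<close> is triangular, so it shares a nilpotent line with the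
      diagonal torus.\<close>
    then have "\<exists>V. tr V = 0 \<and> V \<noteq> 0 \<and> B ** V = mat (- 1) ** V ** B \<and> (V = mat2 0 1 0 0 \<or> V = mat2 0 0 1 0)"
    proof (cases "Z = 0")
      case True
      then show ?thesis by (intro exI[of _ "mat2 0 1 0 0"]) (simp add: Be mat2_simps)
    next
      case False
      then have "Y = 0" using \<open>Y * Z = 0\<close> by simp
      then show ?thesis by (intro exI[of _ "mat2 0 0 1 0"]) (simp add: Be mat2_simps)
    qed
    then obtain V where V: "tr V = 0" "V \<noteq> 0" "B ** V = mat (- 1) ** V ** B" "V = mat2 0 1 0 0 \<or> V = mat2 0 0 1 0"
      by blast
    have "\<exists>l. D ** V = mat l ** V ** D" if D: "det D \<noteq> 0" "D ** mat2 1 0 0 (- 1) = mat2 1 0 0 (- 1) ** D" for D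
    proof -
      obtain d1 d2 d3 d4 where De: "D = mat2 d1 d2 d3 d4" by (rule mat2_cases)
      have "d2 + d2 = 0" "d3 + d3 = 0" using D(2) by (auto simp: De mat2_simps neg_eq_iff_add_eq_0 eq_neg_iff_add_eq_0)
      then have De: "D = mat2 d1 0 0 d4" using double_eq_0 De by auto
      then have "d1 \<noteq> 0" "d4 \<noteq> 0" using D(1) by (auto simp: mat2_simps)
      show ?thesis using V(4)
      proof
        assume "V = mat2 0 1 0 0"
        then show ?thesis using \<open>d4 \<noteq> 0\<close> by (intro exI[of _ "d1 / d4"]) (simp add: De mat2_simps)
      next
        assume "V = mat2 0 0 1 0"
        then show ?thesis using \<open>d1 \<noteq> 0\<close> by (intro exI[of _ "d4 / d1"]) (simp add: De mat2_simps)
      qed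
    qed
    then show "\<exists>V. tr V = 0 \<and> V \<noteq> 0 \<and> (\<exists>l. B ** V = mat l ** V ** B) \<and>
        (\<forall>X. det X \<noteq> 0 \<longrightarrow> X ** mat2 1 0 0 (- 1) = mat2 1 0 0 (- 1) ** X \<longrightarrow> (\<exists>l. X ** V = mat l ** V ** X))"
      using V(1-3) by blast
  }
qed (simp_all add: mat2_simps)

text \<open>\<open>J\<close> is multiplication by sqrt(e). The sign \<kappa> is -1 because the trace
  of \<open>J\<close> times the normal form is y - (2a + y) = -2a.\<close>

lemma nonsplit_torus:
  assumes xy: "\<And>a. (y a + a)\<^sup>2 - e * (x a)\<^sup>2 = a\<^sup>2 + e"
  shows "torus_map e w1 w2 \<iota> s \<Omega> \<rho> S A (mat2 0 e 1 0) g0 (mat2 1 0 0 (- 1)) e (- 1)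
    (w1 / w2) 1 (CARD('a) + 1) (\<lambda>a. mat_\<omega>t_ii e (x a) (y a) a)"
proof (intro torus_map.intro torus_map_axioms.intro matrix_map_axioms)
  have e: "e \<noteq> 0" using e_square by blast
  then show "e \<noteq> 0" .
  show "g0 = mat (w1 / w2) + mat 1 ** mat2 0 e 1 0" by (simp add: mat_\<gamma>_def mat2_simps)
  show "det g0 \<noteq> 0" by (rule det_gamma)
  show "scalar (mpow g0 k) \<longleftrightarrow> CARD('a) + 1 dvd k" for k by (rule scalar_mpow_gamma)
  show "det (mat_\<omega>t_ii e (x a) (y a) a) = 1" for a
  proof -
    have "y a * (2 * a + y a) - e * (x a)\<^sup>2 = (y a + a)\<^sup>2 - e * (x a)\<^sup>2 - a\<^sup>2"
      by (simp add: power2_eq_square algebra_simps)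
    also have "\<dots> = e" unfolding xy by simp
    finally have "(y a * (2 * a + y a) - e * (x a)\<^sup>2) / e = 1" using e by simp
    moreover have "(y a * (2 * a + y a) - e * (x a)\<^sup>2) / e = y a * ((2 * a + y a) / e) - x a * x a"
      using e by (simp add: diff_divide_distrib power2_eq_square)
    moreover have "- (2 * a + y a) / e = - ((2 * a + y a) / e)" by (rule minus_divide_left[symmetric])
    ultimately show ?thesis unfolding mat_\<omega>t_ii_def det_mat2 by simp
  qed
  show "tr (mat_\<omega>t_ii e (x a) (y a) a) = 0" "tr (mat2 0 e 1 0 ** mat_\<omega>t_ii e (x a) (y a) a) = - 1 * (2 * a)" for a
    using e by (simp_all add: mat_\<omega>t_ii_def mat2_mult tr_mat2)
  fix B :: "'a^2^2" and a :: 'a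
  assume B: "tr B = 0" "det B = 1"
  obtain X Y Z where Be: "B = mat2 X Y Z (- X)" using traceless_cases[OF B(1)] .
  have det: "- (X * X) - Y * Z = 1" using B(2) by (simp add: Be mat2_simps)
  have norm: "(Y - h)\<^sup>2 - e * X\<^sup>2 = h\<^sup>2 + e \<and> Z = (2 * h - Y) / e" if "Y + e * Z = 2 * h" for h
  proof -
    have eZ: "e * Z = 2 * h - Y" using that by (simp add: algebra_simps)
    have "e * 1 = e * (- (X * X) - Y * Z)" unfolding det ..
    also have "\<dots> = - (e * (X * X)) - Y * (e * Z)" by (simp add: algebra_simps)
    finally have "e = - (e * (X * X)) - Y * (2 * h - Y)" unfolding eZ by simp
    then have "h\<^sup>2 + e = h\<^sup>2 + (- (e * (X * X)) - Y * (2 * h - Y))" by simp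
    also have "\<dots> = (Y - h)\<^sup>2 - e * X\<^sup>2" by (simp add: power2_eq_square algebra_simps)
    finally show ?thesis using eZ e by (simp add: eq_divide_eq mult.commute)
  qed
  have trJ: "tr (mat2 0 e 1 0 ** B) = Y + e * Z" by (simp add: Be mat2_simps add.commute)
  {
    assume t: "tr (mat2 0 e 1 0 ** B) = - 1 * (2 * a)" and a: "a\<^sup>2 \<noteq> - e"
    then have "Y + e * Z = 2 * (- a)" using trJ by simp
    from norm[OF this] have N1: "(Y + a)\<^sup>2 - e * X\<^sup>2 = a\<^sup>2 + e" and Z: "Z = (2 * (- a) - Y) / e" by auto
    \<comment> \<open>\<open>B\<close> and the normal form are their parts orthogonal to
      \<open>J\<close> minus (a/e) J. These parts have coordinates (X, b) and (x a, c), and both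
      have square \<open>N\<close>.\<close>
    define b c i N where "b = Y + a" and "c = y a + a" and "i = 1 / e" and "N = - (a\<^sup>2 + e) * i"
    have ei: "e * i = 1" using e by (simp add: i_def)
    have "a\<^sup>2 + e \<noteq> 0" using a by (simp add: eq_neg_iff_add_eq_0)
    then have N0: "N \<noteq> 0"
      unfolding N_def mult_eq_0_iff neg_equal_0_iff_equal using e by (simp add: i_def)
    have N_norm: "N = X' * X' - h * h * i" if "h\<^sup>2 - e * X'\<^sup>2 = a\<^sup>2 + e" for h X'
    proof -
      have "N = (e * i) * (X' * X') - h * h * i"
        unfolding N_def that[symmetric] by (simp add: algebra_simps power2_eq_square)
      then show ?thesis unfolding ei by simp
    qed
    have NX: "N = X * X - b * b * i" "N = x a * x a - c * c * i"
      unfolding b_def c_def by (rule N_norm[OF N1], rule N_norm[OF xy])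
    \<comment> \<open>Let B1 and F1 be the orthogonal parts of \<open>B\<close> and of the normal
      form. The matrix F1 B1 + N, which is u + vJ, intertwines B1 and F1 because both squares are
      \<open>N\<close>, and it commutes with \<open>J\<close> because both parts anticommute with
      \<open>J\<close>.\<close>
    define u v E where "u = x a * X - c * b * i + N" and "v = (x a * b - c * X) * i" and "E = e * v"
    have "E = (e * i) * (x a * b - c * X)" by (simp add: E_def v_def)
    then have E: "E = x a * b - c * X" unfolding ei by simp
    have vE: "v = i * E" unfolding E v_def by (rule mult.commute)
    have u1: "u * X - v * b = N * (x a + X)"
    proof -
      have "u * X - v * b = x a * (X * X - b * b * i) + N * X"
        by (simp add: u_def v_def algebra_simps)
      then show ?thesis unfolding NX(1)[symmetric] by (simp add: algebra_simps)
    qed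
    have u2: "x a * u + c * v = N * (x a + X)"
    proof -
      have "x a * u + c * v = X * (x a * x a - c * c * i) + N * x a"
        by (simp add: u_def v_def algebra_simps)
      then show ?thesis unfolding NX(2)[symmetric] by (simp add: algebra_simps)
    qed
    have u3: "u * b - E * X = N * (b + c)"
    proof -
      have "u * b - E * X = c * (X * X - b * b * i) + N * b"
        unfolding E by (simp add: u_def algebra_simps)
      then show ?thesis unfolding NX(1)[symmetric] by (simp add: algebra_simps)
    qed
    have u4: "x a * E + c * u = N * (b + c)"
    proof -
      have "x a * E + c * u = b * (x a * x a - c * c * i) + N * c"
        unfolding E by (simp add: u_def algebra_simps)
      then show ?thesis unfolding NX(2)[symmetric] by (simp add: algebra_simps)
    qed
    have "2 * (- a) - Y = - (a + b)" "2 * a + y a = a + c" by (simp_all add: b_def c_def)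
    then have "Y = b - a" "Z = - (a + b) * i" "y a = c - a" "- (2 * a + y a) / e = - (a + c) * i"
      unfolding Z by (simp_all add: b_def c_def i_def)
    then have Be': "B = mat2 X (b - a) (- (a + b) * i) (- X)"
      and nf': "mat_\<omega>t_ii e (x a) (y a) a = mat2 (x a) (c - a) (- (a + c) * i) (- x a)"
      unfolding Be mat_\<omega>t_ii_def by (simp_all only:)
    show "\<exists>P. det P \<noteq> 0 \<and> P ** mat2 0 e 1 0 = mat2 0 e 1 0 ** P \<and> P ** B = mat_\<omega>t_ii e (x a) (y a) a ** P"
    proof (cases "u = 0 \<and> v = 0")
      \<comment> \<open>The intertwiner vanishes when F1 = -B1; then \<open>J\<close> itself serves,
        since it negates the orthogonal part and fixes the rest.\<close>
      case True
      then have "x a + X = 0" "b + c = 0" using u1 u3 N0 by (simp_all add: E_def)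
      then have X: "X = - x a" and b: "b = - c" by (simp add: add_eq_0_iff, simp add: add_eq_0_iff2)
      have "e * (- (a + - c) * i) = (e * i) * (c - a)" "- (a + c) * i * e = (e * i) * (- c - a)"
        by (simp_all add: algebra_simps)
      then have "mat2 0 e 1 0 ** B = mat_\<omega>t_ii e (x a) (y a) a ** mat2 0 e 1 0"
        unfolding Be' nf' X b mat2_mult ei by simp
      moreover have "det (mat2 0 e 1 0) \<noteq> 0" using e by (simp add: mat2_simps)
      ultimately show ?thesis by blast
    next
      case False
      define P where "P = mat2 u E v u"
      have "det P = u\<^sup>2 - e * v\<^sup>2" by (simp add: P_def E_def mat2_simps power2_eq_square)
      then have "det P \<noteq> 0" using torus_det_nonzero[of u v] False by simp
      moreover have "P ** mat2 0 e 1 0 = mat2 0 e 1 0 ** P" by (simp add: P_def E_def mat2_simps mult.commute)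
      moreover have "P ** B = mat_\<omega>t_ii e (x a) (y a) a ** P"
      proof -
        have 1: "u * X - v * b = x a * u + c * v" and 2: "u * b - E * X = x a * E + c * u"
          using u1 u2 u3 u4 by simp_all
        have e1: "u * X + E * (- (a + b) * i) = x a * u + (c - a) * v"
        proof -
          have "u * X + E * (- (a + b) * i) = u * X - v * b - v * a" unfolding vE by (simp add: algebra_simps)
          then show ?thesis unfolding 1 by (simp add: algebra_simps)
        qed
        have e2: "u * (b - a) + E * (- X) = x a * E + (c - a) * u"
        proof -
          have "u * (b - a) + E * (- X) = u * b - E * X - u * a" by (simp add: algebra_simps)
          then show ?thesis unfolding 2 by (simp add: algebra_simps)
        qed
        have e3: "v * X + u * (- (a + b) * i) = - (a + c) * i * u + (- x a) * v"
        proof -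
          have "v * X + u * (- (a + b) * i) = i * (- (u * b - E * X) - u * a)" unfolding vE by (simp add: algebra_simps)
          then show ?thesis unfolding 2 unfolding vE by (simp add: algebra_simps)
        qed
        have e4: "v * (b - a) + u * (- X) = - (a + c) * i * E + (- x a) * u"
        proof -
          have "v * (b - a) + u * (- X) = - (u * X - v * b) - v * a" by (simp add: algebra_simps)
          then show ?thesis unfolding 1 unfolding vE by (simp add: algebra_simps)
        qed
        show ?thesis unfolding P_def Be' nf' mat2_mult e1 e2 e3 e4 ..
      qed
      ultimately show ?thesis by blast
    qed
  next
    assume t: "tr (mat2 0 e 1 0 ** B) = 2 * a" and a: "a\<^sup>2 = - e"
    then have "Y + e * Z = 2 * a" using trJ by simp
    from norm[OF this] have N1: "(Y - a)\<^sup>2 - e * X\<^sup>2 = 0" and Z: "Z = (2 * a - Y) / e" using a by auto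
    \<comment> \<open>Anisotropy of the norm form leaves only a multiple of \<open>J\<close>, so the
      line of \<open>J\<close> is the invariant one.\<close>
    then have "Y - a = 0" "X = 0" using torus_det_nonzero[of "Y - a" X] by blast+
    then have "B = mat2 0 a (a / e) 0" unfolding Be Z by simp
    then have "B ** mat2 0 e 1 0 = mat 1 ** mat2 0 e 1 0 ** B" using e by (simp add: mat2_simps)
    moreover have "D ** mat2 0 e 1 0 = mat 1 ** mat2 0 e 1 0 ** D" if "D ** mat2 0 e 1 0 = mat2 0 e 1 0 ** D" for D :: "'a^2^2"
      using that by simp
    moreover have "mat2 0 e 1 0 \<noteq> (0 :: 'a^2^2)" "tr (mat2 0 e 1 0) = 0" by (simp_all add: mat2_simps)
    ultimately show "\<exists>V. tr V = 0 \<and> V \<noteq> 0 \<and> (\<exists>l. B ** V = mat l ** V ** B) \<and>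
        (\<forall>X. det X \<noteq> 0 \<longrightarrow> X ** mat2 0 e 1 0 = mat2 0 e 1 0 ** X \<longrightarrow> (\<exists>l. X ** V = mat l ** V ** X))"
      by blast
  }
qed (simp_all add: mat2_simps)

end

theorem theorem4p4:
  fixes e w1 w2 w :: "'a::{field,finite}"
    and \<iota> :: "'a \<Rightarrow> 'b::{field,finite}" and sqrt_e :: 'b
    and x y :: "'a \<Rightarrow> 'a"
    and \<Omega> :: "('a^2^2) set set" and \<rho> :: "('a^2^2) set \<Rightarrow> ('a^2^2) set"
    and M :: "(('a^2^2) set, ('a^2^2) set \<times> ('a^2^2) set) oriented_map"
    and p n :: nat
  assumes "p = CARD('a)" and "prime p" and "p > 5"
    and "generates_units e"
    and "CARD('b) = p\<^sup>2" and "field_embedding \<iota>" and "sqrt_e\<^sup>2 = \<iota> e"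
    and "generates_units (\<iota> w1 + \<iota> w2 * sqrt_e)" and "w = w1 / w2"
    and "\<forall>a. (y a + a)\<^sup>2 - e * (x a)\<^sup>2 = a\<^sup>2 + e"
    and "cayley_map_data PSL2 \<Omega> \<rho>" and "card \<Omega> = n"
    and "M = cayley_map PSL2 \<Omega> \<rho>"
    and "regular_map M" and "balanced PSL2 \<Omega> \<rho>" and "type_II PSL2 \<Omega>"
  shows "n dvd p * (p\<^sup>2 - 1) \<and>
    (n = p \<longrightarrow>
      (\<exists>z::'a. \<forall>z'.
        (z' \<noteq> 0 \<and>
         CM_valid (pgl mat_\<beta>) (psl (mat_varpi z')) \<and>
         M \<cong>\<^sub>M CM (pgl mat_\<beta>) (psl (mat_varpi z')))
        \<longleftrightarrow> z' = z \<or> z' = - z)) \<and>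
    (n dvd p - 1 \<longrightarrow>
      (\<exists>a u. \<forall>a' (u'::nat).
        (a' \<noteq> 0 \<and> a'\<^sup>2 \<noteq> - 1 \<and>
         gcd u' n = 1 \<and> 1 \<le> u' \<and> 2 * u' < n \<and>
         (n = 3 \<longrightarrow> 3 * a'\<^sup>2 \<noteq> - 1 \<and> 3 * a'\<^sup>2 \<noteq> - 2 \<and> 9 * a' ^ 4 + 9 * a'\<^sup>2 + 1 \<noteq> 0) \<and>
         (n = 5 \<longrightarrow> 5 * a' ^ 4 + 5 * a'\<^sup>2 + 1 \<noteq> 0) \<and>
         CM_valid (pgl (mat_\<alpha> e) [^]\<^bsub>PGL2\<^esub> ((p - 1) * u' div n)) (psl (mat_\<omega>_ii a')) \<and>
         M \<cong>\<^sub>M CM (pgl (mat_\<alpha> e) [^]\<^bsub>PGL2\<^esub> ((p - 1) * u' div n)) (psl (mat_\<omega>_ii a')))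
        \<longleftrightarrow> (a' = a \<or> a' = - a) \<and> u' = u)) \<and>
    (n dvd p + 1 \<longrightarrow>
      (\<exists>a v. \<forall>a' (v'::nat).
        (a' \<noteq> 0 \<and> a'\<^sup>2 \<noteq> - e \<and>
         gcd v' n = 1 \<and> 1 \<le> v' \<and> 2 * v' < n \<and>
         (n = 3 \<longrightarrow> 3 * a'\<^sup>2 \<noteq> - e \<and> 3 * a'\<^sup>2 \<noteq> - 2 * e \<and>
                    9 * a' ^ 4 + 9 * a'\<^sup>2 * e + e\<^sup>2 \<noteq> 0) \<and>
         (n = 5 \<longrightarrow> 5 * a' ^ 4 + 5 * a'\<^sup>2 * e + e\<^sup>2 \<noteq> 0) \<and>
         CM_valid (pgl (mat_\<gamma> e w) [^]\<^bsub>PGL2\<^esub> ((p + 1) * v' div n))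
           (psl (mat_\<omega>t_ii e (x a') (y a') a')) \<and>
         M \<cong>\<^sub>M CM (pgl (mat_\<gamma> e w) [^]\<^bsub>PGL2\<^esub> ((p + 1) * v' div n))
           (psl (mat_\<omega>t_ii e (x a') (y a') a')))
        \<longleftrightarrow> (a' = a \<or> a' = - a) \<and> v' = v))"
proof -
  interpret quadratic_extension e w1 w2 \<iota> sqrt_e
    by unfold_locales (use assms in simp_all)
  have "group (PSL2 :: ('a^2^2) set monoid)" using assms(11) by (simp add: cayley_map_data_def)
  then have map: "involutory_cayley_map PSL2 \<Omega> \<rho>"
    by (intro involutory_cayley_map.intro involutory_cayley_map_axioms.intro assms(11,16))
  obtain S A where "matrix_map e w1 w2 \<iota> sqrt_e \<Omega> \<rho> S A"
    using regular_matrix_map[OF map] assms(13,14) by blast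
  then interpret matrix_map e w1 w2 \<iota> sqrt_e \<Omega> \<rho> S A .
  have p: "p = CARD('a)" and n: "n = card \<Omega>" and M: "M = cayley_map PSL2 \<Omega> \<rho>" and w: "w = w1 / w2"
    using assms by simp_all
  have CM: "CM_valid (pgl S') (psl A') \<and> M \<cong>\<^sub>M CM (pgl S') (psl A') \<longleftrightarrow> conj_to S' A'"
    if "det S' \<noteq> 0" "det A' = 1" "tr A' = 0" for S' A'
    unfolding M conj_to_def by (rule iso_CM_iff[OF that])
  interpret split: torus_map e w1 w2 \<iota> sqrt_e \<Omega> \<rho> S A "mat2 1 0 0 (- 1)" "mat_\<alpha> e" "mat2 0 1 1 0" 1 1
    "(e + 1) / 2" "(e - 1) / 2" "CARD('a) - 1" mat_\<omega>_ii
    by (rule split_torus)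
  interpret nonsplit: torus_map e w1 w2 \<iota> sqrt_e \<Omega> \<rho> S A "mat2 0 e 1 0" g0 "mat2 1 0 0 (- 1)" e "- 1"
    "w1 / w2" 1 "CARD('a) + 1" "\<lambda>a. mat_\<omega>t_ii e (x a) (y a) a"
    by (rule nonsplit_torus) (use assms(10) in blast)
  \<comment> \<open>At z = 0 the determinant is 0, since division by zero yields 0; so the
    equivalence retains \<open>z' \<noteq> 0\<close> on both sides.\<close>
  have "det (mat_varpi z) = 1" "tr (mat_varpi z) = 0" if "z \<noteq> 0" for z :: 'a
    using that by (simp_all add: mat_varpi_def mat2_simps)
  then have eq1: "z' \<noteq> 0 \<and> CM_valid (pgl mat_\<beta>) (psl (mat_varpi z')) \<and> M \<cong>\<^sub>M CM (pgl mat_\<beta>) (psl (mat_varpi z'))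
      \<longleftrightarrow> z' \<noteq> 0 \<and> conj_to mat_\<beta> (mat_varpi z')" for z'
    using CM[of mat_\<beta> "mat_varpi z'"] by auto
  have eq2: "(a' \<noteq> 0 \<and> a'\<^sup>2 \<noteq> - 1 \<and> gcd u' n = 1 \<and> 1 \<le> u' \<and> 2 * u' < n \<and>
       (n = 3 \<longrightarrow> 3 * a'\<^sup>2 \<noteq> - 1 \<and> 3 * a'\<^sup>2 \<noteq> - 2 \<and> 9 * a' ^ 4 + 9 * a'\<^sup>2 + 1 \<noteq> 0) \<and>
       (n = 5 \<longrightarrow> 5 * a' ^ 4 + 5 * a'\<^sup>2 + 1 \<noteq> 0) \<and>
       CM_valid (pgl (mat_\<alpha> e) [^]\<^bsub>PGL2\<^esub> ((p - 1) * u' div n)) (psl (mat_\<omega>_ii a')) \<and>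
       M \<cong>\<^sub>M CM (pgl (mat_\<alpha> e) [^]\<^bsub>PGL2\<^esub> ((p - 1) * u' div n)) (psl (mat_\<omega>_ii a')))
      \<longleftrightarrow> split.admissible a' u' \<and> conj_to (mpow (mat_\<alpha> e) ((CARD('a) - 1) * u' div card \<Omega>)) (mat_\<omega>_ii a')"
    for a' u'
  proof -
    have "det (mpow (mat_\<alpha> e) ((p - 1) * u' div n)) \<noteq> 0" using split.det_T by simp
    note c = CM[OF this split.nf(1,2)[of a']]
    show ?thesis unfolding pow_PGL2 c split.admissible_def unfolding n p by simp
  qed
  have eq3: "(a' \<noteq> 0 \<and> a'\<^sup>2 \<noteq> - e \<and> gcd v' n = 1 \<and> 1 \<le> v' \<and> 2 * v' < n \<and>
       (n = 3 \<longrightarrow> 3 * a'\<^sup>2 \<noteq> - e \<and> 3 * a'\<^sup>2 \<noteq> - 2 * e \<and>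
                  9 * a' ^ 4 + 9 * a'\<^sup>2 * e + e\<^sup>2 \<noteq> 0) \<and>
       (n = 5 \<longrightarrow> 5 * a' ^ 4 + 5 * a'\<^sup>2 * e + e\<^sup>2 \<noteq> 0) \<and>
       CM_valid (pgl (mat_\<gamma> e w) [^]\<^bsub>PGL2\<^esub> ((p + 1) * v' div n))
         (psl (mat_\<omega>t_ii e (x a') (y a') a')) \<and>
       M \<cong>\<^sub>M CM (pgl (mat_\<gamma> e w) [^]\<^bsub>PGL2\<^esub> ((p + 1) * v' div n))
         (psl (mat_\<omega>t_ii e (x a') (y a') a')))
      \<longleftrightarrow> nonsplit.admissible a' v' \<and>
        conj_to (mpow g0 ((CARD('a) + 1) * v' div card \<Omega>)) (mat_\<omega>t_ii e (x a') (y a') a')"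
    for a' v'
  proof -
    have "det (mpow g0 ((p + 1) * v' div n)) \<noteq> 0" using nonsplit.det_T by simp
    note c = CM[OF this nonsplit.nf(1,2)[of a']]
    show ?thesis unfolding w pow_PGL2 c nonsplit.admissible_def unfolding n p by simp
  qed
  show ?thesis
    unfolding eq1 eq2 eq3
  proof (intro conjI impI)
    show "n dvd p * (p\<^sup>2 - 1)" unfolding p n by (rule order_dvd)
  next
    assume "n = p"
    then have np: "card \<Omega> = CARD('a)" using n p by simp
    obtain A0 where A0: "conj_to mat_\<beta> A0" "det A0 = 1"
      by (cases rule: order_cases) (use np orders_exclusive in blast)+
    then show "\<exists>z::'a. \<forall>z'. (z' \<noteq> 0 \<and> conj_to mat_\<beta> (mat_varpi z')) = (z' = z \<or> z' = - z)"
      by (rule conj_to_unipotent_normal_form)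
  next
    assume "n dvd p - 1"
    then have nd: "card \<Omega> dvd CARD('a) - 1" unfolding n p .
    obtain A0 k where A0: "conj_to (mpow (mat_\<alpha> e) k) A0" "det A0 = 1"
      by (cases rule: order_cases) (use nd orders_exclusive in blast)+
    note split.normal_form[OF nd A0]
    then show "\<exists>a u. \<forall>a' u'. (split.admissible a' u' \<and>
        conj_to (mpow (mat_\<alpha> e) ((CARD('a) - 1) * u' div card \<Omega>)) (mat_\<omega>_ii a')) =
        ((a' = a \<or> a' = - a) \<and> u' = u)" .
  next
    assume "n dvd p + 1"
    then have nd: "card \<Omega> dvd CARD('a) + 1" unfolding n p .
    obtain A0 k where A0: "conj_to (mpow g0 k) A0" "det A0 = 1"
      by (cases rule: order_cases) (use nd orders_exclusive in blast)+
    note nonsplit.normal_form[OF nd A0]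
    then show "\<exists>a v. \<forall>a' v'. (nonsplit.admissible a' v' \<and>
        conj_to (mpow g0 ((CARD('a) + 1) * v' div card \<Omega>)) (mat_\<omega>t_ii e (x a') (y a') a')) =
        ((a' = a \<or> a' = - a) \<and> v' = v)" .
  qed
qed

end
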